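(* Let $I=[-\tfrac12,\tfrac12]$, $\Sigma=I\times I$, and $F(x,y)=(T(x),G(x,y))$ satisfy: (1) there are $c\in I$, $k\ge0$ with $|G(x_1,y)-G(x_2,y)|\le k|x_1-x_2|$ for all $y$ whenever $c\notin[x_1,x_2]$; (2) $|G(x,y_1)-G(x,y_2)|\le\lambda|y_1-y_2|$ with $\lambda<1$; (3) $T:I\to I$ is onto with two $C^1$ increasing branches on $[-\tfrac12,c)$, $(c,\tfrac12]$, $T'>1$ where defined, $\lim_{x\to c^-}T(x)=\tfrac12$, $\lim_{x\to c^+}T(x)=-\tfrac12$, $T(c)=-\tfrac12$, $\lim_{x\to c}T'(x)=\infty$; (4) $1/T'$ has bounded variation. Let $\mu_0$ be a $K$-good probability measure on $\Sigma$ whose marginal on the $x$-axis has a bounded-variation density $\overline f_0$, and let $C_{\overline f_0}$ be a constant such that for every $n\ge0$ the density of $(T^n)_*(\overline f_0\,m)$ has variation at most $C_{\overline f_0}$ ($m$ Lebesgue measure on $I$). Let $\mu_n=(F^n)_*\mu_0$. Then each $\mu_n$ is $K'$-good, where $$K'=\max\Big(K,\ \frac{3+C_{\overline f_0}+(C_{\overline f_0}+1)\operatorname{Var}(1/T')+2k(C_{\overline f_0}+1)}{1-\lambda}\Big).$$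
   Context: Vertical leaves are $\gamma=\{\gamma\}\times I$. For a finite measure $\mu$ on $\Sigma$ disintegrated as $\mu(A)=\int_I\mu_\gamma(A\cap\gamma)\,\phi_x(\gamma)\,d\gamma$ (with $\mu_\gamma$ probability measures on leaves and $\phi_x$ the density of the marginal), the restriction to the leaf is the (non-normalized) measure on $I$ given by $\mu|_\gamma=(\pi_y)_*(\phi_x(\gamma)\mu_\gamma)$, where $\pi_y(x,y)=y$. On the space $M(I)$ of finite Borel measures on $I$ let $W_1^0(\mu,\nu)=\sup\{|\int g\,d\mu-\int g\,d\nu|: g \text{ 1-Lipschitz on } I,\ \|g\|_\infty\le1\}$. For $G:I\to M(I)$, $\operatorname{Var}(G)=\sup\sum_i W_1^0(G(x_i),G(x_{i+1}))$ over finite increasing sequences $x_1<\dots<x_n$ in $I$. A measure $\mu$ on $\Sigma$ is $K$-good if $G_\mu(\gamma)=\mu|_\gamma$ is defined for every $\gamma\in I$ and $\operatorname{Var}(G_\mu)\le K$. *)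

theory Defs
  imports "HOL-Probability.Probability"
begin

definition Iv :: "real set" where
  "Iv = {-1/2..1/2}"

definition Sigma_sq :: "(real \<times> real) set" where
  "Sigma_sq = Iv \<times> Iv"

definition incr_seqs :: "real set \<Rightarrow> real list set" where
  "incr_seqs S = {xs. sorted_wrt (<) xs \<and> set xs \<subseteq> S}"

definition var_on :: "real set \<Rightarrow> (real \<Rightarrow> real) \<Rightarrow> ereal" where
  "var_on S f = (SUP xs \<in> incr_seqs S.
      ereal (\<Sum>i < length xs - 1. \<bar>f (xs ! i) - f (xs ! Suc i)\<bar>))"

text \<open>Measures in M(I) are measures with sets = Borel sets of I.
  W_1^0 (dual Wasserstein-like distance).\<close>
definition W10 :: "real measure \<Rightarrow> real measure \<Rightarrow> ereal" where
  "W10 \<mu> \<nu> = (SUP g \<in> {g. 1-lipschitz_on Iv g \<and> (\<forall>x\<in>Iv. \<bar>g x\<bar> \<le> 1)}.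
      ereal \<bar>integral\<^sup>L \<mu> g - integral\<^sup>L \<nu> g\<bar>)"

definition VarM :: "(real \<Rightarrow> real measure) \<Rightarrow> ereal" where
  "VarM G = (SUP xs \<in> incr_seqs Iv.
      (\<Sum>i < length xs - 1. W10 (G (xs ! i)) (G (xs ! Suc i))))"

text \<open>K-good: there is a disintegration (phi, nu) of mu along vertical leaves,
  defined for every gamma in I, with phi the marginal density and nu gamma
  probability measures on the leaf (identified with I via pi_y), such that
  gamma |-> mu|_gamma = phi(gamma) nu_gamma has variation at most K.\<close>
definition K_good :: "real \<Rightarrow> (real \<times> real) measure \<Rightarrow> bool" where
  "K_good K \<mu> \<longleftrightarrow>
     (\<exists>(\<phi>::real \<Rightarrow> real) (\<nu>::real \<Rightarrow> real measure).
        (\<forall>\<gamma>\<in>Iv. 0 \<le> \<phi> \<gamma> \<and> prob_space (\<nu> \<gamma>)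
                   \<and> sets (\<nu> \<gamma>) = sets (restrict_space borel Iv)) \<and>
        (\<forall>A\<in>sets \<mu>. emeasure \<mu> A =
           (\<integral>\<^sup>+ \<gamma>. emeasure (\<nu> \<gamma>) {y\<in>Iv. (\<gamma>, y) \<in> A} * ennreal (\<phi> \<gamma>)
                   * indicator Iv \<gamma> \<partial>lborel)) \<and>
        VarM (\<lambda>\<gamma>. scale_measure (ennreal (\<phi> \<gamma>)) (\<nu> \<gamma>)) \<le> ereal K)"

end

theory Submission
  imports Defs
begin

text \<open>
  The restriction of \<open>F\<^sub>* \<mu>\<close> to the leaf over \<open>y\<close> is the sum, over the two preimages \<open>x\<close> of \<open>y\<close> under
  \<open>T\<close>, of the push-forward of \<open>\<mu>|\<^sub>x\<close> under \<open>G x\<close> with weight \<open>1 / T' x\<close>. It suffices to show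
  \<open>Var(F\<^sub>* \<mu>) \<le> lam Var(\<mu>) + C + (1 + C) V + k (1 + C)\<close>, where \<open>V = Var(1 / T')\<close> and \<open>C\<close> bounds the
  variation of the marginal densities \<open>\<phi>\<close> of \<open>\<mu>\<close> and \<open>\<phi>\<^sub>1\<close> of \<open>F\<^sub>* \<mu>\<close>: then \<open>Var \<le> K'\<close> is preserved.

  A test function \<open>g\<close> on \<open>Iv\<close> is \<open>g 0\<close> plus a function bounded by \<open>1/2\<close>. The constant contributes at most
  \<open>Var(\<phi>\<^sub>1) \<le> C\<close>. The rest, composed with \<open>G x\<close>, is a constant of modulus at most \<open>(1 - lam) / 2\<close> plus
  \<open>lam\<close> times a test function bounded by \<open>1/2\<close>. This yields \<open>lam Var(\<mu>)\<close>, the term in \<open>k\<close>, half of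
  \<open>lam (1 + C) Var(w)\<close> and half of \<open>(1 - lam) Var(w \<phi>)\<close>, where \<open>w = 1 / T'\<close> is extended by \<open>0\<close> to \<open>c\<close> and to
  both sides of \<open>Iv\<close>, which accounts for the jump at the end of the left branch. Since \<open>w\<close> vanishes at
  \<open>c\<close>, \<open>Var(w) \<le> 2 V\<close>; since \<open>\<phi>\<close> has mean \<open>1\<close>, the values at the ends of an interval and the variation
  on it add up to at most \<open>2 (1 + C)\<close>, and slicing \<open>w\<close> horizontally gives
  \<open>Var(w \<phi>) \<le> (1 + C) Var(w)\<close>.

  The density with variation at most \<open>C\<close> is only almost everywhere equal to the \<open>\<phi>\<^sub>1\<close> computed from the
  preimages. Hence variations are first estimated along a conull set, and the leaf measures off this set
  are redefined as weak limits.
\<close>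

section \<open>Variation along increasing sequences\<close>

text \<open>Weak monotonicity is allowed because inverse branches and clamped points may repeat
  values. Each step has its own \<open>g i\<close>, so that one bound covers a sum of suprema. With
  \<open>\<Gamma> = UNIV\<close> over type \<open>unit\<close> this is the ordinary
  variation.\<close>

definition seq_var_le :: "real set \<Rightarrow> 'g set \<Rightarrow> (real \<Rightarrow> 'g \<Rightarrow> real) \<Rightarrow> real \<Rightarrow> bool" where
  "seq_var_le D \<Gamma> J K \<longleftrightarrow> (\<forall>N s g. (\<forall>i\<le>N. s i \<in> D) \<longrightarrow> (\<forall>i<N. s i \<le> s (Suc i)) \<longrightarrow>
     (\<forall>i<N. g i \<in> \<Gamma>) \<longrightarrow> (\<Sum>i<N. \<bar>J (s i) (g i) - J (s (Suc i)) (g i)\<bar>) \<le> K)"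

definition tests :: "(real \<Rightarrow> real) set" where
  "tests = {g. 1-lipschitz_on Iv g \<and> (\<forall>x\<in>Iv. \<bar>g x\<bar> \<le> 1)}"

lemma seq_var_leD:
  fixes N :: nat
  assumes "seq_var_le D \<Gamma> J K" "\<And>i. i \<le> N \<Longrightarrow> s i \<in> D" "\<And>i. i < N \<Longrightarrow> s i \<le> s (Suc i)"
    "\<And>i. i < N \<Longrightarrow> g i \<in> \<Gamma>"
  shows "(\<Sum>i<N. \<bar>J (s i) (g i) - J (s (Suc i)) (g i)\<bar>) \<le> K"
  using assms unfolding seq_var_le_def by blast

lemma seq_var_le_two:
  assumes "seq_var_le D \<Gamma> J K" "x \<in> D" "y \<in> D" "g \<in> \<Gamma>"
  shows "\<bar>J x g - J y g\<bar> \<le> K"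
proof -
  have *: "\<bar>J x g - J y g\<bar> \<le> K" if "x \<le> y" "x \<in> D" "y \<in> D" for x y
    using seq_var_leD[OF assms(1), of 1 "\<lambda>i. if i = 0 then x else y" "\<lambda>_. g"] that assms(4)
    by auto
  show ?thesis
    using *[of x y] *[of y x] assms by (cases "x \<le> y") (auto simp: abs_minus_commute)
qed

lemma seq_var_le_subset:
  "seq_var_le D \<Gamma> J K \<Longrightarrow> D' \<subseteq> D \<Longrightarrow> seq_var_le D' \<Gamma> J K"
  unfolding seq_var_le_def by (meson subsetD)

text \<open>Repetitions in a weakly increasing sequence contribute nothing, so it can be compressed
  to a strictly increasing list.\<close>

lemma compress_sequence:
  fixes s :: "nat \<Rightarrow> real" and J :: "real \<Rightarrow> 'g \<Rightarrow> real"
  assumes "\<forall>i\<le>N. s i \<in> D" "\<forall>i<N. s i \<le> s (Suc i)" "\<forall>i<N. g i \<in> \<Gamma>"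
  shows "\<exists>xs h. xs \<in> incr_seqs D \<and> xs \<noteq> [] \<and> last xs = s N \<and>
     (\<forall>i<length xs - 1. h i \<in> \<Gamma>) \<and>
     (\<Sum>i<N. \<bar>J (s i) (g i) - J (s (Suc i)) (g i)\<bar>) =
     (\<Sum>i<length xs - 1. \<bar>J (xs ! i) (h i) - J (xs ! Suc i) (h i)\<bar>)"
  using assms
proof (induction N)
  case 0
  then show ?case by (intro exI[of _ "[s 0]"]) (auto simp: incr_seqs_def)
next
  case (Suc N)
  then obtain xs h where xs: "xs \<in> incr_seqs D" "xs \<noteq> []" "last xs = s N" 
     "\<forall>i<length xs - 1. h i \<in> \<Gamma>"
     "(\<Sum>i<N. \<bar>J (s i) (g i) - J (s (Suc i)) (g i)\<bar>) =
     (\<Sum>i<length xs - 1. \<bar>J (xs ! i) (h i) - J (xs ! Suc i) (h i)\<bar>)"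
    by auto
  show ?case
  proof (cases "s N = s (Suc N)")
    case True
    then show ?thesis using xs by (intro exI[of _ xs] exI[of _ h]) simp
  next
    case False
    with Suc.prems have lt: "s N < s (Suc N)" by (simp add: order_less_le)
    let ?ys = "xs @ [s (Suc N)]"
    let ?n = "length xs - 1"
    let ?h = "\<lambda>i. if i < ?n then h i else g N"
    have n: "length ?ys - 1 = Suc ?n" using xs(2) by (cases xs) auto
    have le: "x \<le> s N" if "x \<in> set xs" for x
    proof -
      have "sorted xs" using xs(1) by (auto simp: incr_seqs_def strict_sorted_iff)
      from that obtain i where i: "i < length xs" "xs ! i = x" by (auto simp: in_set_conv_nth)
      then have "xs ! i \<le> xs ! (length xs - 1)"
        using \<open>sorted xs\<close> by (intro sorted_nth_mono) auto
      then show ?thesis using i xs(2,3) by (simp add: last_conv_nth)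
    qed
    have "?ys \<in> incr_seqs D"
      using xs(1) Suc.prems(1) le lt unfolding incr_seqs_def
      by (auto simp: sorted_wrt_append) (meson le_less_trans)
    moreover have "(\<Sum>i<Suc ?n. \<bar>J (?ys ! i) (?h i) - J (?ys ! Suc i) (?h i)\<bar>)
      = (\<Sum>i<?n. \<bar>J (xs ! i) (h i) - J (xs ! Suc i) (h i)\<bar>) + \<bar>J (s N) (g N) - J (s (Suc N)) (g N)\<bar>"
    proof -
      have "?ys ! ?n = s N" using xs(2,3) by (simp add: nth_append last_conv_nth)
      moreover have "?ys ! Suc ?n = s (Suc N)" using xs(2) by (simp add: nth_append)
      moreover have "(\<Sum>i<?n. \<bar>J (?ys ! i) (?h i) - J (?ys ! Suc i) (?h i)\<bar>)
        = (\<Sum>i<?n. \<bar>J (xs ! i) (h i) - J (xs ! Suc i) (h i)\<bar>)"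
        by (intro sum.cong) (auto simp: nth_append)
      ultimately show ?thesis by simp
    qed
    moreover have "\<forall>i<Suc ?n. ?h i \<in> \<Gamma>" using xs(4) Suc.prems(3) by auto
    moreover have "(\<Sum>i<Suc N. \<bar>J (s i) (g i) - J (s (Suc i)) (g i)\<bar>)
      = (\<Sum>i<?n. \<bar>J (xs ! i) (h i) - J (xs ! Suc i) (h i)\<bar>) + \<bar>J (s N) (g N) - J (s (Suc N)) (g N)\<bar>"
      using xs(5) by simp
    ultimately show ?thesis
      by (intro exI[of _ ?ys] exI[of _ ?h]) (simp only: n, simp)
  qed
qed

text \<open>The hypothesis \<open>0 \<le> K\<close> accounts for the empty list, whose sum is
  \<open>0\<close>, whereas every sequence in \<open>seq_var_le\<close> has at least one
  point.\<close>

lemma seq_var_le_iff_lists: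
  assumes "0 \<le> K"
  shows "seq_var_le D \<Gamma> J K \<longleftrightarrow> (\<forall>xs\<in>incr_seqs D. \<forall>g. (\<forall>i<length xs - 1. g i \<in> \<Gamma>) \<longrightarrow>
     (\<Sum>i<length xs - 1. \<bar>J (xs ! i) (g i) - J (xs ! Suc i) (g i)\<bar>) \<le> K)" (is "_ = ?R")
proof
  assume L: "seq_var_le D \<Gamma> J K"
  show ?R
  proof (intro ballI allI impI)
    fix xs g assume xs: "xs \<in> incr_seqs D" "\<forall>i<length xs - 1. g i \<in> \<Gamma>"
    show "(\<Sum>i<length xs - 1. \<bar>J (xs ! i) (g i) - J (xs ! Suc i) (g i)\<bar>) \<le> K"
    proof (cases "xs = []")
      case True then show ?thesis using assms by simp
    next
      case False
      show ?thesis
      proof (rule seq_var_leD[OF L])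
        fix i assume "i \<le> length xs - 1"
        with False have "i < length xs" by (cases xs) auto
        then show "xs ! i \<in> D" using xs(1) by (auto simp: incr_seqs_def)
      next
        fix i assume i: "i < length xs - 1"
        then have "Suc i < length xs" by linarith
        then have "xs ! i < xs ! Suc i" using xs(1)
          by (intro sorted_wrt_nth_less[of "(<)" xs]) (auto simp: incr_seqs_def)
        then show "xs ! i \<le> xs ! Suc i" by simp
      qed (use xs in auto)
    qed
  qed
next
  assume R: ?R
  show "seq_var_le D \<Gamma> J K"
    unfolding seq_var_le_def
  proof (intro allI impI)
    fix N :: nat and s :: "nat \<Rightarrow> real" and g
    assume "\<forall>i\<le>N. s i \<in> D" "\<forall>i<N. s i \<le> s (Suc i)" "\<forall>i<N. g i \<in> \<Gamma>"
    from compress_sequence[OF this, of J] obtain xs h where "xs \<in> incr_seqs D"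
      "\<forall>i<length xs - 1. h i \<in> \<Gamma>" and eq: "(\<Sum>i<N. \<bar>J (s i) (g i) - J (s (Suc i)) (g i)\<bar>) =
        (\<Sum>i<length xs - 1. \<bar>J (xs ! i) (h i) - J (xs ! Suc i) (h i)\<bar>)" by blast
    then show "(\<Sum>i<N. \<bar>J (s i) (g i) - J (s (Suc i)) (g i)\<bar>) \<le> K"
      unfolding eq using R by blast
  qed
qed

lemma var_on_le_iff:
  assumes "0 \<le> K"
  shows "var_on D f \<le> ereal K \<longleftrightarrow> seq_var_le D UNIV (\<lambda>x (_::unit). f x) K"
  unfolding var_on_def seq_var_le_iff_lists[OF assms] by (simp add: SUP_le_iff)

text \<open>The suprema range over independent choices. The induction fixes a choice
  \<open>h\<close> for the last term, moves that term to the right-hand side and only then takes its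
  supremum.\<close>

lemma sum_SUP_le:
  fixes f :: "nat \<Rightarrow> 'g \<Rightarrow> real" and K :: real
  assumes "\<Gamma> \<noteq> {}" "\<And>i g. 0 \<le> f i g"
    "\<And>g. \<forall>i<n. g i \<in> \<Gamma> \<Longrightarrow> (\<Sum>i<n. f i (g i)) \<le> K"
  shows "(\<Sum>i<n. SUP g\<in>\<Gamma>. ereal (f i g)) \<le> ereal K"
  using assms(3)
proof (induction n arbitrary: K)
  case 0
  then show ?case by (simp add: zero_ereal_def)
next
  case (Suc n)
  let ?S = "\<Sum>i<n. SUP g\<in>\<Gamma>. ereal (f i g)"
  have *: "ereal (f n h) \<le> ereal K - ?S" if "h \<in> \<Gamma>" for h
  proof -
    have "?S \<le> ereal (K - f n h)"
    proof (rule Suc.IH)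
      fix g assume "\<forall>i<n. g i \<in> \<Gamma>"
      with that Suc.prems[of "g(n := h)"] show "(\<Sum>i<n. f i (g i)) \<le> K - f n h"
        by (simp add: less_Suc_eq)
    qed
    then show ?thesis
      by (cases ?S) auto
  qed
  obtain h where "h \<in> \<Gamma>" using assms(1) by blast
  have S: "?S < \<infinity>"
    using *[OF \<open>h \<in> \<Gamma>\<close>] by (cases ?S) auto
  have "0 \<le> ?S"
    using \<open>h \<in> \<Gamma>\<close> assms(2) by (intro sum_nonneg SUP_upper2[of h]) auto
  have "(SUP g\<in>\<Gamma>. ereal (f n g)) \<le> ereal K - ?S"
    using * by (intro SUP_least) auto
  then have "?S + (SUP g\<in>\<Gamma>. ereal (f n g)) \<le> ereal K"
    using S \<open>0 \<le> ?S\<close> by (cases ?S; cases "SUP g\<in>\<Gamma>. ereal (f n g)") auto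
  then show ?case by simp
qed

lemma zero_in_tests: "(\<lambda>_. 0) \<in> tests" and one_in_tests: "(\<lambda>_. 1) \<in> tests"
  by (auto simp: tests_def lipschitz_on_def)

text \<open>Since \<open>W10\<close> is a supremum over \<open>tests\<close>, a sum of distances is
  a supremum over one test function per step, which is the form of
  \<open>seq_var_le\<close>.\<close>

lemma VarM_le_iff:
  assumes "0 \<le> K"
  shows "VarM G \<le> ereal K \<longleftrightarrow> seq_var_le Iv tests (\<lambda>x g. integral\<^sup>L (G x) g) K"
proof -
  have W: "W10 \<mu> \<nu> = (SUP g\<in>tests. ereal \<bar>integral\<^sup>L \<mu> g - integral\<^sup>L \<nu> g\<bar>)" for \<mu> \<nu>
    unfolding W10_def tests_def ..
  have "(\<Sum>i < length xs - 1. W10 (G (xs ! i)) (G (xs ! Suc i))) \<le> ereal K \<longleftrightarrow>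
     (\<forall>g. (\<forall>i<length xs - 1. g i \<in> tests) \<longrightarrow>
       (\<Sum>i<length xs - 1. \<bar>integral\<^sup>L (G (xs ! i)) (g i) - integral\<^sup>L (G (xs ! Suc i)) (g i)\<bar>) \<le> K)"
     (is "?l = ?r") for xs
  proof
    assume ?l
    show ?r
    proof (intro allI impI)
      fix g :: "nat \<Rightarrow> real \<Rightarrow> real" assume g: "\<forall>i<length xs - 1. g i \<in> tests"
      have "ereal (\<Sum>i<length xs - 1. \<bar>integral\<^sup>L (G (xs ! i)) (g i) - integral\<^sup>L (G (xs ! Suc i)) (g i)\<bar>)
        \<le> (\<Sum>i < length xs - 1. W10 (G (xs ! i)) (G (xs ! Suc i)))"
        unfolding sum_ereal[symmetric]
        by (intro sum_mono) (use g in \<open>auto simp: W intro!: SUP_upper\<close>)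
      with \<open>?l\<close> show "(\<Sum>i<length xs - 1. \<bar>integral\<^sup>L (G (xs ! i)) (g i) - integral\<^sup>L (G (xs ! Suc i)) (g i)\<bar>) \<le> K"
        using order_trans ereal_less_eq(3) by blast
    qed
  next
    assume ?r then show ?l unfolding W
      by (intro sum_SUP_le) (use zero_in_tests in auto)
  qed
  then show ?thesis
    unfolding VarM_def seq_var_le_iff_lists[OF assms] by (simp add: SUP_le_iff)
qed

text \<open>Points of \<open>E\<close> are approximated by points of \<open>D\<close>; coinciding points get the same
  approximation, so weak monotonicity survives the approximation.\<close>

lemma seq_var_le_limit:
  assumes D: "seq_var_le D \<Gamma> J K"
    and lim: "\<And>x. x \<in> E \<Longrightarrow> \<exists>d. (\<forall>n. d n \<in> D) \<and> d \<longlonglongrightarrow> x \<and> (\<forall>g\<in>\<Gamma>. (\<lambda>n. J (d n) g) \<longlonglongrightarrow> J' x g)"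
  shows "seq_var_le E \<Gamma> J' K"
  unfolding seq_var_le_def
proof (intro allI impI)
  fix N :: nat and s :: "nat \<Rightarrow> real" and g
  assume s: "\<forall>i\<le>N. s i \<in> E" and mono: "\<forall>i<N. s i \<le> s (Suc i)" and g: "\<forall>i<N. g i \<in> \<Gamma>"
  obtain d where d: "\<And>x. x \<in> E \<Longrightarrow> (\<forall>n. d x n \<in> D) \<and> d x \<longlonglongrightarrow> x \<and> (\<forall>g\<in>\<Gamma>. (\<lambda>n. J (d x n) g) \<longlonglongrightarrow> J' x g)"
    using lim by metis
  have "(\<lambda>n. \<Sum>i<N. \<bar>J (d (s i) n) (g i) - J (d (s (Suc i)) n) (g i)\<bar>) \<longlonglongrightarrow>
    (\<Sum>i<N. \<bar>J' (s i) (g i) - J' (s (Suc i)) (g i)\<bar>)"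
    by (intro tendsto_sum tendsto_rabs tendsto_diff) (use d s g in auto)
  moreover have "\<forall>\<^sub>F n in sequentially. \<forall>i\<in>{..<N}. d (s i) n \<le> d (s (Suc i)) n"
  proof (rule eventually_ball_finite)
    show "\<forall>i\<in>{..<N}. \<forall>\<^sub>F n in sequentially. d (s i) n \<le> d (s (Suc i)) n"
    proof
      fix i assume i: "i \<in> {..<N}"
      show "\<forall>\<^sub>F n in sequentially. d (s i) n \<le> d (s (Suc i)) n"
      proof (cases "s i = s (Suc i)")
        case False
        with mono i have "s i < s (Suc i)" by (simp add: order_less_le)
        moreover have "d (s i) \<longlonglongrightarrow> s i" "d (s (Suc i)) \<longlonglongrightarrow> s (Suc i)" using d s i by auto
        moreover obtain m where "s i < m" "m < s (Suc i)" using calculation dense by blast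
        ultimately have "\<forall>\<^sub>F n in sequentially. d (s i) n < m" "\<forall>\<^sub>F n in sequentially. m < d (s (Suc i)) n"
          by (auto dest: order_tendstoD)
        then show ?thesis by eventually_elim simp
      qed auto
    qed
  qed auto
  then have "\<forall>\<^sub>F n in sequentially. (\<Sum>i<N. \<bar>J (d (s i) n) (g i) - J (d (s (Suc i)) n) (g i)\<bar>) \<le> K"
  proof (rule eventually_mono)
    fix n assume "\<forall>i\<in>{..<N}. d (s i) n \<le> d (s (Suc i)) n"
    then show "(\<Sum>i<N. \<bar>J (d (s i) n) (g i) - J (d (s (Suc i)) n) (g i)\<bar>) \<le> K"
      by (intro seq_var_leD[OF D, of _ "\<lambda>i. d (s i) n"]) (use d s g in auto)
  qed
  ultimately show "(\<Sum>i<N. \<bar>J' (s i) (g i) - J' (s (Suc i)) (g i)\<bar>) \<le> K"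
    by (intro tendsto_upperbound) auto
qed

lemma sum_abs_diff_mono:
  fixes s :: "nat \<Rightarrow> real"
  assumes "\<And>i. i < N \<Longrightarrow> s i \<le> s (Suc i)"
  shows "(\<Sum>i<N. \<bar>s i - s (Suc i)\<bar>) = s N - s 0"
proof -
  have "(\<Sum>i<N. \<bar>s i - s (Suc i)\<bar>) = (\<Sum>i<N. s (Suc i) - s i)"
    using assms by (intro sum.cong) auto
  then show ?thesis by (simp add: sum_lessThan_telescope)
qed

text \<open>Jordan decomposition: \<open>Sup (A x)\<close> is the variation of \<open>f\<close> on
  the part of \<open>D\<close> up to \<open>x\<close>. Both this function and its difference with
  \<open>f\<close> are increasing on \<open>D\<close>, and monotone functions are Borel.\<close>

lemma bounded_variation_measurable:
  assumes "seq_var_le D UNIV (\<lambda>x (_::unit). f x) K"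
  shows "f \<in> borel_measurable (restrict_space borel D)"
proof (cases "D = {}")
  case True
  then show ?thesis by (auto simp: measurable_def)
next
  case False
  define P where "P x N s \<longleftrightarrow> (\<forall>i\<le>N. s i \<in> D) \<and> (\<forall>i<N. s i \<le> s (Suc i)) \<and> s N = x" for x N and s :: "nat \<Rightarrow> real"
  define S where "S N s = (\<Sum>i<N. \<bar>f (s i) - f (s (Suc i))\<bar>)" for N and s :: "nat \<Rightarrow> real"
  define A where "A x = {S N s | N s. P x N s}" for x
  have bd: "a \<le> K" if "a \<in> A x" for a x
    using that seq_var_leD[OF assms, of _ _ "\<lambda>_. ()"] unfolding A_def P_def S_def by auto
  have bdd: "bdd_above (A x)" for x using bd by (rule bdd_aboveI)
  have ne: "A x \<noteq> {}" if "x \<in> D" for x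
    using that unfolding A_def P_def by (auto intro!: exI[of _ 0] exI[of _ "\<lambda>_. x"])
  have key: "Sup (A x) + \<bar>f x - f y\<bar> \<le> Sup (A y)" if xy: "x \<in> D" "y \<in> D" "x \<le> y" for x y
  proof -
    have "a \<le> Sup (A y) - \<bar>f x - f y\<bar>" if "a \<in> A x" for a
    proof -
      from that obtain N s where s: "P x N s" "a = S N s" unfolding A_def by auto
      let ?s = "s(Suc N := y)"
      have "P y (Suc N) ?s" using s xy unfolding P_def by (auto simp: less_Suc_eq le_Suc_eq)
      moreover have "S (Suc N) ?s = a + \<bar>f x - f y\<bar>" using s unfolding S_def P_def by simp
      ultimately have "a + \<bar>f x - f y\<bar> \<in> A y" unfolding A_def by force
      from cSup_upper[OF this bdd] show ?thesis by simp
    qed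
    from cSup_least[OF ne[OF xy(1)] this] show ?thesis by simp
  qed
  have "mono_on D (\<lambda>x. Sup (A x))" "mono_on D (\<lambda>x. Sup (A x) - f x)"
    using key by (force intro!: mono_onI)+
  then have "(\<lambda>x. Sup (A x) - (Sup (A x) - f x)) \<in> borel_measurable (restrict_space borel D)"
    by (intro borel_measurable_diff borel_measurable_mono_on_fnc)
  then show ?thesis by simp
qed

text \<open>A discrete form of horizontal slicing. Subtracting the minimum \<open>e\<close> of
  \<open>w\<close> removes a constant slice, which costs at most \<open>e * (2 * M)\<close> by the
  assumption on \<open>f\<close> and is paid for by the two end values of \<open>w\<close>. The rest
  vanishes at some \<open>m\<close>, where the sum splits into shorter ranges.\<close>

lemma weighted_variation_bound:
  fixes w f :: "nat \<Rightarrow> real"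
  assumes "a \<le> b" "\<And>i. i \<in> {a..b} \<Longrightarrow> 0 \<le> w i" "\<And>i. i \<in> {a..b} \<Longrightarrow> 0 \<le> f i"
    and "\<And>p q. a \<le> p \<Longrightarrow> p \<le> q \<Longrightarrow> q \<le> b \<Longrightarrow> f p + f q + (\<Sum>i=p..<q. \<bar>f i - f (Suc i)\<bar>) \<le> 2 * M"
  shows "w a * f a + (\<Sum>i=a..<b. \<bar>w i * f i - w (Suc i) * f (Suc i)\<bar>) + w b * f b
    \<le> M * (w a + (\<Sum>i=a..<b. \<bar>w i - w (Suc i)\<bar>) + w b)"
  using assms
proof (induction "b - a" arbitrary: a b w rule: less_induct)
  case less
  have fin: "finite (w ` {a..b})" "w ` {a..b} \<noteq> {}" using less.prems(1) by auto
  define e where "e = Min (w ` {a..b})"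
  have e: "0 \<le> e" "\<And>i. i \<in> {a..b} \<Longrightarrow> e \<le> w i"
    using Min_in[OF fin] less.prems(2) Min_le[OF fin(1)] unfolding e_def by auto
  obtain m where m: "m \<in> {a..b}" "w m = e" using Min_in[OF fin] unfolding e_def by auto
  define u where "u i = w i - e" for i
  have u: "0 \<le> u i" if "i \<in> {a..b}" for i using e that by (auto simp: u_def)
  have um: "u m = 0" using m by (simp add: u_def)
  have main: "u a * f a + (\<Sum>i=a..<b. \<bar>u i * f i - u (Suc i) * f (Suc i)\<bar>) + u b * f b
    \<le> M * (u a + (\<Sum>i=a..<b. \<bar>u i - u (Suc i)\<bar>) + u b)"
  proof -
    \<comment> \<open>If the zero of \<open>u\<close> is an endpoint, splitting there would not
      shorten the range. The endpoint is dropped instead, and the step next to it becomes an end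
      term of the shorter range.\<close>
    consider "a = b" | "m = a" "a < b" | "m = b" "a < b" | "a < m" "m < b" using m by fastforce
    then show ?thesis
    proof cases
      case 1
      then have "u a = 0" using m um by auto
      then show ?thesis using 1 by simp
    next
      case 2
      have "u (Suc a) * f (Suc a) + (\<Sum>i=Suc a..<b. \<bar>u i * f i - u (Suc i) * f (Suc i)\<bar>) + u b * f b
        \<le> M * (u (Suc a) + (\<Sum>i=Suc a..<b. \<bar>u i - u (Suc i)\<bar>) + u b)"
        using 2 less.prems u by (intro less.hyps) auto
      moreover have "0 \<le> u (Suc a)" "0 \<le> f (Suc a)" using u less.prems 2 by auto
      ultimately show ?thesis using 2 um by (simp add: sum.atLeast_Suc_lessThan algebra_simps)
    next
      case 3
      then obtain b' where b': "b = Suc b'" "a \<le> b'" by (cases b) auto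
      have "u a * f a + (\<Sum>i=a..<b'. \<bar>u i * f i - u (Suc i) * f (Suc i)\<bar>) + u b' * f b'
        \<le> M * (u a + (\<Sum>i=a..<b'. \<bar>u i - u (Suc i)\<bar>) + u b')"
        using b' less.prems u by (intro less.hyps) auto
      moreover have "0 \<le> u b'" "0 \<le> f b'" using u less.prems b' by auto
      ultimately show ?thesis using b' 3 um by (simp add: algebra_simps)
    next
      case 4
      have "u a * f a + (\<Sum>i=a..<m. \<bar>u i * f i - u (Suc i) * f (Suc i)\<bar>) + u m * f m
        \<le> M * (u a + (\<Sum>i=a..<m. \<bar>u i - u (Suc i)\<bar>) + u m)"
        using 4 less.prems u by (intro less.hyps) auto
      moreover have "u m * f m + (\<Sum>i=m..<b. \<bar>u i * f i - u (Suc i) * f (Suc i)\<bar>) + u b * f b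
        \<le> M * (u m + (\<Sum>i=m..<b. \<bar>u i - u (Suc i)\<bar>) + u b)"
        using 4 less.prems u by (intro less.hyps) auto
      moreover have "(\<Sum>i=a..<b. F i) = (\<Sum>i=a..<m. F i) + (\<Sum>i=m..<b. F i)" for F :: "nat \<Rightarrow> real"
        using 4 by (simp add: sum.atLeastLessThan_concat)
      ultimately show ?thesis using um by (simp add: algebra_simps)
    qed
  qed
  have "(\<Sum>i=a..<b. \<bar>w i * f i - w (Suc i) * f (Suc i)\<bar>) \<le>
    (\<Sum>i=a..<b. \<bar>u i * f i - u (Suc i) * f (Suc i)\<bar> + e * \<bar>f i - f (Suc i)\<bar>)"
  proof (rule sum_mono)
    fix i
    have "w i * f i - w (Suc i) * f (Suc i) = (u i * f i - u (Suc i) * f (Suc i)) + e * (f i - f (Suc i))"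
      by (simp add: u_def algebra_simps)
    also have "\<bar>\<dots>\<bar> \<le> \<bar>u i * f i - u (Suc i) * f (Suc i)\<bar> + e * \<bar>f i - f (Suc i)\<bar>"
      using e(1) by (metis abs_mult abs_of_nonneg abs_triangle_ineq)
    finally show "\<bar>w i * f i - w (Suc i) * f (Suc i)\<bar> \<le> \<bar>u i * f i - u (Suc i) * f (Suc i)\<bar> + e * \<bar>f i - f (Suc i)\<bar>" .
  qed
  also have "\<dots> = (\<Sum>i=a..<b. \<bar>u i * f i - u (Suc i) * f (Suc i)\<bar>) + e * (\<Sum>i=a..<b. \<bar>f i - f (Suc i)\<bar>)"
    by (simp add: sum.distrib sum_distrib_left)
  finally have 1: "(\<Sum>i=a..<b. \<bar>w i * f i - w (Suc i) * f (Suc i)\<bar>) \<le> \<dots>" .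
  have 2: "e * (f a + f b + (\<Sum>i=a..<b. \<bar>f i - f (Suc i)\<bar>)) \<le> e * (2 * M)"
    using e(1) less.prems(4)[of a b] less.prems(1) by (intro mult_left_mono) auto
  have 3: "w a = u a + e" "w b = u b + e" by (auto simp: u_def)
  have 4: "(\<Sum>i=a..<b. \<bar>w i - w (Suc i)\<bar>) = (\<Sum>i=a..<b. \<bar>u i - u (Suc i)\<bar>)" by (simp add: u_def)
  show ?case using 1 2 main unfolding 3 4 by (simp add: algebra_simps)
qed

section \<open>Families of leaf measures\<close>

abbreviation (input) borel_Iv :: "real measure" where
  "borel_Iv \<equiv> restrict_space borel Iv"

definition leaf_family :: "(real \<Rightarrow> real) \<Rightarrow> (real \<Rightarrow> real measure) \<Rightarrow> bool" where
  "leaf_family \<phi> \<nu> \<longleftrightarrow> (\<forall>\<gamma>\<in>Iv. 0 \<le> \<phi> \<gamma> \<and> prob_space (\<nu> \<gamma>) \<and> sets (\<nu> \<gamma>) = sets borel_Iv)"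

definition disintegrates :: "(real \<times> real) measure \<Rightarrow> (real \<Rightarrow> real) \<Rightarrow> (real \<Rightarrow> real measure) \<Rightarrow> bool" where
  "disintegrates \<mu> \<phi> \<nu> \<longleftrightarrow> (\<forall>A\<in>sets \<mu>. emeasure \<mu> A =
     (\<integral>\<^sup>+ \<gamma>. emeasure (\<nu> \<gamma>) {y\<in>Iv. (\<gamma>, y) \<in> A} * ennreal (\<phi> \<gamma>) * indicator Iv \<gamma> \<partial>lborel))"

text \<open>This is the integral of \<open>g\<close> against the non-normalized restriction to the
  leaf over \<open>\<gamma>\<close>.\<close>

definition leaf_integral :: "(real \<Rightarrow> real) \<Rightarrow> (real \<Rightarrow> real measure) \<Rightarrow> real \<Rightarrow> (real \<Rightarrow> real) \<Rightarrow> real" where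
  "leaf_integral \<phi> \<nu> \<gamma> g = \<phi> \<gamma> * integral\<^sup>L (\<nu> \<gamma>) g"

lemma leaf_familyD:
  assumes "leaf_family \<phi> \<nu>" "\<gamma> \<in> Iv"
  shows "0 \<le> \<phi> \<gamma>" "prob_space (\<nu> \<gamma>)" "sets (\<nu> \<gamma>) = sets borel_Iv" "space (\<nu> \<gamma>) = Iv"
  using assms sets_eq_imp_space_eq[of "\<nu> \<gamma>" borel_Iv]
  by (auto simp: leaf_family_def space_restrict_space)

lemma Iv_borel [measurable, simp]: "Iv \<in> sets borel"
  by (simp add: Iv_def)

lemma Sigma_sq_borel [measurable, simp]: "Sigma_sq \<in> sets borel"
  unfolding Sigma_sq_def borel_prod[symmetric] by measurable

lemma zero_in_Iv [simp]: "0 \<in> Iv"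
  by (simp add: Iv_def)

lemma integral_scale_measure:
  fixes f :: "'a \<Rightarrow> real"
  assumes "0 \<le> r" "f \<in> borel_measurable M"
  shows "integral\<^sup>L (scale_measure (ennreal r) M) f = r * integral\<^sup>L M f"
proof -
  have "scale_measure (ennreal r) M = density M (\<lambda>_. ennreal r)"
    by (rule measure_eqI) (auto simp: emeasure_density nn_integral_cmult_indicator)
  then show ?thesis
    using assms by (simp add: integral_density)
qed

lemma tests_continuous: "g \<in> tests \<Longrightarrow> continuous_on Iv g"
  by (auto simp: tests_def intro: lipschitz_on_continuous_on)

lemma tests_measurable: "g \<in> tests \<Longrightarrow> g \<in> borel_measurable borel_Iv"
  by (intro borel_measurable_continuous_on_restrict tests_continuous)

lemma testsI:
  assumes "\<And>x y. x \<in> Iv \<Longrightarrow> y \<in> Iv \<Longrightarrow> \<bar>g x - g y\<bar> \<le> \<bar>x - y\<bar>" "\<And>x. x \<in> Iv \<Longrightarrow> \<bar>g x\<bar> \<le> 1"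
  shows "g \<in> tests"
  using assms by (auto simp: tests_def lipschitz_on_def dist_real_def)

lemma testsD:
  assumes "g \<in> tests" "x \<in> Iv"
  shows "\<bar>g x\<bar> \<le> 1" "y \<in> Iv \<Longrightarrow> \<bar>g x - g y\<bar> \<le> \<bar>x - y\<bar>"
  using assms by (auto simp: tests_def lipschitz_on_def dist_real_def)

lemma leaf_integrable:
  fixes g :: "real \<Rightarrow> real"
  assumes "prob_space N" "sets N = sets borel_Iv" "g \<in> borel_measurable borel_Iv"
    "\<And>x. x \<in> Iv \<Longrightarrow> \<bar>g x\<bar> \<le> B"
  shows "integrable N g" "\<bar>integral\<^sup>L N g\<bar> \<le> B"
proof -
  interpret prob_space N by fact
  have sp: "space N = Iv" using sets_eq_imp_space_eq[OF assms(2)] by (simp add: space_restrict_space)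
  have m: "g \<in> borel_measurable N"
    using assms(3) measurable_cong_sets[OF assms(2) refl] by blast
  show i: "integrable N g"
    using assms(4) by (intro integrable_const_bound[of _ B] m) (auto simp: sp)
  have "\<bar>integral\<^sup>L N g\<bar> \<le> (\<integral>x. \<bar>g x\<bar> \<partial>N)" by (rule integral_abs_bound)
  also have "\<dots> \<le> (\<integral>x. B \<partial>N)"
    using assms(4) i by (intro integral_mono) (auto simp: sp)
  finally show "\<bar>integral\<^sup>L N g\<bar> \<le> B" by (simp add: prob_space)
qed

lemma leaf_integral_one:
  assumes "leaf_family \<phi> \<nu>" "\<gamma> \<in> Iv"
  shows "leaf_integral \<phi> \<nu> \<gamma> (\<lambda>_. 1) = \<phi> \<gamma>"
  using leaf_familyD[OF assms] prob_space.prob_space[of "\<nu> \<gamma>"] by (simp add: leaf_integral_def)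

text \<open>The empty sequence makes the variation nonnegative, so a bound by \<open>K\<close>
  forces \<open>0 \<le> K\<close>. Apart from this, the factor \<open>\<phi> \<gamma>\<close> is
  moved out of the scaled measures.\<close>

lemma K_good_iff:
  "K_good K \<mu> \<longleftrightarrow> (\<exists>\<phi> \<nu>. leaf_family \<phi> \<nu> \<and> disintegrates \<mu> \<phi> \<nu> \<and>
     0 \<le> K \<and> seq_var_le Iv tests (leaf_integral \<phi> \<nu>) K)"
proof -
  have "VarM (\<lambda>\<gamma>. scale_measure (ennreal (\<phi> \<gamma>)) (\<nu> \<gamma>)) \<le> ereal K \<longleftrightarrow>
      0 \<le> K \<and> seq_var_le Iv tests (leaf_integral \<phi> \<nu>) K" if "leaf_family \<phi> \<nu>" for \<phi> \<nu>
  proof (cases "0 \<le> K")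
    case True
    have eq: "(\<integral>y. g y \<partial>scale_measure (ennreal (\<phi> x)) (\<nu> x)) = leaf_integral \<phi> \<nu> x g"
      if "x \<in> Iv" "g \<in> tests" for x g
      unfolding leaf_integral_def
      using leaf_familyD[OF \<open>leaf_family \<phi> \<nu>\<close> that(1)] tests_measurable[OF that(2)]
      by (intro integral_scale_measure) (auto cong: measurable_cong_sets)
    have "(\<Sum>i<N. \<bar>(\<integral>y. g i y \<partial>scale_measure (ennreal (\<phi> (s i))) (\<nu> (s i))) -
        (\<integral>y. g i y \<partial>scale_measure (ennreal (\<phi> (s (Suc i)))) (\<nu> (s (Suc i))))\<bar>) =
      (\<Sum>i<N. \<bar>leaf_integral \<phi> \<nu> (s i) (g i) - leaf_integral \<phi> \<nu> (s (Suc i)) (g i)\<bar>)"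
      if "\<forall>i\<le>N. s i \<in> Iv" "\<forall>i<N. g i \<in> tests" for N s g
      using that by (intro sum.cong refl) (simp add: eq)
    then show ?thesis
      using True unfolding VarM_le_iff[OF True] seq_var_le_def by (auto 4 3)
  next
    case False
    have "[] \<in> incr_seqs Iv" by (simp add: incr_seqs_def)
    then have "VarM (\<lambda>\<gamma>. scale_measure (ennreal (\<phi> \<gamma>)) (\<nu> \<gamma>)) \<ge> 0"
      unfolding VarM_def by (intro SUP_upper2[of "[]"]) auto
    then show ?thesis using False by (meson ereal_less_eq(5) order_trans)
  qed
  then show ?thesis
    unfolding K_good_def leaf_family_def[symmetric] disintegrates_def[symmetric] by blast
qed

section \<open>Weak limits of measures on the interval\<close>

definition clamp_Iv :: "real \<Rightarrow> real" where
  "clamp_Iv x = max (-1/2) (min (1/2) x)"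

lemma clamp_Iv_in [simp]: "clamp_Iv x \<in> Iv"
  and clamp_Iv_id: "x \<in> Iv \<Longrightarrow> clamp_Iv x = x"
  by (auto simp: clamp_Iv_def Iv_def)

lemma continuous_clamp_Iv: "continuous_on UNIV clamp_Iv"
  unfolding clamp_Iv_def by (intro continuous_intros)

lemma clamp_Iv_measurable [measurable]: "clamp_Iv \<in> measurable borel borel_Iv"
  by (intro measurable_restrict_space2 borel_measurable_continuous_onI continuous_clamp_Iv) auto

text \<open>Viewed on the line, the measures all live in \<open>Iv\<close> and hence are tight, so a
  subsequence converges weakly. The retraction \<open>clamp_Iv\<close> extends test functions to
  bounded continuous functions on the line and carries the limit back to \<open>Iv\<close>.\<close>

lemma leaf_weak_compactness:
  assumes "\<And>n::nat. prob_space (N n)" "\<And>n. sets (N n) = sets borel_Iv"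
  obtains r L where "strict_mono (r :: nat \<Rightarrow> nat)" "prob_space L" "sets L = sets borel_Iv"
    "\<And>g. g \<in> tests \<Longrightarrow> (\<lambda>n. integral\<^sup>L (N (r n)) g) \<longlonglongrightarrow> integral\<^sup>L L g"
proof -
  define Q where "Q n = distr (N n) borel (\<lambda>x. x)" for n
  have sp: "space (N n) = Iv" for n
    using sets_eq_imp_space_eq[OF assms(2)] by (simp add: space_restrict_space)
  have id: "(\<lambda>x. x) \<in> measurable (N n) borel" for n
    using measurable_restrict_space1[of "\<lambda>x. x" borel borel Iv]
    by (simp cong: measurable_cong_sets add: assms(2))
  have Q: "real_distribution (Q n)" for n
    unfolding Q_def real_distribution_def real_distribution_axioms_def
    using prob_space.prob_space_distr[OF assms(1) id] by simp
  have "measure (Q n) {-1<..1} = 1" for n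
  proof -
    have "measure (Q n) {-1<..1} = measure (N n) ({-1<..1} \<inter> space (N n))"
      unfolding Q_def using id by (subst measure_distr) (auto simp: vimage_def)
    also have "{-1<..1} \<inter> space (N n) = space (N n)" by (auto simp: sp Iv_def)
    finally show ?thesis using prob_space.prob_space[OF assms(1)] by simp
  qed
  then have "tight Q"
    unfolding tight_def using Q
    by (intro conjI allI impI exI[of _ "-1 :: real"] exI[of _ "1 :: real"]) auto
  from tight_imp_convergent_subsubsequence[OF this, of id] obtain r M
    where r: "strict_mono r" and M: "real_distribution M" "weak_conv_m (\<lambda>n. Q (r n)) M"
    by (auto simp: strict_mono_def o_def)
  interpret M: real_distribution M by fact
  have cl: "clamp_Iv \<in> measurable M borel_Iv"
    using clamp_Iv_measurable by (simp cong: measurable_cong_sets)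
  show thesis
  proof (rule that[OF r, of "distr M borel_Iv clamp_Iv"])
    show "prob_space (distr M borel_Iv clamp_Iv)" by (rule M.prob_space_distr[OF cl])
    fix g assume g: "g \<in> tests"
    have cont: "isCont (\<lambda>x. g (clamp_Iv x)) x" for x
    proof -
      have "continuous_on UNIV (\<lambda>x. g (clamp_Iv x))"
        by (rule continuous_on_compose2[OF tests_continuous[OF g] continuous_clamp_Iv]) auto
      then show ?thesis by (simp add: continuous_on_eq_continuous_at)
    qed
    have "(\<lambda>n. integral\<^sup>L (Q (r n)) (\<lambda>x. g (clamp_Iv x))) \<longlonglongrightarrow> integral\<^sup>L M (\<lambda>x. g (clamp_Iv x))"
      using testsD(1)[OF g] by (intro weak_conv_imp_integral_bdd_continuous_conv[where B = 1] Q M cont) auto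
    moreover have "integral\<^sup>L (Q n) (\<lambda>x. g (clamp_Iv x)) = integral\<^sup>L (N n) g" for n
    proof -
      have "integral\<^sup>L (Q n) (\<lambda>x. g (clamp_Iv x)) = integral\<^sup>L (N n) (\<lambda>x. g (clamp_Iv x))"
        unfolding Q_def using id measurable_compose[OF clamp_Iv_measurable tests_measurable[OF g]]
        by (subst integral_distr) auto
      also have "\<dots> = integral\<^sup>L (N n) g"
        by (intro Bochner_Integration.integral_cong refl) (simp add: sp clamp_Iv_id)
      finally show ?thesis .
    qed
    moreover have "integral\<^sup>L (distr M borel_Iv clamp_Iv) g = integral\<^sup>L M (\<lambda>x. g (clamp_Iv x))"
      using cl tests_measurable[OF g] by (intro integral_distr)
    ultimately show "(\<lambda>n. integral\<^sup>L (N (r n)) g) \<longlonglongrightarrow> integral\<^sup>L (distr M borel_Iv clamp_Iv) g"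
      by simp
  qed simp
qed

text \<open>Otherwise an open interval around \<open>x\<close>, cut down to \<open>Iv\<close>, would
  be a null set; it is nondegenerate even when \<open>x\<close> is an endpoint.\<close>

lemma conull_dense_in_Iv:
  assumes "AE x in lborel. x \<in> Iv \<longrightarrow> x \<in> D" "D \<subseteq> Iv" "x \<in> Iv"
  shows "\<exists>d. (\<forall>n. d n \<in> D) \<and> d \<longlonglongrightarrow> x"
proof -
  have "\<exists>z\<in>D. \<bar>z - x\<bar> < e" if "e > 0" for e
  proof (rule ccontr)
    assume neg: "\<not> (\<exists>z\<in>D. \<bar>z - x\<bar> < e)"
    let ?a = "max (-1/2) (x - e)" and ?b = "min (1/2) (x + e)"
    have "?a < ?b" using that assms(3) by (simp add: Iv_def max_def min_def)
    have "AE z in lborel. z \<notin> {?a<..<?b}"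
      using assms(1) by eventually_elim (use neg in \<open>auto simp: Iv_def abs_less_iff\<close>)
    then have "emeasure lborel {?a<..<?b} = 0"
      by (subst (asm) AE_iff_measurable[of "{?a<..<?b}"]) auto
    moreover have "emeasure lborel {?a<..<?b} = ennreal (?b - ?a)" using \<open>?a < ?b\<close> by (intro emeasure_lborel_Ioo) auto
    ultimately show False using \<open>?a < ?b\<close> by (simp only: ennreal_eq_0_iff)
  qed
  then have "\<exists>z\<in>D. \<bar>z - x\<bar> < inverse (real (Suc n))" for n by simp
  then obtain d where d: "\<And>n. d n \<in> D" "\<And>n. \<bar>d n - x\<bar> < inverse (real (Suc n))" by metis
  have "d \<longlonglongrightarrow> x"
    by (rule Lim_null[THEN iffD2], rule Lim_null_comparison[OF _ LIMSEQ_inverse_real_of_nat])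
      (use d(2) in \<open>auto intro!: always_eventually less_imp_le\<close>)
  with d(1) show ?thesis by blast
qed

text \<open>Off a conull set the leaf measures may be replaced by weak limits of nearby ones;
  this makes bounds on the variation along the conull set hold everywhere.\<close>

lemma leaf_regularization:
  assumes fam: "leaf_family \<phi> \<nu>" and D: "AE x in lborel. x \<in> Iv \<longrightarrow> x \<in> D" "D \<subseteq> Iv"
    and bd: "\<And>x. x \<in> D \<Longrightarrow> \<phi> x \<le> B"
  obtains \<phi>' \<nu>' where "leaf_family \<phi>' \<nu>'" "\<And>x. x \<in> D \<Longrightarrow> \<phi>' x = \<phi> x \<and> \<nu>' x = \<nu> x"
    "\<And>x. x \<in> Iv \<Longrightarrow> \<exists>d. (\<forall>n. d n \<in> D) \<and> d \<longlonglongrightarrow> x \<and> (\<lambda>n. \<phi> (d n)) \<longlonglongrightarrow> \<phi>' x \<and>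
       (\<forall>g\<in>tests. (\<lambda>n. integral\<^sup>L (\<nu> (d n)) g) \<longlonglongrightarrow> integral\<^sup>L (\<nu>' x) g)"
proof -
  define P where "P x p L \<longleftrightarrow> 0 \<le> p \<and> prob_space L \<and> sets L = sets borel_Iv \<and> (x \<in> D \<longrightarrow> p = \<phi> x \<and> L = \<nu> x) \<and>
     (\<exists>d. (\<forall>n. d n \<in> D) \<and> d \<longlonglongrightarrow> x \<and> (\<lambda>n. \<phi> (d n)) \<longlonglongrightarrow> p \<and>
       (\<forall>g\<in>tests. (\<lambda>n. integral\<^sup>L (\<nu> (d n)) g) \<longlonglongrightarrow> integral\<^sup>L L g))" for x p L
  have "\<exists>p L. P x p L" if x: "x \<in> Iv" for x
  proof (cases "x \<in> D")
    case True
    then show ?thesis using leaf_familyD[OF fam x]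
      unfolding P_def by (intro exI[of _ "\<phi> x"] exI[of _ "\<nu> x"]) (auto intro!: exI[of _ "\<lambda>_. x"])
  next
    case False
    obtain d where d: "\<And>n. d n \<in> D" "d \<longlonglongrightarrow> x" using conull_dense_in_Iv[OF D x] by auto
    have dI: "d n \<in> Iv" for n using d D by auto
    have pr: "prob_space (\<nu> (d n))" and st: "sets (\<nu> (d n)) = sets borel_Iv" for n
      using leaf_familyD[OF fam dI] by auto
    \<comment> \<open>A first subsequence makes the leaf measures converge weakly; a second one
      makes the masses, which are confined to \<open>{0..B}\<close>, converge as well.\<close>
    obtain r :: "nat \<Rightarrow> nat" and L where r: "strict_mono r" and L: "prob_space L" "sets L = sets borel_Iv"
      "\<And>g. g \<in> tests \<Longrightarrow> (\<lambda>n. integral\<^sup>L (\<nu> (d (r n))) g) \<longlonglongrightarrow> integral\<^sup>L L g"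
      by (rule leaf_weak_compactness[of "\<lambda>n. \<nu> (d n)", OF pr st]) (rule that)
    have "\<forall>n. \<phi> (d (r n)) \<in> {0..B}" using leaf_familyD(1)[OF fam dI] bd d by auto
    then obtain p r' where p: "p \<in> {0..B}" "strict_mono r'" "((\<lambda>n. \<phi> (d (r n))) \<circ> r') \<longlonglongrightarrow> p"
      by (rule seq_compactE[OF compact_imp_seq_compact[OF compact_Icc[of 0 B]]])
    have "P x p L"
      unfolding P_def
    proof (intro conjI exI[of _ "\<lambda>n. d (r (r' n))"] allI ballI)
      show "(\<lambda>n. d (r (r' n))) \<longlonglongrightarrow> x"
        using LIMSEQ_subseq_LIMSEQ[OF d(2) strict_mono_o[OF r p(2)]] by (simp add: o_def)
      show "(\<lambda>n. \<phi> (d (r (r' n)))) \<longlonglongrightarrow> p" using p(3) by (simp add: o_def)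
      fix g assume "g \<in> tests"
      show "(\<lambda>n. integral\<^sup>L (\<nu> (d (r (r' n)))) g) \<longlonglongrightarrow> integral\<^sup>L L g"
        using LIMSEQ_subseq_LIMSEQ[OF L(3)[OF \<open>g \<in> tests\<close>] p(2)] by (simp add: o_def)
    qed (use p L d False in auto)
    then show ?thesis by blast
  qed
  then obtain \<phi>' \<nu>' where P: "\<And>x. x \<in> Iv \<Longrightarrow> P x (\<phi>' x) (\<nu>' x)" by metis
  show thesis
    by (rule that[of \<phi>' \<nu>']) (use P D(2) in \<open>auto simp: P_def leaf_family_def\<close>)
qed

section \<open>Measurability of the leaf measures in the base point\<close>

lemma seq_var_le_nonneg: "seq_var_le D \<Gamma> J K \<Longrightarrow> x \<in> D \<Longrightarrow> 0 \<le> K"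
  using seq_var_leD[of D \<Gamma> J K 0 "\<lambda>_. x"] by simp

lemma leaf_mass_bound:
  assumes "leaf_family \<phi> \<nu>" "seq_var_le Iv tests (leaf_integral \<phi> \<nu>) K" "x \<in> Iv"
  shows "\<phi> x \<le> \<phi> 0 + K"
  using seq_var_le_two[OF assms(2,3) zero_in_Iv one_in_tests]
  by (simp add: leaf_integral_one[OF assms(1)] assms(3))

lemma leaf_integral_measurable:
  assumes "seq_var_le Iv tests (leaf_integral \<phi> \<nu>) K" "g \<in> tests"
  shows "(\<lambda>x. leaf_integral \<phi> \<nu> x g) \<in> borel_measurable borel_Iv"
proof (rule bounded_variation_measurable)
  show "seq_var_le Iv UNIV (\<lambda>x (_::unit). leaf_integral \<phi> \<nu> x g) K"
    unfolding seq_var_le_def using seq_var_leD[OF assms(1), where g = "\<lambda>_. g"] assms(2) by simp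
qed

lemma leaf_mass_measurable:
  assumes "leaf_family \<phi> \<nu>" "seq_var_le Iv tests (leaf_integral \<phi> \<nu>) K"
  shows "\<phi> \<in> borel_measurable borel_Iv"
  using leaf_integral_measurable[OF assms(2) one_in_tests]
  by (subst (asm) measurable_cong[where g = \<phi>])
    (auto simp: leaf_integral_one[OF assms(1)] space_restrict_space)

text \<open>The indicator of a half-line is the pointwise limit of ramps \<open>u n\<close> of
  steepness \<open>Suc n\<close>. Division by \<open>Suc n\<close> makes each ramp a test function,
  so the measurability of \<open>leaf_integral\<close> passes to the limit.\<close>

lemma leaf_halfline_measurable:
  assumes fam: "leaf_family \<phi> \<nu>" and K: "seq_var_le Iv tests (leaf_integral \<phi> \<nu>) K"
  shows "(\<lambda>x. \<phi> x * measure (\<nu> x) ({..t} \<inter> Iv)) \<in> borel_measurable borel_Iv"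
proof -
  define u where "u n y = max 0 (min 1 (1 - real (Suc n) * (y - t)))" for n y
  have u01: "0 \<le> u n y" "u n y \<le> 1" for n y by (auto simp: u_def)
  have ut: "(\<lambda>y. u n y / real (Suc n)) \<in> tests" for n
  proof (rule testsI)
    fix x y
    have "\<bar>max 0 (min 1 (1 - a)) - max 0 (min 1 (1 - b))\<bar> \<le> \<bar>a - b\<bar>" for a b :: real by linarith
    from this[of "real (Suc n) * (x - t)" "real (Suc n) * (y - t)"]
    have "\<bar>u n x - u n y\<bar> \<le> \<bar>real (Suc n) * (x - t) - real (Suc n) * (y - t)\<bar>"
      unfolding u_def .
    also have "\<dots> = real (Suc n) * \<bar>x - y\<bar>"
      unfolding right_diff_distrib[symmetric] abs_mult by simp
    finally show "\<bar>u n x / real (Suc n) - u n y / real (Suc n)\<bar> \<le> \<bar>x - y\<bar>"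
      unfolding diff_divide_distrib[symmetric] abs_divide by (simp add: divide_le_eq mult.commute)
  next
    fix y show "\<bar>u n y / real (Suc n)\<bar> \<le> 1"
      using u01[of n y] by (simp add: divide_le_eq abs_of_nonneg)
  qed
  have lim: "(\<lambda>n. u n y) \<longlonglongrightarrow> indicator {..t} y" for y
  proof (cases "y \<le> t")
    case True
    then have "u n y = 1" for n by (simp add: u_def mult_nonneg_nonpos)
    then show ?thesis using True by simp
  next
    case False
    obtain m :: nat where m: "1 / (y - t) < real m" using reals_Archimedean2 by blast
    have "u n y = 0" if "n \<ge> m" for n
    proof -
      have "1 / (y - t) < real (Suc n)" using m that by simp
      then have "1 < real (Suc n) * (y - t)" using False by (simp add: divide_less_eq)
      then show ?thesis by (simp add: u_def)
    qed
    then show ?thesis using False by (intro tendsto_eventually) (auto intro: eventually_sequentiallyI)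
  qed
  show ?thesis
  proof (rule borel_measurable_LIMSEQ_real)
    fix n
    show "(\<lambda>x. real (Suc n) * leaf_integral \<phi> \<nu> x (\<lambda>y. u n y / real (Suc n))) \<in> borel_measurable borel_Iv"
      by (intro borel_measurable_times borel_measurable_const leaf_integral_measurable[OF K ut])
  next
    fix x assume "x \<in> space borel_Iv"
    then have x: "x \<in> Iv" by (simp add: space_restrict_space)
    note f = leaf_familyD[OF fam x]
    interpret prob_space "\<nu> x" by (rule f)
    have id: "(\<lambda>x. x) \<in> measurable (\<nu> x) borel"
      using measurable_restrict_space1[of "\<lambda>x. x" borel borel Iv] f(3)
      by (simp cong: measurable_cong_sets)
    have um: "u n \<in> borel_measurable (\<nu> x)" for n unfolding u_def using id by measurable
    have "(\<lambda>n. integral\<^sup>L (\<nu> x) (u n)) \<longlonglongrightarrow> integral\<^sup>L (\<nu> x) (indicator {..t})"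
      using lim u01 id um
      by (intro integral_dominated_convergence[where w = "\<lambda>_. 1"]) auto
    moreover have "integral\<^sup>L (\<nu> x) (indicator {..t}) = measure (\<nu> x) ({..t} \<inter> Iv)"
      using f by simp
    ultimately show "(\<lambda>n. real (Suc n) * leaf_integral \<phi> \<nu> x (\<lambda>y. u n y / real (Suc n)))
        \<longlonglongrightarrow> \<phi> x * measure (\<nu> x) ({..t} \<inter> Iv)"
      by (simp add: leaf_integral_def tendsto_mult_left)
  qed
qed

text \<open>A disintegration as in \<open>K_good\<close> comes without a measurability clause;
  measurability is recovered here from the variation bound. Dividing by a bound \<open>B\<close> of
  the masses gives sub-probability measures, for which it can be checked on half-lines, an
  intersection-stable generator of the Borel sets.\<close>

lemma leaf_kernel_measurable:
  assumes fam: "leaf_family \<phi> \<nu>" and K: "seq_var_le Iv tests (leaf_integral \<phi> \<nu>) K"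
    and A: "A \<in> sets (borel :: (real \<times> real) measure)"
  shows "(\<lambda>x. emeasure (\<nu> x) {y\<in>Iv. (x, y) \<in> A} * ennreal (\<phi> x)) \<in> borel_measurable borel_Iv"
proof -
  \<comment> \<open>The masses are bounded by \<open>\<phi> 0 + K\<close>; adding \<open>1\<close>
    keeps the divisor \<open>B\<close> positive.\<close>
  define B where "B = \<phi> 0 + K + 1"
  have B: "0 < B" "\<And>x. x \<in> Iv \<Longrightarrow> \<phi> x \<le> B"
    using leaf_mass_bound[OF fam K] leaf_familyD(1)[OF fam zero_in_Iv] seq_var_le_nonneg[OF K zero_in_Iv]
    by (force simp: B_def)+
  define L where "L x = scale_measure (ennreal (\<phi> x / B)) (distr (\<nu> x) borel (\<lambda>y. y))" for x
  have id: "(\<lambda>x. x) \<in> measurable (\<nu> x) borel" if "x \<in> Iv" for x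
      using measurable_restrict_space1[of "\<lambda>x. x" borel borel Iv] leaf_familyD(3)[OF fam that]
      by (simp cong: measurable_cong_sets)
  have L: "emeasure (L x) S = ennreal (\<phi> x / B) * emeasure (\<nu> x) (S \<inter> Iv)"
    if "x \<in> Iv" "S \<in> sets borel" for x S
    using that id leaf_familyD[OF fam that(1)] by (simp add: L_def emeasure_distr)
  have "L \<in> measurable borel_Iv (subprob_algebra borel)"
  proof (rule measurable_subprob_algebra_generated[where G = "range (\<lambda>t::real. {..t})" and \<Omega> = UNIV])
    show "sets (borel :: real measure) = sigma_sets UNIV (range (\<lambda>t. {..t}))"
      by (simp add: borel_eq_atMost)
    show "Int_stable (range (\<lambda>t::real. {..t}))" by (auto simp: Int_stable_def)
  next
    fix x assume "x \<in> space borel_Iv"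
    then have x: "x \<in> Iv" by (simp add: space_restrict_space)
    note f = leaf_familyD[OF fam x]
    show "subprob_space (L x)"
    proof
      have "emeasure (\<nu> x) Iv = 1" using prob_space.emeasure_space_1[OF f(2)] f(4) by simp
      then have "emeasure (L x) UNIV = ennreal (\<phi> x / B)" using L[OF x, of UNIV] by simp
      then show "emeasure (L x) (space (L x)) \<le> 1"
        using B x by (simp add: L_def space_scale_measure)
    qed (simp add: L_def space_scale_measure)
    show "sets (L x) = sets borel" by (simp add: L_def)
  next
    have half: "(\<lambda>x. emeasure (L x) {..t}) \<in> borel_measurable borel_Iv" for t
    proof -
      have "(\<lambda>x. ennreal (1 / B * (\<phi> x * measure (\<nu> x) ({..t} \<inter> Iv)))) \<in> borel_measurable borel_Iv"
        using leaf_halfline_measurable[OF fam K, of t] by measurable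
      moreover have "ennreal (1 / B * (\<phi> x * measure (\<nu> x) ({..t} \<inter> Iv))) = emeasure (L x) {..t}"
        if "x \<in> space borel_Iv" for x
      proof -
        have x: "x \<in> Iv" using that by (simp add: space_restrict_space)
        interpret prob_space "\<nu> x" by (rule leaf_familyD[OF fam x])
        show ?thesis using B leaf_familyD(1)[OF fam x]
          by (simp add: L[OF x] emeasure_eq_measure ennreal_mult'[symmetric])
      qed
      ultimately show ?thesis using measurable_cong by (metis (no_types, lifting))
    qed
    then show "(\<lambda>x. emeasure (L x) S) \<in> borel_measurable borel_Iv" if "S \<in> range (\<lambda>t::real. {..t})" for S
      using that by auto
    have "emeasure (L x) {..1/2} = emeasure (L x) UNIV" if "x \<in> space borel_Iv" for x
    proof -
      have "{..1/2} \<inter> Iv = UNIV \<inter> Iv" by (auto simp: Iv_def)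
      then show ?thesis using that by (simp add: L space_restrict_space)
    qed
    then show "(\<lambda>x. emeasure (L x) UNIV) \<in> borel_measurable borel_Iv"
      using half[of "1/2"] measurable_cong by (metis (no_types, lifting))
  qed auto
  moreover have "(SIGMA x:space borel_Iv. {y\<in>Iv. (x, y) \<in> A}) \<in> sets (borel_Iv \<Otimes>\<^sub>M borel)"
  proof -
    have "(\<lambda>x. x) \<in> measurable borel_Iv borel" by (rule measurable_restrict_space1) simp
    from measurable_compose[OF measurable_fst this]
    have "(\<lambda>p::real\<times>real. (fst p, snd p)) \<in> measurable (borel_Iv \<Otimes>\<^sub>M borel) (borel \<Otimes>\<^sub>M borel)"
      by (intro measurable_Pair measurable_snd)
    then have "(\<lambda>p::real\<times>real. p) \<in> measurable (borel_Iv \<Otimes>\<^sub>M borel) (borel \<Otimes>\<^sub>M borel)" by simp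
    moreover have "A \<inter> Sigma_sq \<in> sets (borel \<Otimes>\<^sub>M borel)"
      unfolding borel_prod using A by simp
    ultimately have "(\<lambda>p. p) -` (A \<inter> Sigma_sq) \<inter> space (borel_Iv \<Otimes>\<^sub>M borel) \<in> sets (borel_Iv \<Otimes>\<^sub>M borel)"
      by (rule measurable_sets)
    then have "(A \<inter> Sigma_sq) \<inter> space (borel_Iv \<Otimes>\<^sub>M borel) \<in> sets (borel_Iv \<Otimes>\<^sub>M borel)"
      by simp
    moreover have "(SIGMA x:space borel_Iv. {y\<in>Iv. (x, y) \<in> A}) = (A \<inter> Sigma_sq) \<inter> space (borel_Iv \<Otimes>\<^sub>M borel)"
      by (auto simp: space_restrict_space Sigma_sq_def space_pair_measure)
    ultimately show ?thesis by simp
  qed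
  ultimately have "(\<lambda>x. emeasure (L x) {y\<in>Iv. (x, y) \<in> A}) \<in> borel_measurable borel_Iv"
    by (intro emeasure_measurable_subprob_algebra2)
  then have "(\<lambda>x. ennreal B * emeasure (L x) {y\<in>Iv. (x, y) \<in> A}) \<in> borel_measurable borel_Iv"
    by measurable
  moreover have "ennreal B * emeasure (L x) {y\<in>Iv. (x, y) \<in> A} = emeasure (\<nu> x) {y\<in>Iv. (x, y) \<in> A} * ennreal (\<phi> x)"
    if "x \<in> space borel_Iv" for x
  proof -
    have x: "x \<in> Iv" using that by (simp add: space_restrict_space)
    have "(\<lambda>y. (x, y)) -` A \<inter> Iv \<in> sets borel"
      using A by (intro sets.Int measurable_sets_borel[of _ borel]) auto
    also have "(\<lambda>y. (x, y)) -` A \<inter> Iv = {y\<in>Iv. (x, y) \<in> A}" by auto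
    finally have S: "{y\<in>Iv. (x, y) \<in> A} \<in> sets borel" .
    have "{y\<in>Iv. (x, y) \<in> A} \<inter> Iv = {y\<in>Iv. (x, y) \<in> A}" by auto
    then have "ennreal B * emeasure (L x) {y\<in>Iv. (x, y) \<in> A} =
        (ennreal B * ennreal (\<phi> x / B)) * emeasure (\<nu> x) {y\<in>Iv. (x, y) \<in> A}"
      by (simp add: L[OF x S] mult.assoc)
    also have "ennreal B * ennreal (\<phi> x / B) = ennreal (\<phi> x)"
      using B leaf_familyD(1)[OF fam x] by (simp add: ennreal_mult'[symmetric])
    finally show ?thesis by (simp add: mult.commute)
  qed
  ultimately show ?thesis using measurable_cong by (metis (no_types, lifting))
qed

section \<open>The base map\<close>

text \<open>The interval is exhausted by compact intervals \<open>{a n..b n}\<close>, on which the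
  usual change of variables applies, and continuity of measures along increasing unions gives the
  limit. This accommodates a derivative that is unbounded near an end, as \<open>T'\<close> is at
  \<open>c\<close>.\<close>

lemma nn_integral_substitution_open:
  fixes f :: "real \<Rightarrow> ennreal" and T T' :: "real \<Rightarrow> real"
  assumes f [measurable]: "f \<in> borel_measurable borel" and "\<alpha> < \<beta>"
    and der: "\<And>x. x \<in> {\<alpha><..<\<beta>} \<Longrightarrow> (T has_real_derivative T' x) (at x)"
    and cont': "continuous_on {\<alpha><..<\<beta>} T'" and pos: "\<And>x. x \<in> {\<alpha><..<\<beta>} \<Longrightarrow> 0 < T' x"
  shows "(\<integral>\<^sup>+y. f y * indicator (T ` {\<alpha><..<\<beta>}) y \<partial>lborel) =
    (\<integral>\<^sup>+x. f (T x) * ennreal (T' x) * indicator {\<alpha><..<\<beta>} x \<partial>lborel)"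
proof -
  \<comment> \<open>The offset \<open>3\<close> makes \<open>\<delta> n\<close> less than half the
    length, so that \<open>a n < b n\<close> already for \<open>n = 0\<close>.\<close>
  define \<delta> where "\<delta> n = (\<beta> - \<alpha>) / real (n + 3)" for n :: nat
  define a where "a n = \<alpha> + \<delta> n" for n
  define b where "b n = \<beta> - \<delta> n" for n
  have \<delta>: "0 < \<delta> n" "\<delta> n < (\<beta> - \<alpha>) / 2" "m \<le> n \<Longrightarrow> \<delta> n \<le> \<delta> m" for n m
  proof -
    show "0 < \<delta> n" using \<open>\<alpha> < \<beta>\<close> by (simp add: \<delta>_def)
    show "\<delta> n < (\<beta> - \<alpha>) / 2"
      unfolding \<delta>_def using \<open>\<alpha> < \<beta>\<close> by (intro divide_strict_left_mono) auto
    show "\<delta> n \<le> \<delta> m" if "m \<le> n"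
      unfolding \<delta>_def using \<open>\<alpha> < \<beta>\<close> that by (intro divide_left_mono) auto
  qed
  have ab: "\<alpha> < a n" "a n < b n" "b n < \<beta>" for n using \<delta>[of n] by (auto simp: a_def b_def field_simps)
  have mon: "m \<le> n \<Longrightarrow> a n \<le> a m" "m \<le> n \<Longrightarrow> b m \<le> b n" for m n using \<delta>(3) by (auto simp: a_def b_def)
  have "\<delta> \<longlonglongrightarrow> 0"
    unfolding \<delta>_def using LIMSEQ_ignore_initial_segment[OF lim_const_over_n[of "\<beta> - \<alpha>"], of 3] by simp
  have un: "{\<alpha><..<\<beta>} = (\<Union>n. {a n..b n})"
  proof (intro equalityI subsetI)
    fix x assume x: "x \<in> {\<alpha><..<\<beta>}"
    then have "\<forall>\<^sub>F n in sequentially. \<delta> n < min (x - \<alpha>) (\<beta> - x)"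
      using \<open>\<delta> \<longlonglongrightarrow> 0\<close> by (intro order_tendstoD) auto
    then obtain n where "\<delta> n < min (x - \<alpha>) (\<beta> - x)" by (auto simp: eventually_sequentially)
    then show "x \<in> (\<Union>n. {a n..b n})" by (auto simp: a_def b_def intro!: exI[of _ n])
  qed (use ab in \<open>auto intro: less_le_trans le_less_trans\<close>)
  have cT: "continuous_on {\<alpha><..<\<beta>} T"
    by (intro continuous_at_imp_continuous_on ballI DERIV_isCont[OF der])
  have Tmono: "T x < T y" if "x \<in> {\<alpha><..<\<beta>}" "y \<in> {\<alpha><..<\<beta>}" "x < y" for x y
  proof (rule DERIV_pos_imp_increasing[OF that(3)])
    fix z assume "x \<le> z" "z \<le> y"
    then have "z \<in> {\<alpha><..<\<beta>}" using that by auto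
    then show "\<exists>d. (T has_real_derivative d) (at z) \<and> 0 < d" using der pos by blast
  qed
  have im: "T ` {a n..b n} = {T (a n)..T (b n)}" for n
  proof (intro equalityI subsetI)
    fix y assume "y \<in> {T (a n)..T (b n)}"
    moreover have "continuous_on {a n..b n} T"
      using cT ab[of n] by (elim continuous_on_subset) auto
    ultimately show "y \<in> T ` {a n..b n}"
      using IVT'[of T "a n" y "b n"] ab[of n] by force
  next
    fix y assume "y \<in> T ` {a n..b n}"
    then obtain x where x: "x \<in> {a n..b n}" "y = T x" by auto
    then have "T (a n) \<le> T x" "T x \<le> T (b n)"
      using Tmono[of "a n" x] Tmono[of x "b n"] ab[of n] by (force simp: le_less)+
    then show "y \<in> {T (a n)..T (b n)}" using x by auto
  qed
  have imU: "T ` {\<alpha><..<\<beta>} = (\<Union>n. {T (a n)..T (b n)})"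
    unfolding un image_UN im ..
  \<comment> \<open>Cutting off outside the open interval gives Borel functions on the whole
    line.\<close>
  define tr where "tr x = indicator {\<alpha><..<\<beta>} x *\<^sub>R T x" for x
  define tr' where "tr' x = indicator {\<alpha><..<\<beta>} x *\<^sub>R T' x" for x
  have [measurable]: "tr \<in> borel_measurable borel" "tr' \<in> borel_measurable borel"
    unfolding tr_def tr'_def by (intro borel_measurable_continuous_on_indicator cT cont'; simp)+
  define h where "h x = f (tr x) * ennreal (tr' x)" for x
  have h [measurable]: "h \<in> borel_measurable borel" unfolding h_def by measurable
  have heq: "h x * indicator S x = f (T x) * ennreal (T' x) * indicator S x" if "S \<subseteq> {\<alpha><..<\<beta>}" for S x
    using that by (auto simp: h_def tr_def tr'_def indicator_def)
  have "emeasure (density lborel f) (\<Union>n. {T (a n)..T (b n)}) = (SUP n. emeasure (density lborel f) {T (a n)..T (b n)})"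
  proof (rule SUP_emeasure_incseq[symmetric])
    have "{a m..b m} \<subseteq> {a n..b n}" if "m \<le> n" for m n using mon[OF that] by auto
    then have "T ` {a m..b m} \<subseteq> T ` {a n..b n}" if "m \<le> n" for m n using that by blast
    then show "incseq (\<lambda>n. {T (a n)..T (b n)})"
      unfolding im[symmetric] by (auto simp: incseq_def)
  qed auto
  also have "\<dots> = (SUP n. emeasure (density lborel h) {a n..b n})"
  proof (rule SUP_cong[OF refl])
    fix n
    have sub: "{a n..b n} \<subseteq> {\<alpha><..<\<beta>}" using ab[of n] by auto
    have "emeasure (density lborel f) {T (a n)..T (b n)} = (\<integral>\<^sup>+x. f x * indicator {T (a n)..T (b n)} x \<partial>lborel)"
      by (simp add: emeasure_density)
    also have "\<dots> = (\<integral>\<^sup>+x. f (T x) * ennreal (T' x) * indicator {a n..b n} x \<partial>lborel)"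
      using sub ab[of n] der pos
      by (intro nn_integral_substitution_aux) (auto intro!: continuous_on_subset[OF cont'] less_imp_le)
    also have "\<dots> = emeasure (density lborel h) {a n..b n}"
      by (simp add: emeasure_density heq[OF sub])
    finally show "emeasure (density lborel f) {T (a n)..T (b n)} = emeasure (density lborel h) {a n..b n}" .
  qed
  also have "\<dots> = emeasure (density lborel h) (\<Union>n. {a n..b n})"
    by (rule SUP_emeasure_incseq) (use mon in \<open>force simp: incseq_def\<close>)+
  finally show ?thesis
    unfolding imU[symmetric] un[symmetric]
    by (simp add: emeasure_density heq imU)
qed

locale expanding_map =
  fixes T T' :: "real \<Rightarrow> real" and c :: real
  assumes c_in: "-1/2 < c" "c < 1/2"
    and T_onto: "T ` Iv = Iv"
    and T_der_left: "\<And>x. x \<in> {-1/2..<c} \<Longrightarrow>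
                 (T has_real_derivative T' x) (at x within {-1/2..<c})"
    and T_der_right: "\<And>x. x \<in> {c<..1/2} \<Longrightarrow>
                 (T has_real_derivative T' x) (at x within {c<..1/2})"
    and T'_cont: "continuous_on {-1/2..<c} T'" "continuous_on {c<..1/2} T'"
    and T'_gt: "\<And>x. x \<in> Iv - {c} \<Longrightarrow> T' x > 1"
    and T_lim_right: "(T \<longlongrightarrow> -1/2) (at_right c)"
    and T_c: "T c = -1/2"
    and T'_lim: "filterlim T' at_top (at c within Iv)"
    and hyp4: "var_on (Iv - {c}) (\<lambda>x. 1 / T' x) < \<infinity>"
begin

section \<open>Monotonicity and ranges of the two branches\<close>

lemma T_in: "x \<in> Iv \<Longrightarrow> T x \<in> Iv"
  using T_onto by blast

lemma T_der: "x \<in> {-1/2<..<c} \<or> x \<in> {c<..<1/2} \<Longrightarrow> (T has_real_derivative T' x) (at x)"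
proof (elim disjE)
  assume x: "x \<in> {-1/2<..<c}"
  then have "(T has_real_derivative T' x) (at x within {-1/2<..<c})"
    by (intro DERIV_subset[OF T_der_left]) auto
  then show ?thesis unfolding at_within_open[OF x open_greaterThanLessThan] .
next
  assume x: "x \<in> {c<..<1/2}"
  then have "(T has_real_derivative T' x) (at x within {c<..<1/2})"
    by (intro DERIV_subset[OF T_der_right]) auto
  then show ?thesis unfolding at_within_open[OF x open_greaterThanLessThan] .
qed

lemma T_cont: "continuous_on {-1/2..<c} T" "continuous_on {c<..1/2} T"
  using DERIV_continuous_on[OF T_der_left] DERIV_continuous_on[OF T_der_right] by blast+

lemma T_mono_left:
  assumes "-1/2 \<le> x" "x < y" "y < c" shows "T x < T y"
proof (rule DERIV_pos_imp_increasing_open[OF assms(2)])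
  show "continuous_on {x..y} T" using assms by (intro continuous_on_subset[OF T_cont(1)]) auto
  fix z assume "x < z" "z < y"
  then show "\<exists>d. (T has_real_derivative d) (at z) \<and> 0 < d"
    using T_der[of z] T'_gt[of z] assms c_in by (intro exI[of _ "T' z"]) (auto simp: Iv_def)
qed

lemma T_mono_right:
  assumes "c < x" "x < y" "y \<le> 1/2" shows "T x < T y"
proof (rule DERIV_pos_imp_increasing_open[OF assms(2)])
  show "continuous_on {x..y} T" using assms by (intro continuous_on_subset[OF T_cont(2)]) auto
  fix z assume "x < z" "z < y"
  then show "\<exists>d. (T has_real_derivative d) (at z) \<and> 0 < d"
    using T_der[of z] T'_gt[of z] assms c_in by (intro exI[of _ "T' z"]) (auto simp: Iv_def)
qed

lemma T_left_less: "x \<in> {-1/2..<c} \<Longrightarrow> T x < 1/2"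
  using T_mono_left[of x "(x + c) / 2"] T_in[of "(x + c) / 2"] c_in by (auto simp: Iv_def)

lemma T_right_greater: "x \<in> {c<..1/2} \<Longrightarrow> -1/2 < T x"
  using T_mono_right[of "(x + c) / 2" x] T_in[of "(x + c) / 2"] c_in by (auto simp: Iv_def)

text \<open>By surjectivity the value \<open>1/2\<close> is attained. This does not happen at
  \<open>c\<close>, nor on the left branch, which stays below \<open>1/2\<close>, nor before the end
  of the right branch, which is still to increase.\<close>

lemma T_half: "T (1/2) = 1/2"
proof -
  have "1/2 \<in> T ` Iv" using T_onto by (simp add: Iv_def)
  then obtain x where x: "x \<in> Iv" "T x = 1/2" by auto
  have "x \<noteq> c" using x T_c by auto
  moreover have "\<not> x < c" using T_left_less[of x] x by (auto simp: Iv_def)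
  moreover have "\<not> (c < x \<and> x < 1/2)"
    using T_mono_right[of x "1/2"] T_in[of "1/2"] x by (auto simp: Iv_def)
  ultimately have "x = 1/2" using x by (auto simp: Iv_def)
  then show ?thesis using x(2) by (simp only:)
qed

text \<open>The inverse branches; \<open>inv_left\<close> takes the value \<open>-1\<close>, a point outside \<open>Iv\<close>,
  below the range of the left branch.\<close>

definition inv_left :: "real \<Rightarrow> real" where
  "inv_left y = Sup ({-1} \<union> {x\<in>{-1/2..<c}. T x \<le> y})"

definition inv_right :: "real \<Rightarrow> real" where
  "inv_right y = Sup ({c} \<union> {x\<in>{c<..1/2}. T x \<le> y})"

lemma inv_left_bdd: "bdd_above ({-1} \<union> {x\<in>{-1/2..<c}. T x \<le> y})"
  using c_in by (intro bdd_aboveI[of _ c]) auto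

lemma inv_right_bdd: "bdd_above ({c} \<union> {x\<in>{c<..1/2}. T x \<le> y})"
  using c_in by (intro bdd_aboveI[of _ "1/2"]) auto

lemma inv_left_mono: "mono inv_left"
  unfolding inv_left_def by (intro monoI cSup_subset_mono inv_left_bdd) auto

lemma inv_right_mono: "mono inv_right"
  unfolding inv_right_def by (intro monoI cSup_subset_mono inv_right_bdd) auto

lemma inv_left_T: "x \<in> {-1/2..<c} \<Longrightarrow> inv_left (T x) = x"
  unfolding inv_left_def using T_mono_left[of x] by (intro cSup_eq_maximum) (force simp: not_less[symmetric])+

lemma inv_right_T: "x \<in> {c<..1/2} \<Longrightarrow> inv_right (T x) = x"
  unfolding inv_right_def using T_mono_right[of x] by (intro cSup_eq_maximum) (force simp: not_less[symmetric])+

text \<open>The cases are \<open>y\<close> below, above and in the range of the left branch; the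
  intermediate value theorem excludes gaps in that range.\<close>

lemma inv_left_cases:
  assumes "y \<in> Iv"
  shows "inv_left y = -1 \<or> inv_left y = c \<or> (inv_left y \<in> {-1/2..<c} \<and> T (inv_left y) = y)"
proof (cases "\<exists>x\<in>{-1/2..<c}. T x = y")
  case True
  then show ?thesis using inv_left_T by auto
next
  case False
  show ?thesis
  proof (cases "y < T (-1/2)")
    case True
    have "y < T x" if "x \<in> {-1/2..<c}" for x
      using that True T_mono_left[of "-1/2" x] by (cases "x = -1/2") auto
    then have e: "{x\<in>{-1/2..<c}. T x \<le> y} = {}" unfolding not_less[symmetric] by blast
    show ?thesis unfolding inv_left_def e by simp
  next
    case ge: False
    have "T x \<le> y" if x: "x \<in> {-1/2..<c}" for x
    proof (rule ccontr)
      assume "\<not> T x \<le> y"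
      moreover have "continuous_on {-1/2..x} T"
        using x by (intro continuous_on_subset[OF T_cont(1)]) auto
      ultimately obtain z where "-1/2 \<le> z" "z \<le> x" "T z = y"
        using IVT'[of T "-1/2" y x] ge x by auto
      then show False using False x by auto
    qed
    then have "{-1} \<union> {x\<in>{-1/2..<c}. T x \<le> y} = {-1} \<union> {-1/2..<c}" by auto
    moreover have "Sup ({-1} \<union> {-1/2..<c}) = c"
      using c_in by (subst cSup_union_distrib) (auto simp: sup_max)
    ultimately show ?thesis unfolding inv_left_def by metis
  qed
qed

text \<open>The value \<open>c\<close> belongs to \<open>y = -1/2\<close>. For larger
  \<open>y\<close> the limit at \<open>c\<close> from the right provides a point with a smaller
  value, and the intermediate value theorem applies between it and \<open>1/2\<close>.\<close>

lemma inv_right_cases: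
  assumes "y \<in> Iv"
  shows "inv_right y = c \<or> (inv_right y \<in> {c<..1/2} \<and> T (inv_right y) = y)"
proof (cases "y = -1/2")
  case True
  then have e: "{x\<in>{c<..1/2}. T x \<le> y} = {}" using T_right_greater by (force simp: not_le)
  show ?thesis unfolding inv_right_def e by simp
next
  case False
  then have "-1/2 < y" using assms by (auto simp: Iv_def)
  have "\<forall>\<^sub>F x in at_right c. T x < y" using T_lim_right \<open>-1/2 < y\<close> by (rule order_tendstoD)
  moreover have "\<forall>\<^sub>F x in at_right c. x \<in> {c<..<1/2}" using c_in(2) by (rule eventually_at_right_real)
  ultimately have "\<forall>\<^sub>F x in at_right c. T x < y \<and> x \<in> {c<..<1/2}" by (rule eventually_conj)
  then obtain x where x: "T x < y" "x \<in> {c<..<1/2}"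
    using eventually_happens'[OF trivial_limit_at_right_real] by blast
  have "continuous_on {x..1/2} T" using x by (intro continuous_on_subset[OF T_cont(2)]) auto
  then obtain z where "x \<le> z" "z \<le> 1/2" "T z = y"
    using IVT'[of T x y "1/2"] x assms T_half by (auto simp: Iv_def)
  then show ?thesis using inv_right_T[of z] x by auto
qed

text \<open>At \<open>c\<close> the value \<open>0\<close> is the limit of \<open>1 / T'\<close>. As
  it is also \<open>0\<close> outside \<open>Iv\<close>, the default values \<open>-1\<close> and
  \<open>c\<close> of the inverse branches carry no mass.\<close>

definition weight :: "real \<Rightarrow> real" where
  "weight x = (if x \<in> Iv - {c} then 1 / T' x else 0)"

lemma weight_bounds: "0 \<le> weight x" "weight x \<le> 1"
  using T'_gt[of x] by (auto simp: weight_def)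

lemma weight_c [simp]: "weight c = 0"
  by (simp add: weight_def)

lemma weight_measurable [measurable]: "weight \<in> borel_measurable borel"
proof -
  have "T' x \<noteq> 0" if "x \<in> {-1/2..<c} \<or> x \<in> {c<..1/2}" for x
    using T'_gt[of x] that c_in by (auto simp: Iv_def)
  then have "continuous_on {-1/2..<c} (\<lambda>x. 1 / T' x)" "continuous_on {c<..1/2} (\<lambda>x. 1 / T' x)"
    by (intro continuous_on_divide continuous_on_const T'_cont; blast)+
  then have "(\<lambda>x. indicator {-1/2..<c} x *\<^sub>R (1 / T' x) + indicator {c<..1/2} x *\<^sub>R (1 / T' x)) \<in> borel_measurable borel"
    by (intro borel_measurable_add borel_measurable_continuous_on_indicator) auto
  moreover have "weight = (\<lambda>x. indicator {-1/2..<c} x *\<^sub>R (1 / T' x) + indicator {c<..1/2} x *\<^sub>R (1 / T' x))"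
    using c_in by (auto simp: fun_eq_iff weight_def Iv_def indicator_def)
  ultimately show ?thesis by simp
qed

definition V :: real where
  "V = real_of_ereal (var_on (Iv - {c}) (\<lambda>x. 1 / T' x))"

text \<open>The bound on \<open>Iv - {c}\<close> extends to \<open>c\<close> because
  \<open>1 / T'\<close> tends to \<open>0\<close> there, along a sequence approaching
  \<open>c\<close> from the right.\<close>

lemma weight_variation: "seq_var_le Iv UNIV (\<lambda>x (_::unit). weight x) V"
proof (rule seq_var_le_limit)
  have "[] \<in> incr_seqs (Iv - {c})" by (simp add: incr_seqs_def)
  then have "0 \<le> var_on (Iv - {c}) (\<lambda>x. 1 / T' x)"
    unfolding var_on_def by (intro SUP_upper2[of "[]"]) auto
  then have "var_on (Iv - {c}) (\<lambda>x. 1 / T' x) = ereal V" "0 \<le> V"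
    using hyp4 unfolding V_def by (cases "var_on (Iv - {c}) (\<lambda>x. 1 / T' x)"; simp)+
  then show "seq_var_le (Iv - {c}) UNIV (\<lambda>x (_::unit). 1 / T' x) V"
    by (subst var_on_le_iff[symmetric]) auto
next
  fix x assume x: "x \<in> Iv"
  show "\<exists>d. (\<forall>n. d n \<in> Iv - {c}) \<and> d \<longlonglongrightarrow> x \<and> (\<forall>g::unit\<in>UNIV. (\<lambda>n. 1 / T' (d n)) \<longlonglongrightarrow> weight x)"
  proof (cases "x = c")
    case False
    then show ?thesis using x by (intro exI[of _ "\<lambda>_. x"]) (auto simp: weight_def)
  next
    case True
    define d where "d n = c + (1/2 - c) / real (Suc n)" for n
    have d: "d n \<in> Iv - {c}" for n
    proof -
      have "0 < (1/2 - c) / real (Suc n)" "(1/2 - c) / real (Suc n) \<le> 1/2 - c"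
        using c_in by (auto simp: divide_le_eq)
      then have "c < d n" "d n \<le> 1/2" unfolding d_def by linarith+
      then show ?thesis using c_in by (auto simp: Iv_def)
    qed
    have lim: "d \<longlonglongrightarrow> c"
      unfolding d_def using tendsto_add[OF tendsto_const[of c] LIMSEQ_Suc[OF lim_const_over_n[of "1/2 - c"]]]
      by simp
    have "filterlim d (at c within Iv) sequentially"
      using lim d by (auto simp: filterlim_at)
    then have "filterlim (\<lambda>n. T' (d n)) at_top sequentially"
      by (rule filterlim_compose[OF T'_lim])
    then have "(\<lambda>n. inverse (T' (d n))) \<longlonglongrightarrow> 0"
      by (rule tendsto_inverse_0_at_top)
    then show ?thesis using d lim True by (intro exI[of _ d]) (auto simp: inverse_eq_divide)
  qed
qed

text \<open>Change of variables on each branch: substituting an inverse branch brings in the factor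
  \<open>1 / T'\<close>, that is, \<open>weight\<close>. The ends of the branches form a null set,
  and for \<open>y\<close> outside the range of a branch the weight vanishes.\<close>

lemma nn_integral_transfer:
  fixes H :: "real \<Rightarrow> ennreal"
  assumes H [measurable]: "H \<in> borel_measurable borel"
  shows "(\<integral>\<^sup>+x. H x * indicator Iv x \<partial>lborel) =
    (\<integral>\<^sup>+y. (ennreal (weight (inv_left y)) * H (inv_left y) + ennreal (weight (inv_right y)) * H (inv_right y))
       * indicator Iv y \<partial>lborel)"
proof -
  have [measurable]: "inv_left \<in> borel_measurable borel" "inv_right \<in> borel_measurable borel"
    by (intro borel_measurable_mono inv_left_mono inv_right_mono)+
  have null: "AE x in lborel. x \<notin> {a, b, d}" for a b d :: real
    by (intro AE_not_in) (simp add: null_sets_def emeasure_lborel_countable)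
  have br: "(\<integral>\<^sup>+x. H x * indicator {\<alpha><..<\<beta>} x \<partial>lborel) =
    (\<integral>\<^sup>+y. ennreal (weight (g y)) * H (g y) * indicator (T ` {\<alpha><..<\<beta>}) y \<partial>lborel)"
    if g: "g \<in> borel_measurable borel" "\<And>x. x \<in> {\<alpha><..<\<beta>} \<Longrightarrow> g (T x) = x"
      and ab: "\<alpha> < \<beta>" "{\<alpha><..<\<beta>} \<subseteq> Iv - {c}"
        "\<And>x. x \<in> {\<alpha><..<\<beta>} \<Longrightarrow> x \<in> {-1/2<..<c} \<or> x \<in> {c<..<1/2}" "continuous_on {\<alpha><..<\<beta>} T'" for \<alpha> \<beta> g
  proof -
    note [measurable] = g(1)
    have "(\<integral>\<^sup>+y. ennreal (weight (g y)) * H (g y) * indicator (T ` {\<alpha><..<\<beta>}) y \<partial>lborel) =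
      (\<integral>\<^sup>+x. ennreal (weight (g (T x))) * H (g (T x)) * ennreal (T' x) * indicator {\<alpha><..<\<beta>} x \<partial>lborel)"
    proof (rule nn_integral_substitution_open)
      fix x assume x: "x \<in> {\<alpha><..<\<beta>}"
      show "(T has_real_derivative T' x) (at x)" using ab(3)[OF x] by (rule T_der)
      have "x \<in> Iv - {c}" using ab(2) x by blast
      then show "0 < T' x" using T'_gt[of x] by simp
    qed (use ab in auto)
    also have "\<dots> = (\<integral>\<^sup>+x. H x * indicator {\<alpha><..<\<beta>} x \<partial>lborel)"
    proof (intro nn_integral_cong)
      fix x
      show "ennreal (weight (g (T x))) * H (g (T x)) * ennreal (T' x) * indicator {\<alpha><..<\<beta>} x = H x * indicator {\<alpha><..<\<beta>} x"
      proof (cases "x \<in> {\<alpha><..<\<beta>}")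
        case True
        then have x: "x \<in> Iv - {c}" using ab(2) by blast
        have "ennreal (weight x) * ennreal (T' x) = 1"
          using x T'_gt[OF x] by (simp add: weight_def ennreal_mult'[symmetric])
        then show ?thesis using True g(2)[OF True] by (simp add: mult.commute mult.left_commute mult.assoc)
      qed simp
    qed
    finally show ?thesis by simp
  qed
  have L: "(\<integral>\<^sup>+x. H x * indicator {-1/2<..<c} x \<partial>lborel) =
     (\<integral>\<^sup>+y. ennreal (weight (inv_left y)) * H (inv_left y) * indicator (T ` {-1/2<..<c}) y \<partial>lborel)"
    using c_in inv_left_T by (intro br) (auto simp: Iv_def intro!: continuous_on_subset[OF T'_cont(1)])
  have R: "(\<integral>\<^sup>+x. H x * indicator {c<..<1/2} x \<partial>lborel) =
     (\<integral>\<^sup>+y. ennreal (weight (inv_right y)) * H (inv_right y) * indicator (T ` {c<..<1/2}) y \<partial>lborel)"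
    using c_in inv_right_T by (intro br) (auto simp: Iv_def intro!: continuous_on_subset[OF T'_cont(2)])
  have L2: "(\<integral>\<^sup>+y. ennreal (weight (inv_left y)) * H (inv_left y) * indicator (T ` {-1/2<..<c}) y \<partial>lborel) =
    (\<integral>\<^sup>+y. ennreal (weight (inv_left y)) * H (inv_left y) * indicator Iv y \<partial>lborel)"
  proof (rule nn_integral_cong_AE, use null[of "T (-1/2)" 0 0] in eventually_elim)
    fix y assume y: "y \<notin> {T (-1/2), 0, 0}"
    have "y \<in> T ` {-1/2<..<c}" if "y \<in> Iv" "weight (inv_left y) \<noteq> 0"
    proof -
      have "inv_left y \<in> {-1/2..<c} \<and> T (inv_left y) = y"
        using inv_left_cases[OF that(1)] that(2) by (auto simp: weight_def Iv_def)
      moreover have "inv_left y \<noteq> -1/2" using calculation y by (metis insertI1)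
      ultimately show ?thesis by (intro image_eqI[of _ _ "inv_left y"]) auto
    qed
    moreover have "T ` {-1/2<..<c} \<subseteq> Iv" using T_in c_in by (auto simp: Iv_def)
    ultimately show "ennreal (weight (inv_left y)) * H (inv_left y) * indicator (T ` {-1/2<..<c}) y =
      ennreal (weight (inv_left y)) * H (inv_left y) * indicator Iv y"
      by (cases "weight (inv_left y) = 0") (auto simp: indicator_def)
  qed
  have R2: "(\<integral>\<^sup>+y. ennreal (weight (inv_right y)) * H (inv_right y) * indicator (T ` {c<..<1/2}) y \<partial>lborel) =
    (\<integral>\<^sup>+y. ennreal (weight (inv_right y)) * H (inv_right y) * indicator Iv y \<partial>lborel)"
  proof (rule nn_integral_cong_AE, use null[of "T (1/2)" 0 0] in eventually_elim)
    fix y assume y: "y \<notin> {T (1/2), 0, 0}"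
    have "y \<in> T ` {c<..<1/2}" if "y \<in> Iv" "weight (inv_right y) \<noteq> 0"
    proof -
      have "inv_right y \<in> {c<..1/2} \<and> T (inv_right y) = y"
        using inv_right_cases[OF that(1)] that(2) by auto
      moreover have "inv_right y \<noteq> 1/2" using calculation y by (metis insertI1)
      ultimately show ?thesis by (intro image_eqI[of _ _ "inv_right y"]) auto
    qed
    moreover have "T ` {c<..<1/2} \<subseteq> Iv" using T_in c_in by (auto simp: Iv_def)
    ultimately show "ennreal (weight (inv_right y)) * H (inv_right y) * indicator (T ` {c<..<1/2}) y =
      ennreal (weight (inv_right y)) * H (inv_right y) * indicator Iv y"
      by (cases "weight (inv_right y) = 0") (auto simp: indicator_def)
  qed
  have "(\<integral>\<^sup>+x. H x * indicator Iv x \<partial>lborel) =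
    (\<integral>\<^sup>+x. H x * indicator {-1/2<..<c} x + H x * indicator {c<..<1/2} x \<partial>lborel)"
    by (rule nn_integral_cong_AE, use null[of "-1/2" c "1/2"] in eventually_elim)
      (use c_in in \<open>auto simp: Iv_def indicator_def\<close>)
  also have "\<dots> = (\<integral>\<^sup>+x. H x * indicator {-1/2<..<c} x \<partial>lborel) + (\<integral>\<^sup>+x. H x * indicator {c<..<1/2} x \<partial>lborel)"
    by (rule nn_integral_add) auto
  also have "\<dots> = (\<integral>\<^sup>+y. ennreal (weight (inv_left y)) * H (inv_left y) * indicator Iv y \<partial>lborel) +
      (\<integral>\<^sup>+y. ennreal (weight (inv_right y)) * H (inv_right y) * indicator Iv y \<partial>lborel)"
    unfolding L R L2 R2 ..
  also have "\<dots> = (\<integral>\<^sup>+y. (ennreal (weight (inv_left y)) * H (inv_left y) + ennreal (weight (inv_right y)) * H (inv_right y))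
       * indicator Iv y \<partial>lborel)"
    by (subst nn_integral_add[symmetric]) (auto simp: distrib_right)
  finally show ?thesis .
qed

end

section \<open>The skew product\<close>

text \<open>The convex combination of \<open>M\<close> and \<open>N\<close> with weights
  proportional to \<open>a\<close> and \<open>b\<close>, encoded as a random choice between them. If
  \<open>a + b = 0\<close>, the quotient is \<open>0\<close> by convention and the result is
  \<open>N\<close>, which is harmless since it is then scaled by \<open>0\<close>.\<close>

definition mixture :: "real \<Rightarrow> real \<Rightarrow> real measure \<Rightarrow> real measure \<Rightarrow> real measure" where
  "mixture a b M N = measure_pmf (bernoulli_pmf (a / (a + b))) \<bind> (\<lambda>t. if t then M else N)"

context
  fixes a b :: real and M N :: "real measure"
  assumes ab: "0 \<le> a" "0 \<le> b" and M: "prob_space M" "sets M = sets borel_Iv"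
    and N: "prob_space N" "sets N = sets borel_Iv"
begin

lemma mixture_kernel:
  "(\<lambda>t. if t then M else N) \<in> measurable (measure_pmf p) (subprob_algebra borel_Iv)"
  using M N by (auto simp: measurable_def space_subprob_algebra prob_space_imp_subprob_space)

lemma mixture_weight: "a / (a + b) \<in> {0..1}"
    "(a + b) * (a / (a + b)) = a" "(a + b) * (1 - a / (a + b)) = b"
proof -
  show "a / (a + b) \<in> {0..1}" using ab by (auto simp: divide_le_eq)
  show "(a + b) * (a / (a + b)) = a" using ab by (cases "a + b = 0") auto
  then show "(a + b) * (1 - a / (a + b)) = b" by (simp add: right_diff_distrib)
qed

lemma prob_space_mixture: "prob_space (mixture a b M N)"
  unfolding mixture_def
  by (rule measure_pmf.prob_space_bind[OF _ mixture_kernel]) (use M N in auto)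

lemma sets_mixture: "sets (mixture a b M N) = sets borel_Iv"
  unfolding mixture_def by (rule sets_bind) (use M N in auto)

lemma emeasure_mixture:
  assumes "A \<in> sets borel_Iv"
  shows "ennreal (a + b) * emeasure (mixture a b M N) A = ennreal a * emeasure M A + ennreal b * emeasure N A"
proof -
  have "emeasure (mixture a b M N) A =
      emeasure M A * ennreal (a / (a + b)) + emeasure N A * ennreal (1 - a / (a + b))"
    unfolding mixture_def using mixture_weight
    by (subst emeasure_bind[OF _ mixture_kernel assms]) auto
  then have "ennreal (a + b) * emeasure (mixture a b M N) A =
    (ennreal (a + b) * ennreal (a / (a + b))) * emeasure M A +
    (ennreal (a + b) * ennreal (1 - a / (a + b))) * emeasure N A"
    by (simp add: distrib_left mult.commute mult.left_commute mult.assoc)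
  also have "ennreal (a + b) * ennreal (a / (a + b)) = ennreal a"
    using mixture_weight ab by (subst ennreal_mult'[symmetric]) auto
  also have "ennreal (a + b) * ennreal (1 - a / (a + b)) = ennreal b"
    using mixture_weight ab by (subst ennreal_mult'[symmetric]) auto
  finally show ?thesis .
qed

lemma integral_mixture:
  fixes g :: "real \<Rightarrow> real"
  assumes "g \<in> borel_measurable borel_Iv" "\<And>x. x \<in> Iv \<Longrightarrow> \<bar>g x\<bar> \<le> B"
  shows "(a + b) * integral\<^sup>L (mixture a b M N) g = a * integral\<^sup>L M g + b * integral\<^sup>L N g"
proof -
  have fs: "finite_measure (measure_pmf p)" for p :: "bool pmf" by unfold_locales
  have "integral\<^sup>L (mixture a b M N) g =
      integral\<^sup>L M g * (a / (a + b)) + integral\<^sup>L N g * (1 - a / (a + b))"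
    unfolding mixture_def using mixture_weight assms
    by (subst integral_bind[OF _ _ _ fs, where K = borel_Iv and B = B and B' = 1])
      (use M N mixture_kernel in \<open>auto simp: space_restrict_space prob_space.emeasure_space_1\<close>)
  then have "(a + b) * integral\<^sup>L (mixture a b M N) g =
    (a + b) * (integral\<^sup>L M g * (a / (a + b)) + integral\<^sup>L N g * (1 - a / (a + b)))"
    by (rule arg_cong)
  also have "\<dots> = ((a + b) * (a / (a + b))) * integral\<^sup>L M g + ((a + b) * (1 - a / (a + b))) * integral\<^sup>L N g"
    by (simp only: distrib_left mult.commute mult.left_commute)
  finally show ?thesis unfolding mixture_weight .
qed

end

locale skew_map = expanding_map +
  fixes G :: "real \<Rightarrow> real \<Rightarrow> real" and k lam :: real
  assumes k_nn: "0 \<le> k"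
    and G_maps: "\<And>x y. x \<in> Iv \<Longrightarrow> y \<in> Iv \<Longrightarrow> G x y \<in> Iv"
    and hyp1: "\<And>x1 x2 y. x1 \<in> Iv \<Longrightarrow> x2 \<in> Iv \<Longrightarrow> y \<in> Iv \<Longrightarrow>
                 c \<notin> {min x1 x2..max x1 x2} \<Longrightarrow> \<bar>G x1 y - G x2 y\<bar> \<le> k * \<bar>x1 - x2\<bar>"
    and hyp2: "\<And>x y1 y2. x \<in> Iv \<Longrightarrow> y1 \<in> Iv \<Longrightarrow> y2 \<in> Iv \<Longrightarrow>
                 \<bar>G x y1 - G x y2\<bar> \<le> lam * \<bar>y1 - y2\<bar>"
    and lam: "lam < 1"
begin

abbreviation F :: "real \<times> real \<Rightarrow> real \<times> real" where
  "F \<equiv> \<lambda>(x, y). (T x, G x y)"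

lemma lam_nonneg: "0 \<le> lam"
  using hyp2[of 0 0 "1/2"] abs_ge_zero[of "G 0 0 - G 0 (1/2)"] by (simp add: Iv_def del: abs_ge_zero)

lemma G_continuous: "x \<in> Iv \<Longrightarrow> continuous_on Iv (G x)"
  by (rule lipschitz_on_continuous_on[where L = lam])
    (use lam_nonneg hyp2 in \<open>auto simp: lipschitz_on_def dist_real_def\<close>)

lemma G_measurable: "x \<in> Iv \<Longrightarrow> G x \<in> measurable borel_Iv borel_Iv"
  using G_maps by (intro measurable_restrict_space2 borel_measurable_continuous_on_restrict G_continuous)
    (auto simp: space_restrict_space)

text \<open>The square is cut into the line over \<open>c\<close> and the two strips beside it. On
  each piece both components are continuous: \<open>T\<close> is differentiable on the strips and
  constant on the line, and \<open>G\<close> is Lipschitz with constant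
  \<open>k + lam\<close>.\<close>

lemma F_measurable: "F \<in> measurable (restrict_space borel Sigma_sq) (restrict_space borel Sigma_sq)"
proof -
  let ?L = "{-1/2..<c} \<times> Iv" and ?C = "{c} \<times> Iv" and ?R = "{c<..1/2} \<times> Iv"
  have sets: "?L \<in> sets borel" "?C \<in> sets borel" "?R \<in> sets borel"
    unfolding borel_prod[symmetric] by (auto intro!: pair_measureI)
  have sum: "indicator ?L p *\<^sub>R f p + indicator ?C p *\<^sub>R f p + indicator ?R p *\<^sub>R f p = f p"
    if "p \<in> Sigma_sq" for p and f :: "real \<times> real \<Rightarrow> real"
  proof -
    have "indicator ?L p + indicator ?C p + indicator ?R p = (1::real)"
      using that c_in by (cases p) (auto simp: Sigma_sq_def Iv_def indicator_def)
    then show ?thesis by (simp only: scaleR_left_distrib[symmetric] scaleR_one)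
  qed
  have pieces: "f \<in> borel_measurable (restrict_space borel Sigma_sq)"
    if "continuous_on ?L f" "continuous_on ?C f" "continuous_on ?R f" for f :: "real \<times> real \<Rightarrow> real"
  proof -
    have "(\<lambda>p. indicator ?L p *\<^sub>R f p + indicator ?C p *\<^sub>R f p + indicator ?R p *\<^sub>R f p) \<in> borel_measurable borel"
      by (intro borel_measurable_add borel_measurable_continuous_on_indicator sets that)
    from measurable_restrict_space1[OF this, of Sigma_sq] show ?thesis
      by (subst (asm) measurable_cong[where g = f]) (rule sum, simp add: space_restrict_space)
  qed
  have Gl: "continuous_on S (\<lambda>p. G (fst p) (snd p))"
    if S: "S \<subseteq> Sigma_sq" "\<And>p q. p \<in> S \<Longrightarrow> q \<in> S \<Longrightarrow> fst p = fst q \<or> c \<notin> {min (fst p) (fst q)..max (fst p) (fst q)}" for S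
  proof (rule lipschitz_on_continuous_on[where L = "k + lam"], rule lipschitz_onI)
    show "0 \<le> k + lam" using k_nn lam_nonneg by simp
    fix p q assume pq: "p \<in> S" "q \<in> S"
    then have in_Iv: "fst p \<in> Iv" "snd p \<in> Iv" "fst q \<in> Iv" "snd q \<in> Iv" using S(1) by (auto simp: Sigma_sq_def)
    have "\<bar>G (fst p) (snd p) - G (fst q) (snd p)\<bar> \<le> k * \<bar>fst p - fst q\<bar>"
      using S(2)[OF pq] hyp1[of "fst p" "fst q" "snd p"] in_Iv k_nn by auto
    moreover have "\<bar>G (fst q) (snd p) - G (fst q) (snd q)\<bar> \<le> lam * \<bar>snd p - snd q\<bar>"
      using hyp2 in_Iv by auto
    moreover have "k * \<bar>fst p - fst q\<bar> \<le> k * dist p q" "lam * \<bar>snd p - snd q\<bar> \<le> lam * dist p q"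
      using dist_fst_le[of p q] dist_snd_le[of p q] k_nn lam_nonneg
      by (auto simp: dist_real_def intro!: mult_left_mono)
    ultimately show "dist (G (fst p) (snd p)) (G (fst q) (snd q)) \<le> (k + lam) * dist p q"
      unfolding dist_real_def distrib_right by linarith
  qed
  have "(\<lambda>p. T (fst p)) \<in> borel_measurable (restrict_space borel Sigma_sq)"
  proof (rule pieces)
    show "continuous_on ?L (\<lambda>p. T (fst p))" "continuous_on ?R (\<lambda>p. T (fst p))"
      by (rule continuous_on_compose2[OF T_cont(1)] continuous_on_compose2[OF T_cont(2)];
        auto intro!: continuous_intros)+
    have "continuous_on ?C (\<lambda>p. T c)" by simp
    then show "continuous_on ?C (\<lambda>p. T (fst p))" by (rule continuous_on_eq) auto
  qed
  moreover have "(\<lambda>p. G (fst p) (snd p)) \<in> borel_measurable (restrict_space borel Sigma_sq)"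
    by (intro pieces Gl) (use c_in in \<open>auto simp: Sigma_sq_def Iv_def\<close>)
  ultimately have "(\<lambda>p. (T (fst p), G (fst p) (snd p))) \<in> measurable (restrict_space borel Sigma_sq) (borel \<Otimes>\<^sub>M borel)"
    by (rule measurable_Pair)
  then have "F \<in> measurable (restrict_space borel Sigma_sq) borel"
    by (simp add: borel_prod case_prod_beta)
  then show ?thesis
    by (rule measurable_restrict_space2[rotated]) (auto simp: space_restrict_space Sigma_sq_def T_in G_maps)
qed

section \<open>The image of a disintegration under the skew product\<close>

definition branch_mass :: "(real \<Rightarrow> real) \<Rightarrow> real \<Rightarrow> real" where
  "branch_mass \<phi> x = weight x * \<phi> (clamp_Iv x)"

text \<open>For a leaf family, clamping keeps this a probability measure even at the default point
  \<open>-1\<close> of \<open>inv_left\<close>, where the mass is \<open>0\<close>.\<close>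

definition branch_push :: "(real \<Rightarrow> real measure) \<Rightarrow> real \<Rightarrow> real measure" where
  "branch_push \<nu> x = distr (\<nu> (clamp_Iv x)) borel_Iv (G (clamp_Iv x))"

definition next_mass :: "(real \<Rightarrow> real) \<Rightarrow> real \<Rightarrow> real" where
  "next_mass \<phi> y = branch_mass \<phi> (inv_left y) + branch_mass \<phi> (inv_right y)"

definition next_leaf :: "(real \<Rightarrow> real) \<Rightarrow> (real \<Rightarrow> real measure) \<Rightarrow> real \<Rightarrow> real measure" where
  "next_leaf \<phi> \<nu> y = mixture (branch_mass \<phi> (inv_left y)) (branch_mass \<phi> (inv_right y))
     (branch_push \<nu> (inv_left y)) (branch_push \<nu> (inv_right y))"

definition branch_integral :: "(real \<Rightarrow> real) \<Rightarrow> (real \<Rightarrow> real measure) \<Rightarrow> real \<Rightarrow> (real \<Rightarrow> real) \<Rightarrow> real" where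
  "branch_integral \<phi> \<nu> x g = branch_mass \<phi> x * (\<integral>z. g (G (clamp_Iv x) z) \<partial>\<nu> (clamp_Iv x))"

context
  fixes \<phi> \<nu> assumes fam: "leaf_family \<phi> \<nu>"
begin

lemma branch_mass_nonneg: "0 \<le> branch_mass \<phi> x"
  using leaf_familyD(1)[OF fam clamp_Iv_in] weight_bounds by (simp add: branch_mass_def)

lemma G_measurable_leaf: "x \<in> Iv \<Longrightarrow> G x \<in> measurable (\<nu> x) borel_Iv"
  using G_measurable[of x] leaf_familyD(3)[OF fam] measurable_cong_sets[OF leaf_familyD(3)[OF fam] refl] by blast

lemma branch_push_prob: "prob_space (branch_push \<nu> x)" "sets (branch_push \<nu> x) = sets borel_Iv"
  unfolding branch_push_def
  by (auto intro!: prob_space.prob_space_distr leaf_familyD[OF fam] G_measurable_leaf)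

lemma next_leaf_family: "leaf_family (next_mass \<phi>) (next_leaf \<phi> \<nu>)"
  unfolding leaf_family_def next_mass_def next_leaf_def
  using branch_mass_nonneg
  by (intro ballI conjI add_nonneg_nonneg prob_space_mixture sets_mixture branch_push_prob)

lemma next_leaf_integral:
  assumes "g \<in> borel_measurable borel_Iv" "\<And>x. x \<in> Iv \<Longrightarrow> \<bar>g x\<bar> \<le> B"
  shows "leaf_integral (next_mass \<phi>) (next_leaf \<phi> \<nu>) y g =
    branch_integral \<phi> \<nu> (inv_left y) g + branch_integral \<phi> \<nu> (inv_right y) g"
proof -
  have "integral\<^sup>L (branch_push \<nu> x) g = (\<integral>z. g (G (clamp_Iv x) z) \<partial>\<nu> (clamp_Iv x))" for x
    unfolding branch_push_def by (intro integral_distr G_measurable_leaf assms) simp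
  then show ?thesis
    unfolding leaf_integral_def next_mass_def next_leaf_def branch_integral_def
    by (subst integral_mixture[OF branch_mass_nonneg branch_mass_nonneg branch_push_prob branch_push_prob assms])
      auto
qed

lemma next_leaf_emeasure:
  assumes "S \<in> sets borel_Iv"
  shows "emeasure (next_leaf \<phi> \<nu> y) S * ennreal (next_mass \<phi> y) =
    ennreal (branch_mass \<phi> (inv_left y)) * emeasure (\<nu> (clamp_Iv (inv_left y))) {z\<in>Iv. G (clamp_Iv (inv_left y)) z \<in> S} +
    ennreal (branch_mass \<phi> (inv_right y)) * emeasure (\<nu> (clamp_Iv (inv_right y))) {z\<in>Iv. G (clamp_Iv (inv_right y)) z \<in> S}"
proof -
  have "emeasure (branch_push \<nu> x) S = emeasure (\<nu> (clamp_Iv x)) {z\<in>Iv. G (clamp_Iv x) z \<in> S}" for x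
    unfolding branch_push_def
    by (subst emeasure_distr[OF G_measurable_leaf assms])
      (auto simp: leaf_familyD(4)[OF fam] intro!: arg_cong2[where f = emeasure])
  then show ?thesis
    unfolding next_mass_def next_leaf_def
    using emeasure_mixture[OF branch_mass_nonneg branch_mass_nonneg branch_push_prob branch_push_prob assms]
    by (simp add: mult.commute)
qed

text \<open>The slice over \<open>x\<close> of the preimage \<open>E\<close> of \<open>A\<close> is
  the preimage under \<open>G x\<close> of the slice of \<open>A\<close> over \<open>T x\<close>.
  Hence \<open>nn_integral_transfer\<close> turns the integral over \<open>x\<close> into one over
  \<open>y = T x\<close>, summed over the two preimages of \<open>y\<close>.\<close>

lemma next_disintegrates:
  assumes K: "seq_var_le Iv tests (leaf_integral \<phi> \<nu>) K" and dis: "disintegrates \<mu> \<phi> \<nu>"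
    and sets: "sets \<mu> = sets (restrict_space borel Sigma_sq)"
  shows "disintegrates (distr \<mu> (restrict_space borel Sigma_sq) F) (next_mass \<phi>) (next_leaf \<phi> \<nu>)"
  unfolding disintegrates_def
proof
  fix A assume "A \<in> sets (distr \<mu> (restrict_space borel Sigma_sq) F)"
  then have A: "A \<in> sets (restrict_space borel Sigma_sq)" by simp
  have Fm: "F \<in> measurable \<mu> (restrict_space borel Sigma_sq)"
    using F_measurable measurable_cong_sets[OF sets refl] by blast
  have sp: "space \<mu> = Sigma_sq" using sets_eq_imp_space_eq[OF sets] by (simp add: space_restrict_space)
  define E where "E = F -` A \<inter> Sigma_sq"
  have E: "E \<in> sets \<mu>" using measurable_sets[OF Fm A] by (simp add: sp E_def)
  then have Eb: "E \<in> sets borel" using sets by (simp add: sets_restrict_space_iff)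
  \<comment> \<open>Extension by \<open>0\<close> turns the kernel, known to be measurable on
    \<open>Iv\<close>, into a Borel function on the line.\<close>
  define H where "H x = (if x \<in> Iv then emeasure (\<nu> x) {z\<in>Iv. (x, z) \<in> E} * ennreal (\<phi> x) else 0)" for x
  have H: "H \<in> borel_measurable borel"
    unfolding H_def using leaf_kernel_measurable[OF fam K Eb]
    by (subst measurable_If_restrict_space_iff) (auto simp: pred_def)
  have "emeasure (distr \<mu> (restrict_space borel Sigma_sq) F) A = emeasure \<mu> E"
    by (simp add: emeasure_distr[OF Fm A] sp E_def)
  also have "\<dots> = (\<integral>\<^sup>+x. emeasure (\<nu> x) {z\<in>Iv. (x, z) \<in> E} * ennreal (\<phi> x) * indicator Iv x \<partial>lborel)"
    using dis E by (simp add: disintegrates_def)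
  also have "\<dots> = (\<integral>\<^sup>+x. H x * indicator Iv x \<partial>lborel)"
    by (intro nn_integral_cong) (auto simp: H_def indicator_def)
  also have "\<dots> = (\<integral>\<^sup>+y. (ennreal (weight (inv_left y)) * H (inv_left y) + ennreal (weight (inv_right y)) * H (inv_right y))
       * indicator Iv y \<partial>lborel)"
    by (rule nn_integral_transfer[OF H])
  also have "\<dots> = (\<integral>\<^sup>+y. emeasure (next_leaf \<phi> \<nu> y) {z\<in>Iv. (y, z) \<in> A} * ennreal (next_mass \<phi> y) * indicator Iv y \<partial>lborel)"
  proof (rule nn_integral_cong)
    fix y
    have "ennreal (weight (inv_left y)) * H (inv_left y) + ennreal (weight (inv_right y)) * H (inv_right y) =
      emeasure (next_leaf \<phi> \<nu> y) {z\<in>Iv. (y, z) \<in> A} * ennreal (next_mass \<phi> y)" if y: "y \<in> Iv"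
    proof -
      have "Pair y -` A \<in> sets borel"
        using A by (intro measurable_sets_borel[of _ borel]) (auto simp: sets_restrict_space_iff)
      then have S: "{z\<in>Iv. (y, z) \<in> A} \<in> sets borel_Iv"
        by (auto simp: sets_restrict_space_iff vimage_def Collect_conj_eq)
      \<comment> \<open>Both sides vanish where the weight does; elsewhere \<open>x\<close> is a
        true preimage of \<open>y\<close>.\<close>
      have *: "ennreal (weight x) * H x = ennreal (branch_mass \<phi> x) *
          emeasure (\<nu> (clamp_Iv x)) {z\<in>Iv. G (clamp_Iv x) z \<in> {z\<in>Iv. (y, z) \<in> A}}"
        if "weight x \<noteq> 0 \<longrightarrow> T x = y" for x
      proof (cases "weight x = 0")
        case False
        then have x: "x \<in> Iv" "T x = y" using that by (auto simp: weight_def split: if_splits)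
        have "{z\<in>Iv. (x, z) \<in> E} = {z\<in>Iv. G x z \<in> {z\<in>Iv. (y, z) \<in> A}}"
          using x G_maps by (auto simp: E_def Sigma_sq_def)
        then show ?thesis using x weight_bounds leaf_familyD(1)[OF fam x(1)]
          by (simp add: H_def branch_mass_def clamp_Iv_id ennreal_mult mult.commute mult.left_commute mult.assoc)
      qed (simp add: branch_mass_def)
      have w: "weight (inv_left y) \<noteq> 0 \<longrightarrow> T (inv_left y) = y" "weight (inv_right y) \<noteq> 0 \<longrightarrow> T (inv_right y) = y"
        using inv_left_cases[OF y] inv_right_cases[OF y] by (auto simp: weight_def Iv_def)
      show ?thesis unfolding next_leaf_emeasure[OF S] *[OF w(1)] *[OF w(2)] ..
    qed
    then show "(ennreal (weight (inv_left y)) * H (inv_left y) + ennreal (weight (inv_right y)) * H (inv_right y)) * indicator Iv y =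
      emeasure (next_leaf \<phi> \<nu> y) {z\<in>Iv. (y, z) \<in> A} * ennreal (next_mass \<phi> y) * indicator Iv y"
      by (simp add: indicator_def)
  qed
  finally show "emeasure (distr \<mu> (restrict_space borel Sigma_sq) F) A =
     (\<integral>\<^sup>+y. emeasure (next_leaf \<phi> \<nu> y) {z\<in>Iv. (y, z) \<in> A} * ennreal (next_mass \<phi> y) * indicator Iv y \<partial>lborel)" .
qed

lemma next_mass_measurable:
  assumes "\<phi> \<in> borel_measurable borel_Iv"
  shows "next_mass \<phi> \<in> borel_measurable borel_Iv"
proof -
  have [measurable]: "inv_left \<in> borel_measurable borel" "inv_right \<in> borel_measurable borel"
    by (intro borel_measurable_mono inv_left_mono inv_right_mono)+
  have "(\<lambda>x. \<phi> (clamp_Iv x)) \<in> borel_measurable borel"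
    by (rule measurable_compose[OF clamp_Iv_measurable assms])
  then have [measurable]: "branch_mass \<phi> \<in> borel_measurable borel"
    unfolding branch_mass_def by measurable
  show ?thesis unfolding next_mass_def by (intro measurable_restrict_space1) measurable
qed

end

end

section \<open>The variation of the image leaf measures\<close>

lemma sum_lessThan_split:
  fixes f :: "nat \<Rightarrow> real"
  shows "(\<Sum>j<m + n. f j) = (\<Sum>j<m. f j) + (\<Sum>j<n. f (m + j))"
  by (induction n) auto

lemma abs_diff_le_sum:
  fixes f :: "nat \<Rightarrow> real"
  shows "\<bar>f 0 - f n\<bar> \<le> (\<Sum>i<n. \<bar>f i - f (Suc i)\<bar>)"
  by (induction n) auto

lemma clamp_Iv_mono: "x \<le> y \<Longrightarrow> clamp_Iv x \<le> clamp_Iv y"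
  by (auto simp: clamp_Iv_def)

lemma clamp_minus_one [simp]: "clamp_Iv (-1) = -1/2"
  by (simp add: clamp_Iv_def)

section \<open>Bounds for a density from its variation and one small value\<close>

context
  fixes \<phi> :: "real \<Rightarrow> real" and C P :: real
  assumes var: "seq_var_le Iv UNIV (\<lambda>x (_::unit). \<phi> x) C" and P: "P \<in> Iv" "\<phi> P \<le> 1"
begin

lemma mass_le: "x \<in> Iv \<Longrightarrow> \<phi> x \<le> 1 + C"
  using seq_var_le_two[OF var _ P(1), of x "()"] P(2) by simp

lemma mass_var_nonneg: "0 \<le> C"
  using seq_var_le_nonneg[OF var P(1)] .

text \<open>If \<open>P\<close> lies outside the range of the sequence, the sequence extended by
  \<open>P\<close> has variation at most \<open>C\<close>, which controls both ends through the
  nearer one. If \<open>P\<close> lies inside, the points \<open>s 0\<close>, \<open>P\<close>,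
  \<open>s n\<close> bound the end values by \<open>2 + C\<close>, and the sequence itself adds at
  most \<open>C\<close>.\<close>

lemma mass_ends_bound:
  fixes s :: "nat \<Rightarrow> real"
  assumes s: "\<And>i. i \<le> n \<Longrightarrow> s i \<in> Iv" "\<And>i. i < n \<Longrightarrow> s i \<le> s (Suc i)"
  shows "\<phi> (s 0) + \<phi> (s n) + (\<Sum>i<n. \<bar>\<phi> (s i) - \<phi> (s (Suc i))\<bar>) \<le> 2 * (1 + C)"
proof -
  define S where "S = (\<Sum>i<n. \<bar>\<phi> (s i) - \<phi> (s (Suc i))\<bar>)"
  have tel: "\<bar>\<phi> (s 0) - \<phi> (s n)\<bar> \<le> S"
    unfolding S_def using abs_diff_le_sum[of "\<lambda>i. \<phi> (s i)" n] .
  consider "P \<le> s 0" | "s n \<le> P" | "s 0 \<le> P" "P \<le> s n" by linarith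
  then show ?thesis
  proof cases
    case 1
    let ?t = "case_nat P s"
    have "(\<Sum>i<Suc n. \<bar>\<phi> (?t i) - \<phi> (?t (Suc i))\<bar>) \<le> C"
    proof (rule seq_var_leD[OF var, of _ ?t "\<lambda>_. ()"])
      show "?t i \<in> Iv" if "i \<le> Suc n" for i using that s(1) P by (cases i) auto
      show "?t i \<le> ?t (Suc i)" if "i < Suc n" for i using that s(2) 1 by (cases i) auto
    qed simp
    then have "\<bar>\<phi> P - \<phi> (s 0)\<bar> + S \<le> C"
      unfolding sum.lessThan_Suc_shift S_def by simp
    then show ?thesis unfolding S_def[symmetric] using tel P(2) by (smt (verit))
  next
    case 2
    let ?t = "s(Suc n := P)"
    have "(\<Sum>i<Suc n. \<bar>\<phi> (?t i) - \<phi> (?t (Suc i))\<bar>) \<le> C"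
    proof (rule seq_var_leD[OF var, of _ ?t "\<lambda>_. ()"])
      show "?t i \<in> Iv" if "i \<le> Suc n" for i using that s(1) P by (auto simp: le_Suc_eq)
      show "?t i \<le> ?t (Suc i)" if "i < Suc n" for i using that s(2) 2 by (auto simp: less_Suc_eq)
    qed simp
    then have "S + \<bar>\<phi> (s n) - \<phi> P\<bar> \<le> C" by (simp add: S_def)
    then show ?thesis unfolding S_def[symmetric] using tel P(2) by (smt (verit))
  next
    case 3
    let ?t = "\<lambda>i::nat. if i = 0 then s 0 else if i = 1 then P else s n"
    have "(\<Sum>i<2. \<bar>\<phi> (?t i) - \<phi> (?t (Suc i))\<bar>) \<le> C"
      by (rule seq_var_leD[OF var, of _ ?t "\<lambda>_. ()"]) (use s(1) P 3 in auto)
    then have "\<bar>\<phi> (s 0) - \<phi> P\<bar> + \<bar>\<phi> P - \<phi> (s n)\<bar> \<le> C" by (simp add: numeral_2_eq_2)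
    moreover have "S \<le> C" unfolding S_def by (rule seq_var_leD[OF var, of _ s "\<lambda>_. ()"]) (use s in auto)
    ultimately show ?thesis unfolding S_def[symmetric] using P(2) by (smt (verit))
  qed
qed

end

context skew_map
begin

definition extended_Iv :: "real set" where
  "extended_Iv = insert (-1) Iv"

lemma weight_eq_0: "x \<notin> Iv - {c} \<Longrightarrow> weight x = 0"
  by (auto simp: weight_def)

text \<open>Only the step from \<open>-1\<close> into \<open>Iv\<close> is not controlled by
  \<open>V\<close>; it costs \<open>weight (-1/2)\<close>. As \<open>weight c = 0\<close>, the
  sequence \<open>-1/2\<close>, \<open>c\<close>, \<open>z n\<close> shows that this jump and the
  final value together cost at most another \<open>V\<close>.\<close>

lemma weight_variation_extended:
  fixes z :: "nat \<Rightarrow> real"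
  assumes z: "\<And>i. i \<le> n \<Longrightarrow> z i \<in> extended_Iv" "\<And>i. i < n \<Longrightarrow> z i \<le> z (Suc i)"
    and last: "c \<le> z n"
  shows "(\<Sum>i<n. \<bar>weight (z i) - weight (z (Suc i))\<bar>) + weight (z n) \<le> 2 * V"
proof -
  \<comment> \<open>The differences of \<open>\<kappa>\<close> telescope and count the step from
    \<open>-1\<close> into \<open>Iv\<close>, which occurs at most once.\<close>
  define \<kappa> :: "real \<Rightarrow> real" where "\<kappa> x = (if x \<in> Iv then 1 else 0)" for x
  let ?a = "weight (-1/2)"
  have w1: "weight (-1) = 0" by (simp add: weight_def Iv_def)
  have "\<bar>weight x - weight y\<bar> \<le> \<bar>weight (clamp_Iv x) - weight (clamp_Iv y)\<bar> + (\<kappa> y - \<kappa> x) * ?a"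
    if "x \<in> extended_Iv" "y \<in> extended_Iv" "x \<le> y" for x y
  proof (cases "x \<in> Iv")
    case True
    then have "y \<in> Iv" using that by (auto simp: extended_Iv_def Iv_def)
    then show ?thesis using True by (simp add: clamp_Iv_id \<kappa>_def)
  next
    case False
    then have x: "x = -1" using that by (auto simp: extended_Iv_def)
    show ?thesis
    proof (cases "y \<in> Iv")
      case True
      have "clamp_Iv x = -1/2" using x by simp
      moreover have "\<bar>0 - b\<bar> \<le> \<bar>a - b\<bar> + (1 - 0) * a" if "0 \<le> a" "0 \<le> b" for a b :: real
        using that by auto
      ultimately show ?thesis
        using True False x weight_bounds(1) by (simp only: w1 clamp_Iv_id \<kappa>_def if_True if_False)
    next
      case False
      then have "y = x" using x that by (auto simp: extended_Iv_def)
      then show ?thesis by simp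
    qed
  qed
  then have "(\<Sum>i<n. \<bar>weight (z i) - weight (z (Suc i))\<bar>) \<le>
      (\<Sum>i<n. \<bar>weight (clamp_Iv (z i)) - weight (clamp_Iv (z (Suc i)))\<bar> + (\<kappa> (z (Suc i)) - \<kappa> (z i)) * ?a)"
    using z by (intro sum_mono) simp
  also have "\<dots> = (\<Sum>i<n. \<bar>weight (clamp_Iv (z i)) - weight (clamp_Iv (z (Suc i)))\<bar>)
      + (\<kappa> (z n) - \<kappa> (z 0)) * ?a"
    unfolding sum.distrib sum_distrib_right[symmetric] sum_lessThan_telescope[of "\<lambda>i. \<kappa> (z i)"] ..
  also have "\<dots> \<le> V + 1 * ?a"
  proof (rule add_mono)
    show "(\<Sum>i<n. \<bar>weight (clamp_Iv (z i)) - weight (clamp_Iv (z (Suc i)))\<bar>) \<le> V"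
      by (rule seq_var_leD[OF weight_variation, of n "\<lambda>i. clamp_Iv (z i)" "\<lambda>_. ()"])
        (use z clamp_Iv_mono in auto)
    show "(\<kappa> (z n) - \<kappa> (z 0)) * ?a \<le> 1 * ?a"
      using weight_bounds(1) by (intro mult_right_mono) (auto simp: \<kappa>_def)
  qed
  finally have 1: "(\<Sum>i<n. \<bar>weight (z i) - weight (z (Suc i))\<bar>) \<le> V + ?a" by simp
  have zn: "z n \<in> Iv" using z(1)[of n] last c_in by (auto simp: extended_Iv_def)
  let ?t = "\<lambda>i::nat. if i = 0 then -1/2 else if i = 1 then c else z n"
  have "(\<Sum>i<2. \<bar>weight (?t i) - weight (?t (Suc i))\<bar>) \<le> V"
    by (rule seq_var_leD[OF weight_variation, of _ ?t "\<lambda>_. ()"]) (use zn c_in last in \<open>auto simp: Iv_def\<close>)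
  then have "?a + weight (z n) \<le> V" using weight_bounds(1) by (simp add: numeral_2_eq_2)
  with 1 show ?thesis by simp
qed

context
  fixes \<phi> :: "real \<Rightarrow> real" and \<nu> :: "real \<Rightarrow> real measure" and C P :: real
  assumes fam: "leaf_family \<phi> \<nu>" and var: "seq_var_le Iv UNIV (\<lambda>x (_::unit). \<phi> x) C"
    and P: "P \<in> Iv" "\<phi> P \<le> 1"
begin

lemma branch_integral_bound:
  assumes "g \<in> borel_measurable borel_Iv" "\<And>z. z \<in> Iv \<Longrightarrow> \<bar>g z\<bar> \<le> B"
  shows "\<bar>branch_integral \<phi> \<nu> x g\<bar> \<le> branch_mass \<phi> x * B"
proof -
  have "\<bar>\<integral>z. g (G (clamp_Iv x) z) \<partial>\<nu> (clamp_Iv x)\<bar> \<le> B"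
    by (intro leaf_integrable(2) leaf_familyD[OF fam] measurable_compose[OF G_measurable assms(1)])
      (auto intro!: assms G_maps)
  then show ?thesis
    unfolding branch_integral_def abs_mult using branch_mass_nonneg[OF fam, of x]
    by (simp add: mult_left_mono)
qed

text \<open>With \<open>u = g \<circ> G x\<close>, the constant \<open>d\<close> below splits \<open>u = d + lam * v\<close>, where the test
  function \<open>v\<close> is bounded by \<open>1/2\<close>: only the \<open>v\<close> part sees the distance of the leaf measures, and it is
  contracted by \<open>lam\<close>, while the constant part sees only the total masses.\<close>

lemma branch_integral_diff:
  assumes x: "x \<in> Iv - {c}" and x': "x' \<in> Iv - {c}" and side: "c \<notin> {min x x'..max x x'}"
    and g: "\<And>y z. y \<in> Iv \<Longrightarrow> z \<in> Iv \<Longrightarrow> \<bar>g y - g z\<bar> \<le> \<bar>y - z\<bar>"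
    and gb: "\<And>z. z \<in> Iv \<Longrightarrow> \<bar>g z\<bar> \<le> 1/2"
  shows "\<exists>v\<in>tests. \<bar>branch_integral \<phi> \<nu> x g - branch_integral \<phi> \<nu> x' g\<bar> \<le>
    (1 - lam) / 2 * \<bar>branch_mass \<phi> x - branch_mass \<phi> x'\<bar> + lam / 2 * (1 + C) * \<bar>weight x - weight x'\<bar>
    + lam * \<bar>leaf_integral \<phi> \<nu> x v - leaf_integral \<phi> \<nu> x' v\<bar> + k * (1 + C) * \<bar>x - x'\<bar>"
proof -
  have xI: "x \<in> Iv" "x' \<in> Iv" using x x' by auto
  have "g \<in> tests" by (intro testsI order_trans[OF gb] g) auto
  note gm = tests_measurable[OF this]
  define u where "u z = g (G x z)" for z
  define u' where "u' z = g (G x' z)" for z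
  \<comment> \<open>Since \<open>u\<close> stays within \<open>lam / 2\<close> of \<open>u 0\<close>
    and within \<open>1/2\<close> of \<open>0\<close>, truncating \<open>u 0\<close> at modulus
    \<open>(1 - lam) / 2\<close> leaves a remainder of modulus at most
    \<open>lam / 2\<close>.\<close>
  define d where "d = max (- ((1 - lam) / 2)) (min ((1 - lam) / 2) (u 0))"
  define v where "v z = (u z - d) / lam" for z
  have ub: "\<bar>u z\<bar> \<le> 1/2" "\<bar>u' z\<bar> \<le> 1/2" if "z \<in> Iv" for z
    using that xI gb G_maps by (auto simp: u_def u'_def)
  have ul: "\<bar>u y - u z\<bar> \<le> lam * \<bar>y - z\<bar>" if "y \<in> Iv" "z \<in> Iv" for y z
    unfolding u_def using that xI G_maps by (intro order_trans[OF g hyp2]) auto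
  have d: "\<bar>d\<bar> \<le> (1 - lam) / 2" 
  proof -
    have "\<bar>max (- b) (min b a)\<bar> \<le> b" if "0 \<le> b" for a b :: real
      using that by (auto simp: max_def min_def abs_le_iff)
    from this[of "(1 - lam) / 2"] show ?thesis using lam unfolding d_def by auto
  qed
  have ud: "\<bar>u z - d\<bar> \<le> lam / 2" if z: "z \<in> Iv" for z
  proof -
    have "lam * \<bar>z - 0\<bar> \<le> lam * (1/2)" using z lam_nonneg by (intro mult_left_mono) (auto simp: Iv_def)
    then have "\<bar>u z - u 0\<bar> \<le> lam / 2" using ul[OF z zero_in_Iv] by simp
    moreover have "\<bar>a - max (- b) (min b a')\<bar> \<le> 1/2 - b"
      if "\<bar>a - a'\<bar> \<le> 1/2 - b" "\<bar>a\<bar> \<le> 1/2" "\<bar>a'\<bar> \<le> 1/2" "0 \<le> b" for a a' b :: real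
      using that by (auto simp: max_def min_def abs_if split: if_splits)
    from this[of "u z" "u 0" "(1 - lam) / 2"]
    have "\<bar>u z - u 0\<bar> \<le> lam / 2 \<Longrightarrow> \<bar>u z - d\<bar> \<le> lam / 2"
      using ub(1)[OF z] ub(1)[OF zero_in_Iv] lam unfolding d_def by (simp add: field_simps)
    ultimately show ?thesis by blast
  qed
  \<comment> \<open>For \<open>lam = 0\<close> the function \<open>v\<close> is \<open>0\<close> by
    the convention on division, and \<open>ud\<close> says that \<open>u\<close> is the constant
    \<open>d\<close> on \<open>Iv\<close>.\<close>
  have uv: "u z = d + lam * v z" if "z \<in> Iv" for z
    using ud[OF that] by (cases "lam = 0") (auto simp: v_def)
  have vb: "\<bar>v z\<bar> \<le> 1/2" if "z \<in> Iv" for z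
    using ud[OF that] lam_nonneg unfolding v_def abs_divide by (cases "lam = 0") (auto simp: divide_le_eq)
  have vt: "v \<in> tests"
  proof (rule testsI)
    fix y z assume yz: "y \<in> Iv" "z \<in> Iv"
    have "v y - v z = (u y - u z) / lam" by (simp add: v_def diff_divide_distrib)
    then show "\<bar>v y - v z\<bar> \<le> \<bar>y - z\<bar>"
      using ul[OF yz] lam_nonneg by (cases "lam = 0") (auto simp: abs_divide divide_le_eq mult.commute)
  next
    fix z assume "z \<in> Iv" then show "\<bar>v z\<bar> \<le> 1" using vb[of z] by simp
  qed
  note f = leaf_familyD[OF fam xI(1)] and f' = leaf_familyD[OF fam xI(2)]
  have um: "u \<in> borel_measurable borel_Iv" "u' \<in> borel_measurable borel_Iv"
    unfolding u_def u'_def by (intro measurable_compose[OF G_measurable gm] xI)+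
  have Iu: "integral\<^sup>L N u = d + lam * integral\<^sup>L N v" if N: "prob_space N" "sets N = sets borel_Iv" for N
  proof -
    interpret prob_space N by (rule N)
    have sp: "space N = Iv" using sets_eq_imp_space_eq[OF N(2)] by (simp add: space_restrict_space)
    have "integral\<^sup>L N u = (\<integral>z. d + lam * v z \<partial>N)"
      by (intro Bochner_Integration.integral_cong) (auto simp: sp uv)
    also have "\<dots> = d + lam * integral\<^sup>L N v"
      using leaf_integrable(1)[OF N tests_measurable[OF vt] vb] by (simp add: prob_space)
    finally show ?thesis .
  qed
  define a where "a = integral\<^sup>L (\<nu> x) v"
  define a' where "a' = integral\<^sup>L (\<nu> x') v"
  define e where "e = integral\<^sup>L (\<nu> x') u - integral\<^sup>L (\<nu> x') u'"
  define w where "w = weight x" define w' where "w' = weight x'"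
  define p where "p = \<phi> x" define p' where "p' = \<phi> x'"
  have ab: "\<bar>a\<bar> \<le> 1/2" unfolding a_def by (intro leaf_integrable(2) f tests_measurable[OF vt] vb)
  have eb: "\<bar>e\<bar> \<le> k * \<bar>x - x'\<bar>"
  proof -
    have "e = (\<integral>z. u z - u' z \<partial>\<nu> x')"
      unfolding e_def
      using leaf_integrable(1)[OF f'(2,3) um(1) ub(1)] leaf_integrable(1)[OF f'(2,3) um(2) ub(2)] by simp
    also have "\<bar>\<dots>\<bar> \<le> k * \<bar>x - x'\<bar>"
    proof (intro leaf_integrable(2) f' borel_measurable_diff um)
      fix z assume z: "z \<in> Iv"
      show "\<bar>u z - u' z\<bar> \<le> k * \<bar>x - x'\<bar>"
        unfolding u_def u'_def using z xI G_maps side by (intro order_trans[OF g hyp1]) auto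
    qed
    finally show ?thesis .
  qed
  have pb: "0 \<le> p" "p \<le> 1 + C" "0 \<le> p'" "p' \<le> 1 + C" "0 \<le> w" "w \<le> 1" "0 \<le> w'" "w' \<le> 1"
    using f f' mass_le[OF var P] xI weight_bounds by (auto simp: p_def p'_def w_def w'_def)
  have B: "branch_integral \<phi> \<nu> x g = w * p * (d + lam * a)"
    "branch_integral \<phi> \<nu> x' g = w' * p' * (d + lam * a' - e)"
    using xI Iu[OF f(2,3)] Iu[OF f'(2,3)]
    unfolding branch_integral_def branch_mass_def e_def a_def a'_def w_def w'_def p_def p'_def
    by (auto simp: clamp_Iv_id u_def[symmetric] u'_def[symmetric])
  have m: "branch_mass \<phi> x = w * p" "branch_mass \<phi> x' = w' * p'"
    using xI by (auto simp: branch_mass_def clamp_Iv_id w_def w'_def p_def p'_def)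
  have J: "leaf_integral \<phi> \<nu> x v = p * a" "leaf_integral \<phi> \<nu> x' v = p' * a'"
    by (auto simp: leaf_integral_def p_def p'_def a_def a'_def)
  \<comment> \<open>The four terms are the changes of the branch mass, of the weight, of the leaf
    measure and of the fibre map.\<close>
  have "w * p * (d + lam * a) - w' * p' * (d + lam * a' - e) =
    d * (w * p - w' * p') + lam * (w - w') * (p * a) + lam * (w' * (p * a - p' * a')) + (w' * p') * e"
    by (simp add: algebra_simps)
  also have "\<bar>\<dots>\<bar> \<le> \<bar>d * (w * p - w' * p')\<bar> + \<bar>lam * (w - w') * (p * a)\<bar> + \<bar>lam * (w' * (p * a - p' * a'))\<bar> + \<bar>(w' * p') * e\<bar>"
    by linarith
  also have "\<dots> \<le> (1 - lam) / 2 * \<bar>w * p - w' * p'\<bar> + lam / 2 * (1 + C) * \<bar>w - w'\<bar>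
      + lam * \<bar>p * a - p' * a'\<bar> + k * (1 + C) * \<bar>x - x'\<bar>"
  proof (intro add_mono)
    show "\<bar>d * (w * p - w' * p')\<bar> \<le> (1 - lam) / 2 * \<bar>w * p - w' * p'\<bar>"
      unfolding abs_mult using d by (intro mult_right_mono) auto
    have "p * \<bar>a\<bar> \<le> (1 + C) * (1/2)" using pb ab by (intro mult_mono) auto
    then have "lam * \<bar>w - w'\<bar> * (p * \<bar>a\<bar>) \<le> lam * \<bar>w - w'\<bar> * ((1 + C) * (1/2))"
      using lam_nonneg by (intro mult_left_mono) auto
    then show "\<bar>lam * (w - w') * (p * a)\<bar> \<le> lam / 2 * (1 + C) * \<bar>w - w'\<bar>"
      using lam_nonneg pb by (simp add: abs_mult mult.commute mult.left_commute)
    show "\<bar>lam * (w' * (p * a - p' * a'))\<bar> \<le> lam * \<bar>p * a - p' * a'\<bar>"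
      unfolding abs_mult using lam_nonneg pb by (intro mult_mono mult_left_le_one_le) auto
    have "w' * p' \<le> 1 * (1 + C)" using pb by (intro mult_mono) auto
    then have "w' * p' * \<bar>e\<bar> \<le> (1 + C) * (k * \<bar>x - x'\<bar>)" using pb eb by (intro mult_mono) auto
    then show "\<bar>(w' * p') * e\<bar> \<le> k * (1 + C) * \<bar>x - x'\<bar>" using pb by (simp add: abs_mult mult.commute mult.left_commute)
  qed
  finally show ?thesis
    unfolding B[symmetric] using vt by (intro bexI[of _ v]) (auto simp: m J w_def w'_def)
qed

text \<open>If one of the points is \<open>c\<close> or outside \<open>Iv\<close>, its branch
  integral vanishes. The other integral is at most half its branch mass; splitting this half in the
  ratio \<open>1 - lam\<close> to \<open>lam\<close> matches the first two terms of the bound, so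
  the test function \<open>0\<close> suffices.\<close>

lemma branch_integral_diff_extended:
  assumes side: "x \<le> c \<and> x' \<le> c \<or> c \<le> x \<and> c \<le> x'"
    and g: "\<And>y z. y \<in> Iv \<Longrightarrow> z \<in> Iv \<Longrightarrow> \<bar>g y - g z\<bar> \<le> \<bar>y - z\<bar>"
    and gb: "\<And>z. z \<in> Iv \<Longrightarrow> \<bar>g z\<bar> \<le> 1/2"
  shows "\<exists>v\<in>tests. \<bar>branch_integral \<phi> \<nu> x g - branch_integral \<phi> \<nu> x' g\<bar> \<le>
    (1 - lam) / 2 * \<bar>branch_mass \<phi> x - branch_mass \<phi> x'\<bar> + lam / 2 * (1 + C) * \<bar>weight x - weight x'\<bar>
    + lam * \<bar>leaf_integral \<phi> \<nu> (clamp_Iv x) v - leaf_integral \<phi> \<nu> (clamp_Iv x') v\<bar>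
    + k * (1 + C) * \<bar>clamp_Iv x - clamp_Iv x'\<bar>"
proof (cases "x \<in> Iv - {c} \<and> x' \<in> Iv - {c}")
  case True
  then have "c \<notin> {min x x'..max x x'}" using side by (auto simp: min_def max_def)
  then show ?thesis using branch_integral_diff[of x x' g] True g gb by (simp add: clamp_Iv_id)
next
  case False
  have "g \<in> tests" by (intro testsI order_trans[OF gb] g) auto
  note gm = tests_measurable[OF this]
  have half: "\<bar>branch_integral \<phi> \<nu> y g\<bar> \<le>
      (1 - lam) / 2 * branch_mass \<phi> y + lam / 2 * (1 + C) * weight y" for y
  proof -
    have "lam / 2 * branch_mass \<phi> y \<le> lam / 2 * ((1 + C) * weight y)"
      unfolding branch_mass_def mult.commute[of "1 + C"] using lam_nonneg
      by (intro mult_left_mono mass_le[OF var P clamp_Iv_in] weight_bounds(1)) auto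
    moreover have "\<bar>branch_integral \<phi> \<nu> y g\<bar> \<le> (1 - lam) / 2 * branch_mass \<phi> y + lam / 2 * branch_mass \<phi> y"
      using branch_integral_bound[OF gm gb, of y] by (simp add: field_simps)
    ultimately show ?thesis by (simp add: mult.assoc)
  qed
  have zero: "branch_integral \<phi> \<nu> y g = 0" "branch_mass \<phi> y = 0" "weight y = 0" if "y \<notin> Iv - {c}" for y
    using weight_eq_0[OF that] by (auto simp: branch_integral_def branch_mass_def)
  have pos: "0 \<le> branch_mass \<phi> y" "0 \<le> weight y" for y
    using branch_mass_nonneg[OF fam] weight_bounds by auto
  have "\<bar>branch_integral \<phi> \<nu> x g - branch_integral \<phi> \<nu> x' g\<bar> \<le>
    (1 - lam) / 2 * \<bar>branch_mass \<phi> x - branch_mass \<phi> x'\<bar> + lam / 2 * (1 + C) * \<bar>weight x - weight x'\<bar>"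
  proof (cases "x \<in> Iv - {c}")
    case True
    with False have "x' \<notin> Iv - {c}" by blast
    then show ?thesis using half[of x] pos by (simp add: zero)
  next
    case False
    then show ?thesis using half[of x'] pos by (simp add: zero)
  qed
  moreover have "0 \<le> k * (1 + C) * \<bar>clamp_Iv x - clamp_Iv x'\<bar>"
    using k_nn mass_var_nonneg[OF var P] by simp
  ultimately show ?thesis
    by (intro bexI[OF _ zero_in_tests]) (simp add: leaf_integral_def)
qed

text \<open>In the application, \<open>D\<close> is the conull set on which the new mass agrees with
  a density of variation at most \<open>C\<close>. The value \<open>g i 0\<close> sees only the
  masses, which gives the term \<open>C\<close>; the remainder \<open>h i\<close> is estimated step
  by step on each branch, and the steps are summed along one sequence.\<close>

lemma next_leaf_variation:
  assumes K: "seq_var_le Iv tests (leaf_integral \<phi> \<nu>) K"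
    and D: "D \<subseteq> Iv" "seq_var_le D UNIV (\<lambda>x (_::unit). next_mass \<phi> x) C"
  shows "seq_var_le D tests (leaf_integral (next_mass \<phi>) (next_leaf \<phi> \<nu>))
    (lam * K + (C + (1 + C) * V + k * (1 + C)))"
  unfolding seq_var_le_def
proof (intro allI impI)
  fix N :: nat and s :: "nat \<Rightarrow> real" and g :: "nat \<Rightarrow> real \<Rightarrow> real"
  assume s: "\<forall>i\<le>N. s i \<in> D" and mono: "\<forall>i<N. s i \<le> s (Suc i)" and g: "\<forall>i<N. g i \<in> tests"
  let ?J = "leaf_integral (next_mass \<phi>) (next_leaf \<phi> \<nu>)"
  let ?B = "branch_integral \<phi> \<nu>"
  have sI: "s i \<in> Iv" if "i \<le> N" for i using s D(1) that by auto
  define h where "h i z = g i z - g i 0" for i z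
  have hl: "\<bar>h i y - h i z\<bar> \<le> \<bar>y - z\<bar>" if "i < N" "y \<in> Iv" "z \<in> Iv" for i y z
    using testsD(2)[of "g i" y z] g that by (simp add: h_def)
  have hb: "\<bar>h i z\<bar> \<le> 1/2" if "i < N" "z \<in> Iv" for i z
  proof -
    have "\<bar>h i z\<bar> \<le> \<bar>z\<bar>" using testsD(2)[of "g i" z 0] g that by (simp add: h_def)
    also have "\<dots> \<le> 1/2" using that by (auto simp: Iv_def)
    finally show ?thesis .
  qed
  have hm: "h i \<in> borel_measurable borel_Iv" if "i < N" for i
    using tests_measurable[of "g i"] g that unfolding h_def by auto
  have split: "?J y (g i) = g i 0 * next_mass \<phi> y + (?B (inv_left y) (h i) + ?B (inv_right y) (h i))"
    if i: "i < N" for i y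
  proof -
    have "?B x (g i) = g i 0 * branch_mass \<phi> x + ?B x (h i)" for x
    proof -
      let ?x = "clamp_Iv x"
      interpret prob_space "\<nu> ?x" by (rule leaf_familyD[OF fam clamp_Iv_in])
      have "integrable (\<nu> ?x) (\<lambda>z. h i (G ?x z))"
        by (rule leaf_integrable(1)[OF leaf_familyD(2,3)[OF fam clamp_Iv_in]])
          (auto intro!: measurable_compose[OF G_measurable hm] hb G_maps i)
      then have "(\<integral>z. g i 0 + h i (G ?x z) \<partial>\<nu> ?x) = g i 0 + (\<integral>z. h i (G ?x z) \<partial>\<nu> ?x)"
        by (simp add: prob_space)
      then show ?thesis unfolding branch_integral_def h_def by (simp add: algebra_simps)
    qed
    moreover have "?J y (g i) = ?B (inv_left y) (g i) + ?B (inv_right y) (g i)"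
      by (rule next_leaf_integral[OF fam]) (use tests_measurable testsD(1) g i in auto)
    ultimately show ?thesis by (simp add: next_mass_def algebra_simps)
  qed
  have L: "inv_left (s i) \<in> extended_Iv" "inv_left (s i) \<le> c" "-1 \<le> inv_left (s i)" if "i \<le> N" for i
    using inv_left_cases[OF sI[OF that]] c_in by (auto simp: extended_Iv_def Iv_def)
  have R: "inv_right (s i) \<in> Iv" "c \<le> inv_right (s i)" if "i \<le> N" for i
    using inv_right_cases[OF sI[OF that]] c_in by (auto simp: Iv_def)
  define E where "E x x' v = (1 - lam) / 2 * \<bar>branch_mass \<phi> x - branch_mass \<phi> x'\<bar> + lam / 2 * (1 + C) * \<bar>weight x - weight x'\<bar>
    + lam * \<bar>leaf_integral \<phi> \<nu> (clamp_Iv x) v - leaf_integral \<phi> \<nu> (clamp_Iv x') v\<bar>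
    + k * (1 + C) * \<bar>clamp_Iv x - clamp_Iv x'\<bar>" for x x' v
  have C0: "0 \<le> C" using mass_var_nonneg[OF var P] .
  have E0: "0 \<le> E x x' v" for x x' v
    unfolding E_def using lam lam_nonneg k_nn C0 by (intro add_nonneg_nonneg mult_nonneg_nonneg) auto
  have "\<forall>i\<in>{..<N}. \<exists>v\<in>tests. \<bar>?B (inv_left (s i)) (h i) - ?B (inv_left (s (Suc i))) (h i)\<bar> \<le> E (inv_left (s i)) (inv_left (s (Suc i))) v"
    unfolding E_def using L hl hb by (intro ballI branch_integral_diff_extended) auto
  then obtain vL where vL: "\<And>i. i < N \<Longrightarrow> vL i \<in> tests"
    "\<And>i. i < N \<Longrightarrow> \<bar>?B (inv_left (s i)) (h i) - ?B (inv_left (s (Suc i))) (h i)\<bar> \<le> E (inv_left (s i)) (inv_left (s (Suc i))) (vL i)"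
    unfolding bchoice_iff Bex_def by auto
  have "\<forall>i\<in>{..<N}. \<exists>v\<in>tests. \<bar>?B (inv_right (s i)) (h i) - ?B (inv_right (s (Suc i))) (h i)\<bar> \<le> E (inv_right (s i)) (inv_right (s (Suc i))) v"
    unfolding E_def using R hl hb by (intro ballI branch_integral_diff_extended) auto
  then obtain vR where vR: "\<And>i. i < N \<Longrightarrow> vR i \<in> tests"
    "\<And>i. i < N \<Longrightarrow> \<bar>?B (inv_right (s i)) (h i) - ?B (inv_right (s (Suc i))) (h i)\<bar> \<le> E (inv_right (s i)) (inv_right (s (Suc i))) (vR i)"
    unfolding bchoice_iff Bex_def by auto
  \<comment> \<open>all preimages as one increasing sequence, so that variations over both branches add up to
    variations over \<open>Iv\<close>\<close>
  define z where "z j = (if j = 0 then -1 else if j \<le> N + 1 then inv_left (s (j - 1)) else inv_right (s (j - (N + 2))))" for j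
  \<comment> \<open>Steps \<open>0\<close> and \<open>N + 1\<close> join \<open>-1\<close> to the
    left branch and the left branch to the right one. No integrals are compared there, so the test
    function is \<open>0\<close>.\<close>
  define v where "v j = (if j = 0 \<or> j = N + 1 then (\<lambda>_. 0) else if j \<le> N then vL (j - 1) else vR (j - (N + 2)))" for j
  define n where "n = (N + 2) + N"
  have zin: "z j \<in> extended_Iv" if "j \<le> n" for j
    using that L R by (auto simp: z_def n_def extended_Iv_def)
  have zmono: "z j \<le> z (Suc j)" if j: "j < n" for j
  proof -
    consider "j = 0" | "1 \<le> j" "j \<le> N" | "j = N + 1" | "N + 2 \<le> j" by linarith
    then show ?thesis
    proof cases
      case 2
      then obtain i where "j = Suc i" "i < N" by (cases j) auto
      then show ?thesis using mono inv_left_mono by (auto simp: z_def mono_def)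
    next
      case 4
      define i where "i = j - (N + 2)"
      have "j = N + 2 + i" "i < N" using 4 j by (auto simp: i_def n_def)
      then show ?thesis using mono inv_right_mono by (auto simp: z_def mono_def)
    next
      case 3
      then show ?thesis using L(2)[of N] R(2)[of 0] by (simp add: z_def)
    qed (use L in \<open>auto simp: z_def\<close>)
  qed
  have vt: "v j \<in> tests" if "j < n" for j
    using that vL(1) vR(1) zero_in_tests by (auto simp: v_def n_def)
  have "(\<Sum>i<N. \<bar>?B (inv_left (s i)) (h i) - ?B (inv_left (s (Suc i))) (h i)\<bar>) +
      (\<Sum>i<N. \<bar>?B (inv_right (s i)) (h i) - ?B (inv_right (s (Suc i))) (h i)\<bar>)
    \<le> (\<Sum>i<N. E (z (Suc i)) (z (Suc (Suc i))) (v (Suc i))) + (\<Sum>i<N. E (z (N + 2 + i)) (z (Suc (N + 2 + i))) (v (N + 2 + i)))"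
    by (intro add_mono sum_mono) (use vL(2) vR(2) in \<open>auto simp: z_def v_def\<close>)
  \<comment> \<open>The two joining steps only add nonnegative terms.\<close>
  also have "\<dots> \<le> (\<Sum>j<n. E (z j) (z (Suc j)) (v j))"
  proof -
    have "(\<Sum>j<n. E (z j) (z (Suc j)) (v j)) = (\<Sum>j<Suc (Suc N). E (z j) (z (Suc j)) (v j)) +
        (\<Sum>i<N. E (z (N + 2 + i)) (z (Suc (N + 2 + i))) (v (N + 2 + i)))"
      unfolding n_def sum_lessThan_split[of _ "N + 2"] by (simp only: add_2_eq_Suc')
    also have "(\<Sum>j<Suc (Suc N). E (z j) (z (Suc j)) (v j)) = E (z 0) (z (Suc 0)) (v 0) +
        (\<Sum>i<N. E (z (Suc i)) (z (Suc (Suc i))) (v (Suc i))) + E (z (Suc N)) (z (Suc (Suc N))) (v (Suc N))"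
      by (subst sum.lessThan_Suc, subst sum.lessThan_Suc_shift) simp
    finally show ?thesis using E0[of "z 0" "z (Suc 0)" "v 0"] E0[of "z (Suc N)" "z (Suc (Suc N))" "v (Suc N)"] by linarith
  qed
  also have "\<dots> = (1 - lam) / 2 * (\<Sum>j<n. \<bar>branch_mass \<phi> (z j) - branch_mass \<phi> (z (Suc j))\<bar>)
      + lam / 2 * (1 + C) * (\<Sum>j<n. \<bar>weight (z j) - weight (z (Suc j))\<bar>)
      + lam * (\<Sum>j<n. \<bar>leaf_integral \<phi> \<nu> (clamp_Iv (z j)) (v j) - leaf_integral \<phi> \<nu> (clamp_Iv (z (Suc j))) (v j)\<bar>)
      + k * (1 + C) * (\<Sum>j<n. \<bar>clamp_Iv (z j) - clamp_Iv (z (Suc j))\<bar>)"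
    by (simp only: E_def sum.distrib sum_distrib_left)
  \<comment> \<open>The bound \<open>2 * V\<close> is halved by the factors
    \<open>(1 - lam) / 2\<close> and \<open>lam / 2\<close>, and the two contributions add up to
    \<open>(1 + C) * V\<close>. The last factor \<open>1\<close> is the length of
    \<open>Iv\<close>.\<close>
  also have "\<dots> \<le> (1 - lam) / 2 * ((1 + C) * (2 * V)) + lam / 2 * (1 + C) * (2 * V) + lam * K + k * (1 + C) * 1"
  proof (intro add_mono mult_left_mono)
    have zn: "c \<le> z n" using R(2)[of N] by (cases N) (auto simp: z_def n_def)
    from weight_variation_extended[OF zin zmono zn]
    have wv: "(\<Sum>j<n. \<bar>weight (z j) - weight (z (Suc j))\<bar>) + weight (z n) \<le> 2 * V" .
    then show "(\<Sum>j<n. \<bar>weight (z j) - weight (z (Suc j))\<bar>) \<le> 2 * V" using weight_bounds(1)[of "z n"] by linarith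
    \<comment> \<open>On the right, \<open>weight (z 0)\<close> vanishes and
      \<open>weight (z n)\<close> is absorbed by \<open>wv\<close>, which is why \<open>wv\<close>
      includes that end value.\<close>
    have "weight (z 0) * \<phi> (clamp_Iv (z 0)) +
        (\<Sum>i=0..<n. \<bar>weight (z i) * \<phi> (clamp_Iv (z i)) - weight (z (Suc i)) * \<phi> (clamp_Iv (z (Suc i)))\<bar>) +
        weight (z n) * \<phi> (clamp_Iv (z n))
      \<le> (1 + C) * (weight (z 0) + (\<Sum>i=0..<n. \<bar>weight (z i) - weight (z (Suc i))\<bar>) + weight (z n))"
    proof (rule weighted_variation_bound)
      fix p q :: nat assume pq: "p \<le> q" "q \<le> n"
      have "\<phi> (clamp_Iv (z (p + 0))) + \<phi> (clamp_Iv (z (p + (q - p)))) +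
        (\<Sum>i<q - p. \<bar>\<phi> (clamp_Iv (z (p + i))) - \<phi> (clamp_Iv (z (p + Suc i)))\<bar>) \<le> 2 * (1 + C)"
        by (rule mass_ends_bound[OF var P, of "q - p" "\<lambda>i. clamp_Iv (z (p + i))"])
          (use pq zmono clamp_Iv_mono in auto)
      moreover have "(\<Sum>i=p..<q. f i) = (\<Sum>i<q - p. f (p + i))" for f :: "nat \<Rightarrow> real"
        using sum.shift_bounds_nat_ivl[of f 0 p "q - p"] pq by (simp add: add.commute atLeast0LessThan)
      ultimately show "\<phi> (clamp_Iv (z p)) + \<phi> (clamp_Iv (z q)) +
        (\<Sum>i=p..<q. \<bar>\<phi> (clamp_Iv (z i)) - \<phi> (clamp_Iv (z (Suc i)))\<bar>) \<le> 2 * (1 + C)"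
        using pq by simp
    qed (use weight_bounds leaf_familyD(1)[OF fam clamp_Iv_in] in auto)
    moreover have "weight (z 0) = 0" by (simp add: z_def weight_def Iv_def)
    moreover have "0 \<le> weight (z n) * \<phi> (clamp_Iv (z n))"
      using weight_bounds leaf_familyD(1)[OF fam clamp_Iv_in] by simp
    ultimately have "(\<Sum>j<n. \<bar>branch_mass \<phi> (z j) - branch_mass \<phi> (z (Suc j))\<bar>)
       \<le> (1 + C) * ((\<Sum>j<n. \<bar>weight (z j) - weight (z (Suc j))\<bar>) + weight (z n))"
      by (simp add: branch_mass_def atLeast0LessThan)
    also have "\<dots> \<le> (1 + C) * (2 * V)" using wv C0 by (intro mult_left_mono) auto
    finally show "(\<Sum>j<n. \<bar>branch_mass \<phi> (z j) - branch_mass \<phi> (z (Suc j))\<bar>) \<le> (1 + C) * (2 * V)" .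
    show "(\<Sum>j<n. \<bar>leaf_integral \<phi> \<nu> (clamp_Iv (z j)) (v j) - leaf_integral \<phi> \<nu> (clamp_Iv (z (Suc j))) (v j)\<bar>) \<le> K"
      by (rule seq_var_leD[OF K, of n "\<lambda>j. clamp_Iv (z j)" v]) (use zmono clamp_Iv_mono vt in auto)
    have "(\<Sum>j<n. \<bar>clamp_Iv (z j) - clamp_Iv (z (Suc j))\<bar>) = clamp_Iv (z n) - clamp_Iv (z 0)"
      by (rule sum_abs_diff_mono) (use zmono clamp_Iv_mono in auto)
    also have "\<dots> \<le> 1" using clamp_Iv_in[of "z n"] clamp_Iv_in[of "z 0"] unfolding Iv_def by auto
    finally show "(\<Sum>j<n. \<bar>clamp_Iv (z j) - clamp_Iv (z (Suc j))\<bar>) \<le> 1" .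
  qed (use lam lam_nonneg k_nn C0 in auto)
  also have "\<dots> = lam * K + ((1 + C) * V + k * (1 + C))" by (simp add: field_simps)
  finally have br: "(\<Sum>i<N. \<bar>?B (inv_left (s i)) (h i) - ?B (inv_left (s (Suc i))) (h i)\<bar>) +
      (\<Sum>i<N. \<bar>?B (inv_right (s i)) (h i) - ?B (inv_right (s (Suc i))) (h i)\<bar>)
      \<le> lam * K + ((1 + C) * V + k * (1 + C))" .
  have nm: "(\<Sum>i<N. \<bar>next_mass \<phi> (s i) - next_mass \<phi> (s (Suc i))\<bar>) \<le> C"
    by (rule seq_var_leD[OF D(2), of N s "\<lambda>_. ()"]) (use s mono in auto)
  have "(\<Sum>i<N. \<bar>?J (s i) (g i) - ?J (s (Suc i)) (g i)\<bar>) \<le>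
    (\<Sum>i<N. \<bar>next_mass \<phi> (s i) - next_mass \<phi> (s (Suc i))\<bar> +
      (\<bar>?B (inv_left (s i)) (h i) - ?B (inv_left (s (Suc i))) (h i)\<bar> +
       \<bar>?B (inv_right (s i)) (h i) - ?B (inv_right (s (Suc i))) (h i)\<bar>))"
  proof (rule sum_mono)
    fix i assume "i \<in> {..<N}"
    then have i: "i < N" by simp
    have "\<bar>g i 0\<bar> \<le> 1" using testsD(1)[of "g i" 0] g i by simp
    then have "\<bar>g i 0 * (next_mass \<phi> (s i) - next_mass \<phi> (s (Suc i)))\<bar> \<le> \<bar>next_mass \<phi> (s i) - next_mass \<phi> (s (Suc i))\<bar>"
      unfolding abs_mult by (intro mult_left_le_one_le) auto
    moreover have "?J (s i) (g i) - ?J (s (Suc i)) (g i) = g i 0 * (next_mass \<phi> (s i) - next_mass \<phi> (s (Suc i)))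
      + ((?B (inv_left (s i)) (h i) - ?B (inv_left (s (Suc i))) (h i)) +
         (?B (inv_right (s i)) (h i) - ?B (inv_right (s (Suc i))) (h i)))"
      unfolding split[OF i] by (simp add: algebra_simps)
    ultimately show "\<bar>?J (s i) (g i) - ?J (s (Suc i)) (g i)\<bar> \<le> \<bar>next_mass \<phi> (s i) - next_mass \<phi> (s (Suc i))\<bar> +
      (\<bar>?B (inv_left (s i)) (h i) - ?B (inv_left (s (Suc i))) (h i)\<bar> +
       \<bar>?B (inv_right (s i)) (h i) - ?B (inv_right (s (Suc i))) (h i)\<bar>)"
      by linarith
  qed
  also have "\<dots> \<le> C + (lam * K + ((1 + C) * V + k * (1 + C)))"
    using nm br unfolding sum.distrib by linarith
  finally show "(\<Sum>i<N. \<bar>?J (s i) (g i) - ?J (s (Suc i)) (g i)\<bar>) \<le> lam * K + (C + (1 + C) * V + k * (1 + C))"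
    by simp
qed

end

end

section \<open>Marginal densities and the main theorem\<close>

lemma seq_var_le_mono: "seq_var_le D \<Gamma> J K \<Longrightarrow> K \<le> K' \<Longrightarrow> seq_var_le D \<Gamma> J K'"
  unfolding seq_var_le_def by (meson order_trans)

lemma funpow_measurable: "f \<in> measurable M M \<Longrightarrow> f ^^ n \<in> measurable M M"
  by (induction n) (auto intro: measurable_comp)

lemma sets_restrict_lborel: "sets (restrict_space lborel Iv) = sets borel_Iv"
  by (simp add: sets_restrict_space)

lemma fst_measurable_square: "fst \<in> measurable (restrict_space borel Sigma_sq) borel_Iv"
  by (intro measurable_restrict_space2 measurable_restrict_space1)
    (auto simp: space_restrict_space Sigma_sq_def borel_prod[symmetric])

lemma disintegrates_marginal:
  assumes fam: "leaf_family \<phi> \<nu>" and \<phi>: "\<phi> \<in> borel_measurable borel_Iv" and dis: "disintegrates \<mu> \<phi> \<nu>"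
    and sets: "sets \<mu> = sets (restrict_space borel Sigma_sq)"
  shows "distr \<mu> borel_Iv fst = density (restrict_space lborel Iv) (\<lambda>x. ennreal (\<phi> x))"
proof (rule measure_eqI)
  show "sets (distr \<mu> borel_Iv fst) = sets (density (restrict_space lborel Iv) (\<lambda>x. ennreal (\<phi> x)))"
    by (simp add: sets_restrict_lborel)
  fix S assume "S \<in> sets (distr \<mu> borel_Iv fst)"
  then have S: "S \<in> sets borel_Iv" by simp
  then have Sb: "S \<subseteq> Iv" by (simp add: sets_restrict_space_iff)
  have sp: "space \<mu> = Sigma_sq" using sets_eq_imp_space_eq[OF sets] by (simp add: space_restrict_space)
  have fst: "fst \<in> measurable \<mu> borel_Iv"
    using fst_measurable_square measurable_cong_sets[OF sets refl] by blast
  have m: "(\<lambda>x. ennreal (\<phi> x)) \<in> borel_measurable (restrict_space lborel Iv)"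
    using \<phi> measurable_cong_sets[OF sets_restrict_lborel refl] by measurable
  have "emeasure (distr \<mu> borel_Iv fst) S = emeasure \<mu> (fst -` S \<inter> Sigma_sq)"
    by (simp add: emeasure_distr[OF fst S] sp)
  also have "\<dots> = (\<integral>\<^sup>+ \<gamma>. emeasure (\<nu> \<gamma>) {y\<in>Iv. (\<gamma>, y) \<in> fst -` S \<inter> Sigma_sq} * ennreal (\<phi> \<gamma>) * indicator Iv \<gamma> \<partial>lborel)"
    using dis measurable_sets[OF fst S] by (simp add: disintegrates_def sp)
  also have "\<dots> = (\<integral>\<^sup>+ \<gamma>. ennreal (\<phi> \<gamma>) * indicator S \<gamma> * indicator Iv \<gamma> \<partial>lborel)"
  proof (rule nn_integral_cong)
    fix \<gamma>
    have "emeasure (\<nu> \<gamma>) {y\<in>Iv. (\<gamma>, y) \<in> fst -` S \<inter> Sigma_sq} = indicator S \<gamma>" if "\<gamma> \<in> Iv"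
    proof (cases "\<gamma> \<in> S")
      case True
      then have "{y\<in>Iv. (\<gamma>, y) \<in> fst -` S \<inter> Sigma_sq} = Iv" using that by (auto simp: Sigma_sq_def)
      then show ?thesis
        using True prob_space.emeasure_space_1[OF leaf_familyD(2)[OF fam that]] leaf_familyD(4)[OF fam that] by simp
    qed simp
    then show "emeasure (\<nu> \<gamma>) {y\<in>Iv. (\<gamma>, y) \<in> fst -` S \<inter> Sigma_sq} * ennreal (\<phi> \<gamma>) * indicator Iv \<gamma> =
      ennreal (\<phi> \<gamma>) * indicator S \<gamma> * indicator Iv \<gamma>"
      by (cases "\<gamma> \<in> Iv") (auto simp: mult.commute)
  qed
  also have "\<dots> = emeasure (density (restrict_space lborel Iv) (\<lambda>x. ennreal (\<phi> x))) S"
    using S m by (simp add: emeasure_density sets_restrict_lborel nn_integral_restrict_space)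
  finally show "emeasure (distr \<mu> borel_Iv fst) S = emeasure (density (restrict_space lborel Iv) (\<lambda>x. ennreal (\<phi> x))) S" .
qed

text \<open>Both \<open>\<phi>\<close> and \<open>h\<close> are densities of the same marginal, so
  they agree almost everywhere up to the truncation of negative values by \<open>ennreal\<close>.
  Truncation does not increase the variation.\<close>

lemma leaf_mass_eq_density:
  assumes fam: "leaf_family \<phi> \<nu>" and \<phi>: "\<phi> \<in> borel_measurable borel_Iv" and dis: "disintegrates \<mu> \<phi> \<nu>"
    and sets: "sets \<mu> = sets (restrict_space borel Sigma_sq)"
    and h: "distr \<mu> borel_Iv fst = density (restrict_space lborel Iv) (\<lambda>x. ennreal (h x))"
    and C: "0 \<le> C" "var_on Iv h \<le> ereal C"
  defines "D \<equiv> {x\<in>Iv. \<phi> x = max 0 (h x)}"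
  shows "AE x in lborel. x \<in> Iv \<longrightarrow> x \<in> D" "seq_var_le D UNIV (\<lambda>x (_::unit). \<phi> x) C"
proof -
  have hv: "seq_var_le Iv UNIV (\<lambda>x (_::unit). h x) C" using C var_on_le_iff by blast
  have hm: "h \<in> borel_measurable borel_Iv" by (rule bounded_variation_measurable[OF hv])
  have m: "(\<lambda>x. ennreal (f x)) \<in> borel_measurable (restrict_space lborel Iv)"
    if "f \<in> borel_measurable borel_Iv" for f
    using that measurable_cong_sets[OF sets_restrict_lborel refl] by measurable
  interpret I: finite_measure "restrict_space lborel Iv"
    by (rule finite_measureI) (simp add: emeasure_restrict_space space_restrict_space Iv_def)
  have "AE x in restrict_space lborel Iv. ennreal (\<phi> x) = ennreal (h x)"
    by (rule I.density_unique[OF m[OF \<phi>] m[OF hm]])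
      (simp add: h[symmetric] disintegrates_marginal[OF fam \<phi> dis sets])
  then have "AE x in lborel. x \<in> Iv \<longrightarrow> ennreal (\<phi> x) = ennreal (h x)"
    by (simp add: AE_restrict_space_iff)
  then show "AE x in lborel. x \<in> Iv \<longrightarrow> x \<in> D"
  proof eventually_elim
    case (elim x)
    show ?case
    proof
      assume x: "x \<in> Iv"
      have "max 0 (\<phi> x) = max 0 (h x)"
        using elim x by (metis enn2real_ennreal ennreal_max_0 max.cobounded1 ennreal_eq_0_iff max.commute)
      then show "x \<in> D" using leaf_familyD(1)[OF fam x] x by (simp add: D_def)
    qed
  qed
  show "seq_var_le D UNIV (\<lambda>x (_::unit). \<phi> x) C"
    unfolding seq_var_le_def
  proof (intro allI impI)
    fix N :: nat and s :: "nat \<Rightarrow> real" and g :: "nat \<Rightarrow> unit"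
    assume s: "\<forall>i\<le>N. s i \<in> D" "\<forall>i<N. s i \<le> s (Suc i)"
    have "(\<Sum>i<N. \<bar>\<phi> (s i) - \<phi> (s (Suc i))\<bar>) \<le> (\<Sum>i<N. \<bar>h (s i) - h (s (Suc i))\<bar>)"
    proof (rule sum_mono)
      fix i assume "i \<in> {..<N}"
      then have "\<phi> (s i) = max 0 (h (s i))" "\<phi> (s (Suc i)) = max 0 (h (s (Suc i)))" using s by (auto simp: D_def)
      then show "\<bar>\<phi> (s i) - \<phi> (s (Suc i))\<bar> \<le> \<bar>h (s i) - h (s (Suc i))\<bar>" by simp
    qed
    also have "\<dots> \<le> C"
      by (rule seq_var_leD[OF hv, of N s "\<lambda>_. ()"]) (use s in \<open>auto simp: D_def\<close>)
    finally show "(\<Sum>i<N. \<bar>\<phi> (s i) - \<phi> (s (Suc i))\<bar>) \<le> C" .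
  qed
qed

text \<open>The invariant of the induction over the iterates. Besides the variation of the leaf
  measures it records that of the marginal density, on which the next step relies.\<close>

definition regular_leaves :: "real \<Rightarrow> real \<Rightarrow> (real \<times> real) measure \<Rightarrow> (real \<Rightarrow> real) \<Rightarrow> (real \<Rightarrow> real measure) \<Rightarrow> bool" where
  "regular_leaves K C \<mu> \<phi> \<nu> \<longleftrightarrow> leaf_family \<phi> \<nu> \<and> disintegrates \<mu> \<phi> \<nu> \<and>
     seq_var_le Iv tests (leaf_integral \<phi> \<nu>) K \<and> seq_var_le Iv UNIV (\<lambda>x (_::unit). \<phi> x) C"

text \<open>Regularization changes the leaf data on \<open>Iv\<close> only on a null set, so they
  still represent \<open>\<mu>\<close>, and both variation bounds pass to limits of points of
  \<open>D\<close>.\<close>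

lemma regular_leaves_exist:
  assumes fam: "leaf_family \<phi> \<nu>" and dis: "disintegrates \<mu> \<phi> \<nu>"
    and D: "AE x in lborel. x \<in> Iv \<longrightarrow> x \<in> D" "D \<subseteq> Iv"
    and K: "seq_var_le D tests (leaf_integral \<phi> \<nu>) K" and C: "seq_var_le D UNIV (\<lambda>x (_::unit). \<phi> x) C"
  shows "\<exists>\<phi>' \<nu>'. regular_leaves K C \<mu> \<phi>' \<nu>'"
proof -
  obtain x0 where x0: "x0 \<in> D" using conull_dense_in_Iv[OF D zero_in_Iv] by auto
  have bd: "\<phi> x \<le> \<phi> x0 + C" if "x \<in> D" for x
    using seq_var_le_two[OF C that x0, of "()"] by simp
  obtain \<phi>' \<nu>' where fam': "leaf_family \<phi>' \<nu>'" and eq: "\<And>x. x \<in> D \<Longrightarrow> \<phi>' x = \<phi> x \<and> \<nu>' x = \<nu> x"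
    and lim: "\<And>x. x \<in> Iv \<Longrightarrow> \<exists>d. (\<forall>n. d n \<in> D) \<and> d \<longlonglongrightarrow> x \<and> (\<lambda>n. \<phi> (d n)) \<longlonglongrightarrow> \<phi>' x \<and>
       (\<forall>g\<in>tests. (\<lambda>n. integral\<^sup>L (\<nu> (d n)) g) \<longlonglongrightarrow> integral\<^sup>L (\<nu>' x) g)"
    by (rule leaf_regularization[OF fam D bd]) (assumption, rule that)
  have "disintegrates \<mu> \<phi>' \<nu>'"
    unfolding disintegrates_def
  proof
    fix A assume "A \<in> sets \<mu>"
    then have "emeasure \<mu> A =
     (\<integral>\<^sup>+ \<gamma>. emeasure (\<nu> \<gamma>) {y\<in>Iv. (\<gamma>, y) \<in> A} * ennreal (\<phi> \<gamma>) * indicator Iv \<gamma> \<partial>lborel)"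
      using dis by (simp add: disintegrates_def)
    also have "\<dots> = (\<integral>\<^sup>+ \<gamma>. emeasure (\<nu>' \<gamma>) {y\<in>Iv. (\<gamma>, y) \<in> A} * ennreal (\<phi>' \<gamma>) * indicator Iv \<gamma> \<partial>lborel)"
      by (rule nn_integral_cong_AE, use D(1) in eventually_elim) (auto simp: eq indicator_def)
    finally show "emeasure \<mu> A =
     (\<integral>\<^sup>+ \<gamma>. emeasure (\<nu>' \<gamma>) {y\<in>Iv. (\<gamma>, y) \<in> A} * ennreal (\<phi>' \<gamma>) * indicator Iv \<gamma> \<partial>lborel)" .
  qed
  moreover have "seq_var_le Iv tests (leaf_integral \<phi>' \<nu>') K"
  proof (rule seq_var_le_limit[OF K])
    fix x assume "x \<in> Iv"
    from lim[OF this] show "\<exists>d. (\<forall>n. d n \<in> D) \<and> d \<longlonglongrightarrow> x \<and>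
      (\<forall>g\<in>tests. (\<lambda>n. leaf_integral \<phi> \<nu> (d n) g) \<longlonglongrightarrow> leaf_integral \<phi>' \<nu>' x g)"
      unfolding leaf_integral_def by (elim ex_forward) (auto intro!: tendsto_mult)
  qed
  moreover have "seq_var_le Iv UNIV (\<lambda>x (_::unit). \<phi>' x) C"
  proof (rule seq_var_le_limit[OF C])
    fix x assume "x \<in> Iv"
    from lim[OF this] show "\<exists>d. (\<forall>n. d n \<in> D) \<and> d \<longlonglongrightarrow> x \<and>
      (\<forall>g::unit\<in>UNIV. (\<lambda>n. \<phi> (d n)) \<longlonglongrightarrow> \<phi>' x)"
      by (elim ex_forward) auto
  qed
  ultimately show ?thesis using fam' unfolding regular_leaves_def by blast
qed

text \<open>A density that integrates to \<open>1\<close> over an interval of length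
  \<open>1\<close> cannot exceed \<open>1\<close> everywhere.\<close>

lemma leaf_mass_le_one:
  assumes fam: "leaf_family \<phi> \<nu>" and \<phi>: "\<phi> \<in> borel_measurable borel_Iv" and dis: "disintegrates \<mu> \<phi> \<nu>"
    and sets: "sets \<mu> = sets (restrict_space borel Sigma_sq)" and "prob_space \<mu>"
  shows "\<exists>P\<in>Iv. \<phi> P \<le> 1"
proof (rule ccontr)
  assume neg: "\<not> (\<exists>P\<in>Iv. \<phi> P \<le> 1)"
  let ?I = "restrict_space lborel Iv"
  have sp: "space \<mu> = Sigma_sq" using sets_eq_imp_space_eq[OF sets] by (simp add: space_restrict_space)
  have m: "(\<lambda>x. ennreal (\<phi> x)) \<in> borel_measurable ?I"
    using \<phi> measurable_cong_sets[OF sets_restrict_lborel refl] by measurable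
  have e1: "emeasure ?I Iv = 1"
    by (simp add: emeasure_restrict_space) (simp add: Iv_def)
  have fst: "fst \<in> measurable \<mu> borel_Iv"
    using fst_measurable_square measurable_cong_sets[OF sets refl] by blast
  have spI: "space ?I = Iv" by (simp add: space_restrict_space)
  have "(\<integral>\<^sup>+x. ennreal (\<phi> x) \<partial>?I) = emeasure (density ?I (\<lambda>x. ennreal (\<phi> x))) Iv"
    using m sets.top[of ?I] unfolding spI
    by (subst emeasure_density) (auto simp: spI intro!: nn_integral_cong)
  also have "\<dots> = emeasure (distr \<mu> borel_Iv fst) (space (distr \<mu> borel_Iv fst))"
    unfolding disintegrates_marginal[OF fam \<phi> dis sets, symmetric] by (simp add: space_restrict_space)
  also have "\<dots> = 1"
    using prob_space.prob_space_distr[OF \<open>prob_space \<mu>\<close> fst] by (rule prob_space.emeasure_space_1)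
  finally have total: "(\<integral>\<^sup>+x. ennreal (\<phi> x) \<partial>?I) = 1" .
  have "(\<integral>\<^sup>+x. 1 \<partial>?I) < (\<integral>\<^sup>+x. ennreal (\<phi> x) \<partial>?I)"
  proof (rule nn_integral_less[OF _ m])
    show "(\<integral>\<^sup>+x. 1 \<partial>?I) \<noteq> \<infinity>" using e1 spI by simp
    have gt: "1 < ennreal (\<phi> x)" if "x \<in> Iv" for x
      using neg that by (simp add: not_le)
    then show "AE x in ?I. 1 \<le> ennreal (\<phi> x)"
      by (intro AE_I2) (auto simp: spI intro: less_imp_le)
    show "\<not> (AE x in ?I. ennreal (\<phi> x) \<le> 1)"
    proof
      assume "AE x in ?I. ennreal (\<phi> x) \<le> 1"
      then have "AE x in ?I. False" using AE_space by eventually_elim (use gt spI leD in \<open>fastforce\<close>)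
      then have "emeasure ?I (space ?I) = 0" by (subst (asm) AE_iff_measurable[OF sets.top]) auto
      then show False using e1 spI by simp
    qed
  qed simp
  then show False using total e1 spI by simp
qed

section \<open>Iteration of the dynamics\<close>

context skew_map
begin

lemma T_measurable: "T \<in> measurable borel_Iv borel_Iv"
proof -
  have "(\<lambda>x. (x, 0::real)) \<in> measurable borel_Iv (restrict_space borel Sigma_sq)"
    by (intro measurable_restrict_space2 measurable_restrict_space1)
      (auto simp: space_restrict_space Sigma_sq_def borel_prod[symmetric])
  from measurable_compose[OF measurable_compose[OF this F_measurable] fst_measurable_square]
  show ?thesis by simp
qed

lemma fst_F_funpow: "fst ((F ^^ n) p) = (T ^^ n) (fst p)"
  by (induction n) (auto simp: case_prod_beta)

text \<open>For the explicit image disintegration the bounds are available only along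
  \<open>D\<close>, where its mass agrees with a density of variation at most \<open>C\<close>;
  regularization restores them on all of \<open>Iv\<close>.\<close>

lemma regular_leaves_step:
  assumes reg: "regular_leaves K C \<mu> \<phi> \<nu>" and \<mu>: "prob_space \<mu>" "sets \<mu> = sets (restrict_space borel Sigma_sq)"
    and h: "distr (distr \<mu> (restrict_space borel Sigma_sq) F) borel_Iv fst = density (restrict_space lborel Iv) (\<lambda>x. ennreal (h x))"
      "var_on Iv h \<le> ereal C"
  shows "\<exists>\<phi>' \<nu>'. regular_leaves (lam * K + (C + (1 + C) * V + k * (1 + C))) C
    (distr \<mu> (restrict_space borel Sigma_sq) F) \<phi>' \<nu>'"
proof -
  have fam: "leaf_family \<phi> \<nu>" and dis: "disintegrates \<mu> \<phi> \<nu>" and K: "seq_var_le Iv tests (leaf_integral \<phi> \<nu>) K"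
    and C: "seq_var_le Iv UNIV (\<lambda>x (_::unit). \<phi> x) C"
    using reg by (auto simp: regular_leaves_def)
  have \<phi>: "\<phi> \<in> borel_measurable borel_Iv" by (rule bounded_variation_measurable[OF C])
  obtain P where P: "P \<in> Iv" "\<phi> P \<le> 1" using leaf_mass_le_one[OF fam \<phi> dis \<mu>(2,1)] by blast
  define D where "D = {x\<in>Iv. next_mass \<phi> x = max 0 (h x)}"
  have dis': "disintegrates (distr \<mu> (restrict_space borel Sigma_sq) F) (next_mass \<phi>) (next_leaf \<phi> \<nu>)"
    by (rule next_disintegrates[OF fam K dis \<mu>(2)])
  note AE = leaf_mass_eq_density[OF next_leaf_family[OF fam] next_mass_measurable[OF fam \<phi>] dis' _ h(1)
      seq_var_le_nonneg[OF C zero_in_Iv] h(2), folded D_def]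
  have "D \<subseteq> Iv" by (auto simp: D_def)
  show ?thesis
    by (rule regular_leaves_exist[OF next_leaf_family[OF fam] dis' AE(1) \<open>D \<subseteq> Iv\<close>
      next_leaf_variation[OF fam C P K \<open>D \<subseteq> Iv\<close> AE(2)] AE(2)]) simp_all
qed

end

theorem theorem8p10:
  fixes T :: "real \<Rightarrow> real" and T' :: "real \<Rightarrow> real"
    and G :: "real \<Rightarrow> real \<Rightarrow> real"
    and c k lam K C :: real
    and \<mu>0 :: "(real \<times> real) measure" and f0 :: "real \<Rightarrow> real"
  assumes c_in: "-1/2 < c" "c < 1/2"
    and k_nn: "0 \<le> k"
    and G_maps: "\<And>x y. x \<in> Iv \<Longrightarrow> y \<in> Iv \<Longrightarrow> G x y \<in> Iv"
    and hyp1: "\<And>x1 x2 y. x1 \<in> Iv \<Longrightarrow> x2 \<in> Iv \<Longrightarrow> y \<in> Iv \<Longrightarrow>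
                 c \<notin> {min x1 x2..max x1 x2} \<Longrightarrow> \<bar>G x1 y - G x2 y\<bar> \<le> k * \<bar>x1 - x2\<bar>"
    and hyp2: "\<And>x y1 y2. x \<in> Iv \<Longrightarrow> y1 \<in> Iv \<Longrightarrow> y2 \<in> Iv \<Longrightarrow>
                 \<bar>G x y1 - G x y2\<bar> \<le> lam * \<bar>y1 - y2\<bar>"
    and lam: "lam < 1"
    and T_onto: "T ` Iv = Iv"
    and T_der_left: "\<And>x. x \<in> {-1/2..<c} \<Longrightarrow>
                 (T has_real_derivative T' x) (at x within {-1/2..<c})"
    and T_der_right: "\<And>x. x \<in> {c<..1/2} \<Longrightarrow>
                 (T has_real_derivative T' x) (at x within {c<..1/2})"
    and T'_cont: "continuous_on {-1/2..<c} T'" "continuous_on {c<..1/2} T'"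
    and T'_gt: "\<And>x. x \<in> Iv - {c} \<Longrightarrow> T' x > 1"
    and T_lim_left: "(T \<longlongrightarrow> 1/2) (at_left c)"
    and T_lim_right: "(T \<longlongrightarrow> -1/2) (at_right c)"
    and T_c: "T c = -1/2"
    and T'_lim: "filterlim T' at_top (at c within Iv)"
    and hyp4: "var_on (Iv - {c}) (\<lambda>x. 1 / T' x) < \<infinity>"
    and \<mu>0_prob: "prob_space \<mu>0"
    and \<mu>0_sets: "sets \<mu>0 = sets (restrict_space borel Sigma_sq)"
    and \<mu>0_good: "K_good K \<mu>0"
    and marg: "distr \<mu>0 (restrict_space borel Iv) fst
                 = density (restrict_space lborel Iv) (\<lambda>x. ennreal (f0 x))"
    and f0_bv: "var_on Iv f0 < \<infinity>"
    and C_bound: "\<And>n. \<exists>h. distr (density (restrict_space lborel Iv) (\<lambda>x. ennreal (f0 x)))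
                       (restrict_space lborel Iv) (T ^^ n)
                     = density (restrict_space lborel Iv) (\<lambda>x. ennreal (h x))
                   \<and> var_on Iv h \<le> ereal C"
  shows "\<forall>n. K_good
           (max K ((3 + C + (C + 1) * real_of_ereal (var_on (Iv - {c}) (\<lambda>x. 1 / T' x))
                     + 2 * k * (C + 1)) / (1 - lam)))
           (distr \<mu>0 (restrict_space borel Sigma_sq) ((\<lambda>(x, y). (T x, G x y)) ^^ n))"
proof -
  interpret skew_map T T' c G k lam
    using assms by unfold_locales
  let ?S = "restrict_space borel Sigma_sq :: (real \<times> real) measure"
  define K' where "K' = max K ((3 + C + (C + 1) * V + 2 * k * (C + 1)) / (1 - lam))"
  define \<mu> where "\<mu> n = distr \<mu>0 ?S (F ^^ n)" for n
  have Fn: "F ^^ n \<in> measurable \<mu>0 ?S" for n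
    using funpow_measurable[OF F_measurable] measurable_cong_sets[OF \<mu>0_sets refl] by blast
  have \<mu>: "prob_space (\<mu> n)" "sets (\<mu> n) = sets ?S" for n
    unfolding \<mu>_def using prob_space.prob_space_distr[OF \<mu>0_prob Fn] by auto
  have \<mu>_Suc: "\<mu> (Suc n) = distr (\<mu> n) ?S F" for n
    unfolding \<mu>_def by (simp add: distr_distr[OF F_measurable Fn] o_def)
  have fst0: "fst \<in> measurable \<mu>0 borel_Iv"
    using fst_measurable_square measurable_cong_sets[OF \<mu>0_sets refl] by blast
  \<comment> \<open>Since \<open>F\<close> lies over \<open>T\<close>, the marginal of
    \<open>\<mu> n\<close> is the image under \<open>T ^^ n\<close> of that of
    \<open>\<mu>0\<close>, for which \<open>C_bound\<close> provides a density.\<close>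
  have "\<exists>h. distr (\<mu> n) borel_Iv fst = density (restrict_space lborel Iv) (\<lambda>x. ennreal (h x)) \<and> var_on Iv h \<le> ereal C" for n
  proof -
    have "distr (\<mu> n) borel_Iv fst = distr \<mu>0 borel_Iv (fst \<circ> F ^^ n)"
      unfolding \<mu>_def by (rule distr_distr[OF fst_measurable_square Fn])
    also have "\<dots> = distr \<mu>0 borel_Iv (T ^^ n \<circ> fst)"
      by (rule distr_cong) (auto simp: fst_F_funpow)
    also have "\<dots> = distr (distr \<mu>0 borel_Iv fst) borel_Iv (T ^^ n)"
      by (rule distr_distr[OF funpow_measurable[OF T_measurable] fst0, symmetric])
    also have "\<dots> = distr (density (restrict_space lborel Iv) (\<lambda>x. ennreal (f0 x))) (restrict_space lborel Iv) (T ^^ n)"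
      unfolding marg by (rule distr_cong) (auto simp: sets_restrict_lborel)
    finally show ?thesis using C_bound[of n] by simp
  qed
  then obtain h where h: "\<And>n. distr (\<mu> n) borel_Iv fst = density (restrict_space lborel Iv) (\<lambda>x. ennreal (h n x))"
    "\<And>n. var_on Iv (h n) \<le> ereal C" by metis
  have "[] \<in> incr_seqs Iv" by (simp add: incr_seqs_def)
  then have "0 \<le> var_on Iv (h 0)" unfolding var_on_def by (intro SUP_upper2[of "[]"]) auto
  then have C0: "0 \<le> C" using h(2)[of 0] by (meson ereal_less_eq(5) order_trans)
  obtain \<phi>0 \<nu>0 where good: "leaf_family \<phi>0 \<nu>0" "disintegrates \<mu>0 \<phi>0 \<nu>0" "0 \<le> K"
    "seq_var_le Iv tests (leaf_integral \<phi>0 \<nu>0) K"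
    using \<mu>0_good unfolding K_good_iff by blast
  have \<mu>_0: "\<mu> 0 = \<mu>0"
    unfolding \<mu>_def using distr_id2[OF \<mu>0_sets[symmetric]] by (simp add: id_def)
  have "0 \<le> V" using seq_var_le_nonneg[OF weight_variation zero_in_Iv] .
  \<comment> \<open>This asks that \<open>K'\<close> be at least the fixed point of the affine bound
    on the variation, which the second entry of the maximum ensures.\<close>
  have step: "lam * K' + (C + (1 + C) * V + k * (1 + C)) \<le> K'"
  proof -
    have "(3 + C + (C + 1) * V + 2 * k * (C + 1)) / (1 - lam) \<le> K'" by (simp add: K'_def)
    then have "3 + C + (C + 1) * V + 2 * k * (C + 1) \<le> K' * (1 - lam)" using lam by (simp add: divide_le_eq)
    moreover have "0 \<le> k * (C + 1)" using k_nn C0 by simp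
    ultimately show ?thesis by (simp add: algebra_simps)
  qed
  have "\<exists>\<phi> \<nu>. regular_leaves K' C (\<mu> n) \<phi> \<nu>" for n
  proof (induction n)
    case 0
    \<comment> \<open>The mass of the given disintegration agrees with a density of variation at
      most \<open>C\<close> only almost everywhere, so the initial leaf measures are regularized
      too.\<close>
    let ?D = "{x\<in>Iv. \<phi>0 x = max 0 (h 0 x)}"
    note AE = leaf_mass_eq_density[OF good(1) leaf_mass_measurable[OF good(1,4)] good(2) \<mu>0_sets
        h(1)[of 0, unfolded \<mu>_0] C0 h(2)]
    have "seq_var_le Iv tests (leaf_integral \<phi>0 \<nu>0) K'"
      by (rule seq_var_le_mono[OF good(4)]) (simp add: K'_def)
    then have "seq_var_le ?D tests (leaf_integral \<phi>0 \<nu>0) K'"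
      by (rule seq_var_le_subset) auto
    from regular_leaves_exist[OF good(1,2) AE(1) _ this AE(2)] show ?case
      unfolding \<mu>_0 by auto
  next
    case (Suc n)
    then obtain \<phi> \<nu> where "regular_leaves K' C (\<mu> n) \<phi> \<nu>" by blast
    from regular_leaves_step[OF this \<mu> h(1)[of "Suc n", unfolded \<mu>_Suc] h(2)]
    obtain \<phi>' \<nu>' where "regular_leaves (lam * K' + (C + (1 + C) * V + k * (1 + C))) C (\<mu> (Suc n)) \<phi>' \<nu>'"
      unfolding \<mu>_Suc by blast
    then have "regular_leaves K' C (\<mu> (Suc n)) \<phi>' \<nu>'"
      using seq_var_le_mono[OF _ step] by (auto simp: regular_leaves_def)
    then show ?case by blast
  qed
  then have "K_good K' (\<mu> n)" for n
    unfolding K_good_iff regular_leaves_def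
    using seq_var_le_nonneg[OF _ zero_in_Iv] by blast
  then show ?thesis unfolding K'_def V_def \<mu>_def by blast
qed

end
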